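(* Let $b(y,t)$ have the form $$b(y,t)=\sum_{j=1}^N b_1^j(y)\,b_2^j(t),$$ where the $b_1^j(y)$ are (deterministic) Lipschitz continuous and periodic in $y$, and the $b_2^j(t)$ are stationary centered Gaussian fields such that A1–A6 are satisfied for $b(y,t)$. Let $c^*(\delta)$ be the speed associated with the scaled field $\delta b(y,t)$. Then the constant $$\bar C=\liminf_{\delta\to\infty}\frac{c^*(\delta)}{\delta}\in[0,+\infty)$$ is equal to zero if and only if $b(y,t)\equiv b(t)$, i.e. $b$ is independent of $y$.
   Context: Let $n\ge 2$, $L>0$, $D=[0,L]^{n-1}$. Let $f\in C^1([0,1])$ be a KPP nonlinearity: $f(0)=f(1)=0$, $f(u)>0$ for $u\in(0,1)$, and $f'(0)=\sup_{u\in(0,1)}f(u)/u$. The field: $b=b(y,t,\hat\omega)$, $y\in\mathbb{R}^{n-1}$, $t\ge0$, is a real Gaussian random field on a probability space $(\hat\Omega,\hat{\mathcal F},Q)$ (expectation $E_Q$), periodic in $y$ with period cell $D$, with covariance $\Gamma(y_1,y_2,t_1,t_2)=E_Q[b(y_1,t_1)b(y_2,t_2)]$. Assumptions: A1: for each $\hat\omega$ there is a continuous map $J(\cdot,\hat\omega):[0,\infty)\to C^{0,1}_P(D)$ with $b(\cdot,t,\hat\omega)=J(t,\hat\omega)$, where $C^{0,1}_P(D)$ is the space of Lipschitz continuous functions periodic with period cell $D$. A2: for each $s\ge0$ there is a $Q$-measure preserving $\tau_s:\hat\Omega\to\hat\Omega$ with $b(y,\cdot+s,\hat\omega)=b(y,\cdot,\tau_s\hat\omega)$;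 hence $\Gamma(y_1,y_2,s,t)$ depends only on $y_1,y_2,|t-s|$. A3: for $s>0$, $\tau_s$ is ergodic: any $A\in\hat{\mathcal F}$ invariant under $\tau_s$ has $Q(A)\in\{0,1\}$. A4: $b$ is almost surely continuous in $(y,t)$, $E_Q[b(y,t)]=0$ and $E_Q[b(y,t)^2]\le\sigma^2$ for all $y\in D$, $t\ge0$, for some finite $\sigma$. A5: $\hat\Gamma(r)=\sup_{y_1,y_2}\Gamma(y_1,y_2,0,r)$ is integrable on $[0,\infty)$, with $\int_0^\infty\hat\Gamma(r)\,dr=p_1<\infty$, $p_1>0$. A6: there is a finite $p_2>0$ with $|\Gamma(y_1,y_2,s,t)-\Gamma(y_1,y_3,s,t)|\le p_2|y_3-y_2|\hat\Gamma(|s-t|)$. For $\lambda\in\mathbb{R}$ let $$\rho(\lambda)=\lim_{t\to\infty}\frac1t\log E\left[e^{-\lambda\int_0^t b(y+W_2(s),t-s,\hat\omega)\,ds}\right],$$ where $W_2$ is a standard $(n-1)$-dimensional Wiener process with $W_2(0)=0$, independent of $b$, and $E$ is expectation over $W_2$ with $\hat\omega$ fixed; under A1–A6 this limit exists $Q$-almost surely and is a finite constant independent of $\hat\omega$ and $y$. For the scaled field $\delta b$ ($\delta\ge 0$) set $\mu_\delta(\lambda)=f'(0)+\frac{\lambda^2}{2}+\rho(\delta\lambda)$ and $c^*(\delta)=\inf_{\lambda>0}\mu_\delta(\lambda)/\lambda$. *)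

theory Defs
  imports "HOL-Probability.Probability"
begin

text \<open>
  The transverse space \<open>\<real>\<^sup>n\<^sup>-\<^sup>1\<close> with \<open>n \<ge> 2\<close> is rendered as \<open>real ^ 'd\<close>, so that \<open>n = CARD('d) + 1\<close>.
  Time is a real variable; only values at times \<open>t \<ge> 0\<close> are ever constrained or used.
\<close>

section \<open>KPP nonlinearities\<close>

text \<open>\<open>df\<close> is the derivative of \<open>f\<close> on \<open>[0,1]\<close>, one-sided at the end points.\<close>

definition kpp_nonlinearity :: "(real \<Rightarrow> real) \<Rightarrow> (real \<Rightarrow> real) \<Rightarrow> bool" where
  "kpp_nonlinearity f df \<longleftrightarrow>
     (\<forall>u\<in>{0..1}. (f has_real_derivative df u) (at u within {0..1})) \<and>
     continuous_on {0..1} df \<and>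
     f 0 = 0 \<and> f 1 = 0 \<and> (\<forall>u\<in>{0<..<1}. f u > 0) \<and>
     df 0 = (SUP u\<in>{0<..<1}. f u / u)"

section \<open>Periodic Lipschitz functions\<close>

definition period_cell :: "real \<Rightarrow> (real ^ 'd) set" where
  "period_cell L = {y. \<forall>i. 0 \<le> y $ i \<and> y $ i \<le> L}"

definition cell_periodic :: "real \<Rightarrow> (real ^ 'd \<Rightarrow> real) \<Rightarrow> bool" where
  "cell_periodic L g \<longleftrightarrow> (\<forall>y i. g (y + L *\<^sub>R axis i 1) = g y)"

definition C01_periodic :: "real \<Rightarrow> (real ^ 'd \<Rightarrow> real) set" where
  "C01_periodic L = {g. (\<exists>C. C-lipschitz_on UNIV g) \<and> cell_periodic L g}"

text \<open>Both suprema are finite on \<open>C01_periodic L\<close> when \<open>L > 0\<close>.\<close>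

definition C01_norm :: "(real ^ 'd \<Rightarrow> real) \<Rightarrow> real" where
  "C01_norm g = (SUP y. \<bar>g y\<bar>) + (SUP (y, z)\<in>{(y, z). y \<noteq> z}. \<bar>g y - g z\<bar> / dist y z)"

section \<open>Gaussian, stationary and Wiener processes\<close>

text \<open>Normal laws are allowed to be degenerate (Dirac).\<close>

definition gaussian_rv :: "'o measure \<Rightarrow> ('o \<Rightarrow> real) \<Rightarrow> bool" where
  "gaussian_rv M X \<longleftrightarrow> X \<in> borel_measurable M \<and>
     (\<exists>m. (\<exists>s>0. distributed M lborel X (\<lambda>x. ennreal (normal_density m s x))) \<or>
          (AE w in M. X w = m))"

definition gaussian_process :: "'o measure \<Rightarrow> 'i set \<Rightarrow> ('i \<Rightarrow> 'o \<Rightarrow> real) \<Rightarrow> bool" where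
  "gaussian_process M I X \<longleftrightarrow>
     (\<forall>S c. finite S \<and> S \<subseteq> I \<longrightarrow> gaussian_rv M (\<lambda>w. \<Sum>i\<in>S. c i * X i w))"

definition stationary_process :: "'o measure \<Rightarrow> (real \<Rightarrow> 'o \<Rightarrow> real) \<Rightarrow> bool" where
  "stationary_process M X \<longleftrightarrow>
     (\<forall>t\<ge>0. X t \<in> borel_measurable M) \<and>
     (\<forall>S h. finite S \<and> S \<subseteq> {0..} \<and> h \<ge> 0 \<longrightarrow>
        distr M (PiM S (\<lambda>_. borel)) (\<lambda>w. \<lambda>t\<in>S. X (t + h) w) =
        distr M (PiM S (\<lambda>_. borel)) (\<lambda>w. \<lambda>t\<in>S. X t w))"

text \<open>Standard Wiener process: the product density is that of the centred normal law with
  covariance \<open>(t - s)\<close> times the identity.\<close>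

definition wiener_process :: "'w measure \<Rightarrow> (real \<Rightarrow> 'w \<Rightarrow> real ^ 'd) \<Rightarrow> bool" where
  "wiener_process M W \<longleftrightarrow>
     prob_space M \<and>
     (\<forall>t\<ge>0. W t \<in> borel_measurable M) \<and>
     (\<forall>w\<in>space M. W 0 w = 0) \<and>
     (\<forall>w\<in>space M. continuous_on {0..} (\<lambda>t. W t w)) \<and>
     (\<forall>s t. 0 \<le> s \<and> s < t \<longrightarrow>
        distributed M lborel (\<lambda>w. W t w - W s w)
          (\<lambda>x. ennreal (\<Prod>i\<in>UNIV. normal_density 0 (sqrt (t - s)) (x $ i)))) \<and>
     (\<forall>k (r :: nat \<Rightarrow> real). 0 \<le> r 0 \<and> (\<forall>i<k. r i \<le> r (Suc i)) \<longrightarrow>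
        prob_space.indep_vars M (\<lambda>_. borel) (\<lambda>i w. W (r (Suc i)) w - W (r i) w) {..<k})"

section \<open>The random shear field\<close>

definition field_cov ::
    "'o measure \<Rightarrow> (real ^ 'd \<Rightarrow> real \<Rightarrow> 'o \<Rightarrow> real) \<Rightarrow>
      real ^ 'd \<Rightarrow> real ^ 'd \<Rightarrow> real \<Rightarrow> real \<Rightarrow> real" where
  "field_cov Q b y1 y2 t1 t2 = (\<integral>\<omega>. b y1 t1 \<omega> * b y2 t2 \<omega> \<partial>Q)"

definition field_cov_sup ::
    "'o measure \<Rightarrow> (real ^ 'd \<Rightarrow> real \<Rightarrow> 'o \<Rightarrow> real) \<Rightarrow> real \<Rightarrow> real" where
  "field_cov_sup Q b r = (SUP (y1, y2)\<in>UNIV. field_cov Q b y1 y2 0 r)"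

text \<open>In \<open>A1\<close> the continuous map \<open>J\<close> into the space of periodic Lipschitz functions is
  \<open>t \<mapsto> b(\<cdot>, t, \<omega>)\<close> itself; continuity is with respect to \<open>C01_norm\<close>.
  The constant \<open>p\<^sub>1\<close> is the integral in \<open>A5\<close>.\<close>

locale random_shear_field = prob_space Q
  for Q :: "'o measure" +
  fixes L :: real
    and b :: "real ^ 'd \<Rightarrow> real \<Rightarrow> 'o \<Rightarrow> real"
    and \<tau> :: "real \<Rightarrow> 'o \<Rightarrow> 'o"
  assumes L_pos: "L > 0"
    and gaussian: "gaussian_process Q (UNIV \<times> {0..}) (\<lambda>(y, t). b y t)"
    and A1: "\<forall>\<omega>\<in>space Q. \<forall>t\<ge>0.
               (\<lambda>y. b y t \<omega>) \<in> C01_periodic L \<and>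
               ((\<lambda>s. C01_norm (\<lambda>y. b y s \<omega> - b y t \<omega>)) \<longlongrightarrow> 0) (at t within {0..})"
    and A2: "\<forall>s\<ge>0. \<tau> s \<in> measurable Q Q \<and> distr Q Q (\<tau> s) = Q \<and>
               (\<forall>\<omega>\<in>space Q. \<forall>y. \<forall>t\<ge>0. b y (t + s) \<omega> = b y t (\<tau> s \<omega>))"
    and A3: "\<forall>s>0. \<forall>A\<in>sets Q. \<tau> s -` A \<inter> space Q = A \<longrightarrow> measure Q A = 0 \<or> measure Q A = 1"
    and A4: "AE \<omega> in Q. continuous_on (UNIV \<times> {0..}) (\<lambda>(y, t). b y t \<omega>)"
            "\<forall>y\<in>period_cell L. \<forall>t\<ge>0. (\<integral>\<omega>. b y t \<omega> \<partial>Q) = 0"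
            "\<exists>\<sigma>. \<forall>y\<in>period_cell L. \<forall>t\<ge>0. (\<integral>\<omega>. (b y t \<omega>)\<^sup>2 \<partial>Q) \<le> \<sigma>\<^sup>2"
    and A5: "set_integrable lborel {0..} (field_cov_sup Q b)"
            "(LINT r:{0..}|lborel. field_cov_sup Q b r) > 0"
    and A6: "\<exists>p2>0. \<forall>y1 y2 y3. \<forall>s\<ge>0. \<forall>t\<ge>0.
               \<bar>field_cov Q b y1 y2 s t - field_cov Q b y1 y3 s t\<bar>
                 \<le> p2 * dist y3 y2 * field_cov_sup Q b \<bar>s - t\<bar>"

section \<open>The exponent and the front speed\<close>

text \<open>The sample point \<open>\<omega>\<close> of the field is kept fixed and the Wiener process lives on a
  probability space \<open>M\<close> of its own, so it is independent of the field.\<close>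

definition feynman_kac ::
    "'w measure \<Rightarrow> (real \<Rightarrow> 'w \<Rightarrow> real ^ 'd) \<Rightarrow> (real ^ 'd \<Rightarrow> real \<Rightarrow> 'o \<Rightarrow> real) \<Rightarrow>
      real \<Rightarrow> real ^ 'd \<Rightarrow> real \<Rightarrow> 'o \<Rightarrow> real" where
  "feynman_kac M W b lam y t \<omega> =
     (\<integral>w. exp (- lam * (LINT s:{0..t}|lborel. b (y + W s w) (t - s) \<omega>)) \<partial>M)"

text \<open>The deterministic almost sure limit, common to all starting points \<open>y\<close>.\<close>

definition rho ::
    "'o measure \<Rightarrow> 'w measure \<Rightarrow> (real \<Rightarrow> 'w \<Rightarrow> real ^ 'd) \<Rightarrow>
      (real ^ 'd \<Rightarrow> real \<Rightarrow> 'o \<Rightarrow> real) \<Rightarrow> real \<Rightarrow> real" where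
  "rho Q M W b lam =
     (THE r. AE \<omega> in Q. \<forall>y. ((\<lambda>t. 1 / t * ln (feynman_kac M W b lam y t \<omega>)) \<longlongrightarrow> r) at_top)"

text \<open>\<open>a\<close> stands for \<open>f'(0)\<close>.\<close>

definition mu_scaled ::
    "real \<Rightarrow> 'o measure \<Rightarrow> 'w measure \<Rightarrow> (real \<Rightarrow> 'w \<Rightarrow> real ^ 'd) \<Rightarrow>
      (real ^ 'd \<Rightarrow> real \<Rightarrow> 'o \<Rightarrow> real) \<Rightarrow> real \<Rightarrow> real \<Rightarrow> real" where
  "mu_scaled a Q M W b \<delta> lam = a + lam\<^sup>2 / 2 + rho Q M W b (\<delta> * lam)"

definition front_speed ::
    "real \<Rightarrow> 'o measure \<Rightarrow> 'w measure \<Rightarrow> (real \<Rightarrow> 'w \<Rightarrow> real ^ 'd) \<Rightarrow>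
      (real ^ 'd \<Rightarrow> real \<Rightarrow> 'o \<Rightarrow> real) \<Rightarrow> real \<Rightarrow> real" where
  "front_speed a Q M W b \<delta> = (INF lam\<in>{0<..}. mu_scaled a Q M W b \<delta> lam / lam)"

definition speed_ratio_liminf ::
    "real \<Rightarrow> 'o measure \<Rightarrow> 'w measure \<Rightarrow> (real \<Rightarrow> 'w \<Rightarrow> real ^ 'd) \<Rightarrow>
      (real ^ 'd \<Rightarrow> real \<Rightarrow> 'o \<Rightarrow> real) \<Rightarrow> ereal" where
  "speed_ratio_liminf a Q M W b = Liminf at_top (\<lambda>\<delta>. ereal (front_speed a Q M W b \<delta> / \<delta>))"

end

theory Submission
  imports Defs
begin

text \<open>
  Let \<open>u\<close> be the Feynman--Kac expectation for the potential \<open>V = - lam * b\<close>; the exponent \<open>\<rho> lam\<close> is its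
  exponential growth rate. In terms of \<open>m = \<delta> * lam\<close> the speed divided by \<open>\<delta>\<close> is the infimum over \<open>m > 0\<close> of
  \<open>(a + m\<^sup>2 / (2 * \<delta>\<^sup>2) + \<rho> m) / m\<close> with \<open>a = df 0 > 0\<close>. Everything follows from three properties of the exponent:
  \<open>\<rho>\<close> is nonnegative, \<open>\<rho> (p * lam) \<ge> p * \<rho> lam\<close> for \<open>p \<ge> 1\<close> (Jensen), and \<open>\<rho> 1 = 0\<close> exactly for a field
  without dependence on \<open>y\<close>, in which case \<open>\<rho>\<close> vanishes identically. If \<open>\<rho> = 0\<close>, the choice \<open>lam = 1\<close> bounds
  the ratio by \<open>(a + 1 / 2) / \<delta>\<close>; otherwise the ratio is at least \<open>min a (\<rho> 1) > 0\<close> (\<open>speed_ratio_ge\<close>).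

  The exponent is defined as an almost sure limit, so its existence is part of the proof. By a Harnack
  inequality (\<open>harnack\<close>) the solution is constant in space up to a factor that involves only the last two units of
  time. Therefore \<open>ln u\<close> is almost additive along the time shift (\<open>fk1_almost_additive\<close>), with an error per step
  that is stationary and whose mean does not depend on the length \<open>T\<close> of the steps. Birkhoff's theorem for the
  single map \<open>\<tau> T\<close> confines \<open>ln u / t\<close> to a window of width of order \<open>1 / T\<close>, and \<open>T\<close> is arbitrary (\<open>rho_limit\<close>).
  The separated form of the field enters through \<open>finite_interpolation\<close>: the field is a combination, with bounded
  Lipschitz weights, of its values at finitely many points, which gives an integrable bound for its supremum.

  For the positivity of \<open>\<rho> 1\<close>, a Wiener path of duration \<open>r + h\<close> is cut into pieces of durations \<open>r\<close> and \<open>h\<close>.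
  Gluing them in the opposite order changes neither the law nor the end point of the path, but it changes
  the action from \<open>a\<close> to \<open>a'\<close>. Symmetrizing before applying Jensen's inequality yields an extra term
  \<open>ln (cosh ((a - a') / 2)) \<ge> 0\<close> (\<open>fk_swap_jensen\<close>). When the starting point is averaged over a period cell, which
  is invariant under translations, all other terms telescope or have mean 0, so \<open>(r + h) * \<rho> 1\<close> is at least
  the mean of this gain (\<open>rho_ge_mean_gap\<close>). If the field at time 0 depends on \<open>y\<close>, a piece of duration \<open>r\<close>
  that hardly moves and a jump of duration \<open>h = r * r\<close> between two places with different values of the
  field make \<open>a - a'\<close> of order \<open>r\<close> with positive probability, so the gain is positive for some small \<open>r\<close>
  (\<open>swap_gap_pos\<close>).
\<close>

section \<open>The ergodic theorem\<close>

text \<open>The set on which the partial sums are unbounded is invariant, so it is null or of full measure. The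
running maxima \<open>R n\<close> of the sums satisfy \<open>R (Suc n) = max 0 (f + R n \<circ> T)\<close>; on this set the
differences \<open>R (Suc n) - R n \<circ> T\<close> decrease to \<open>f\<close>, while their means are nonnegative. Full measure
would therefore force the mean of \<open>f\<close> to be nonnegative.\<close>

lemma (in prob_space) ergodic_sums_bounded_above:
  fixes f :: "'a \<Rightarrow> real"
  assumes T: "T \<in> measurable M M" and mp: "distr M M T = M"
    and erg: "\<And>A. A \<in> sets M \<Longrightarrow> T -` A \<inter> space M = A \<Longrightarrow> measure M A = 0 \<or> measure M A = 1"
    and f: "integrable M f" and neg: "(\<integral>x. f x \<partial>M) < 0"
  shows "AE x in M. \<exists>B. \<forall>n. (\<Sum>k<n. f ((T ^^ k) x)) \<le> B"
proof -
  have [measurable]: "T \<in> measurable M M" "f \<in> borel_measurable M" using T f by auto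
  have Tk [measurable]: "(T ^^ k) \<in> measurable M M" for k
    by (induction k) auto
  have sp: "T x \<in> space M" if "x \<in> space M" for x using T that by (rule measurable_space)
  define S where "S n x = (\<Sum>k<n. f ((T ^^ k) x))" for n x
  have S_meas [measurable]: "S n \<in> borel_measurable M" for n unfolding S_def by measurable
  have S_Suc: "S (Suc n) x = f x + S n (T x)" for n x
    unfolding S_def by (subst sum.lessThan_Suc_shift) (simp add: funpow_swap1)
  define R where "R n x = Max ((\<lambda>k. S k x) ` {..n})" for n x
  have R_meas [measurable]: "R n \<in> borel_measurable M" for n
    unfolding R_def by measurable
  have R_0: "R 0 x = 0" for x by (simp add: R_def S_def)
  have R_rec: "R (Suc n) x = max 0 (f x + R n (T x))" for n x
  proof -
    have "R (Suc n) x = Max ((\<lambda>k. S k x) ` insert 0 (Suc ` {..n}))"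
      unfolding R_def atMost_Suc_eq_insert_0 ..
    also have "\<dots> = max (S 0 x) (Max ((\<lambda>k. S k x) ` Suc ` {..n}))"
      by (simp add: image_image)
    also have "(\<lambda>k. S k x) ` Suc ` {..n} = (\<lambda>v. f x + v) ` (\<lambda>k. S k (T x)) ` {..n}"
      by (simp add: image_image S_Suc)
    also have "Max \<dots> = f x + R n (T x)"
      unfolding R_def by (subst mono_Max_commute[symmetric]) (auto simp: mono_def)
    finally show ?thesis by (simp add: S_def)
  qed
  have R_mono: "R n x \<le> R (Suc n) x" for n x
    unfolding R_def by (intro Max_mono) auto
  have R_nonneg: "0 \<le> R n x" for n x
    using R_rec[of "n - 1" x] R_0[of x] by (cases n) auto
  have int_T: "integrable M (\<lambda>x. g (T x))" "(\<integral>x. g (T x) \<partial>M) = (\<integral>x. g x \<partial>M)"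
    if "integrable M g" for g :: "'a \<Rightarrow> real"
  proof -
    have [measurable]: "g \<in> borel_measurable M" using that by auto
    show "integrable M (\<lambda>x. g (T x))"
      using that by (subst integrable_distr_eq[OF T, symmetric]) (auto simp: mp)
    show "(\<integral>x. g (T x) \<partial>M) = (\<integral>x. g x \<partial>M)"
      using integral_distr[OF T, of g] by (simp add: mp)
  qed
  have R_int: "integrable M (R n)" for n
  proof (induction n)
    case 0 then show ?case by (simp add: R_0)
  next
    case (Suc n)
    have "integrable M (\<lambda>x. max 0 (f x + R n (T x)))"
      using f int_T(1)[OF Suc] by auto
    then show ?case by (simp add: R_rec)
  qed
  define A where "A = {x \<in> space M. \<forall>m::nat. \<exists>n. S n x > m}"
  have A_sets [measurable]: "A \<in> sets M" unfolding A_def by measurable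
  have A_inv: "T -` A \<inter> space M = A"
  proof (intro set_eqI iffI)
    fix x assume x: "x \<in> T -` A \<inter> space M"
    have "\<exists>n. S n x > real m" for m
    proof -
      obtain k where k: "real k > real m - f x" using reals_Archimedean2 by blast
      obtain n where "S n (T x) > k" using x unfolding A_def by auto
      then show ?thesis using k by (intro exI[of _ "Suc n"]) (simp add: S_Suc)
    qed
    then show "x \<in> A" using x by (auto simp: A_def)
  next
    fix x assume x: "x \<in> A"
    have "\<exists>n. S n (T x) > real m" for m
    proof -
      obtain k where k: "real k > max 0 (real m + f x)" using reals_Archimedean2 by blast
      obtain n where n: "S n x > k" using x unfolding A_def by auto
      then have "n \<noteq> 0" by (auto simp: S_def intro!: gr0I)
      then obtain n' where "n = Suc n'" using not0_implies_Suc by blast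
      then show ?thesis using k n by (intro exI[of _ n']) (simp add: S_Suc)
    qed
    then show "x \<in> T -` A \<inter> space M" using x sp by (auto simp: A_def)
  qed
  have "prob A = 0"
  proof (rule ccontr)
    assume "prob A \<noteq> 0"
    then have A1: "prob A = 1" using erg[OF A_sets A_inv] by auto
    then have AE_A: "AE x in M. x \<in> A" by (simp add: prob_eq_1)
    define d where "d n x = R (Suc n) x - R n (T x)" for n x
    have d_eq: "d n x = max (- R n (T x)) (f x)" for n x
      unfolding d_def R_rec by simp
    have "(\<lambda>n. \<integral>x. d n x \<partial>M) \<longlonglongrightarrow> (\<integral>x. f x \<partial>M)"
    proof (rule integral_dominated_convergence[where w = "\<lambda>x. \<bar>f x\<bar>"])
      show "AE x in M. norm (d n x) \<le> \<bar>f x\<bar>" for n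
      proof (intro AE_I2)
        fix x show "norm (d n x) \<le> \<bar>f x\<bar>"
          using R_nonneg[of n "T x"] by (auto simp: d_eq)
      qed
      show "AE x in M. (\<lambda>n. d n x) \<longlonglongrightarrow> f x"
        using AE_A
      proof (eventually_elim)
        fix x assume "x \<in> A"
        then have "T x \<in> A" using A_inv by blast
        obtain m :: nat where m: "real m > - f x" using reals_Archimedean2 by blast
        obtain n where n: "S n (T x) > m" using \<open>T x \<in> A\<close> unfolding A_def by auto
        have "d k x = f x" if "k \<ge> n" for k
        proof -
          have "S n (T x) \<le> R k (T x)" unfolding R_def using that by (intro Max_ge) auto
          then show ?thesis using m n by (simp add: d_eq)
        qed
        then show "(\<lambda>n. d n x) \<longlonglongrightarrow> f x"
          by (intro tendsto_eventually) (auto simp: eventually_sequentially)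
      qed
      show "integrable M (\<lambda>x. \<bar>f x\<bar>)" using f by auto
    qed (auto simp: d_def)
    \<comment> \<open>\<open>T\<close> preserves the measure, so \<open>R n \<circ> T\<close> has the same mean as \<open>R n \<le> R (Suc n)\<close>.\<close>
    moreover have "0 \<le> (\<integral>x. d n x \<partial>M)" for n
    proof -
      have "(\<integral>x. d n x \<partial>M) = (\<integral>x. R (Suc n) x \<partial>M) - (\<integral>x. R n x \<partial>M)"
        unfolding d_def using R_int int_T[OF R_int] by (subst Bochner_Integration.integral_diff) auto
      also have "\<dots> \<ge> 0" using R_mono R_int by (simp add: integral_mono)
      finally show ?thesis .
    qed
    ultimately have "0 \<le> (\<integral>x. f x \<partial>M)"
      by (intro LIMSEQ_le_const) auto
    then show False using neg by simp
  qed
  then have "AE x in M. x \<notin> A" by (simp add: prob_eq_0)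
  moreover have "AE x in M. x \<in> space M" by simp
  ultimately show ?thesis
  proof eventually_elim
    case (elim x)
    then obtain m :: nat where "\<forall>n. S n x \<le> m" unfolding A_def by (auto simp: not_less)
    then show ?case unfolding S_def by blast
  qed
qed

lemma (in prob_space) ergodic_average_upper:
  fixes f :: "'a \<Rightarrow> real"
  assumes T: "T \<in> measurable M M" and mp: "distr M M T = M"
    and erg: "\<And>A. A \<in> sets M \<Longrightarrow> T -` A \<inter> space M = A \<Longrightarrow> measure M A = 0 \<or> measure M A = 1"
    and f: "integrable M f"
  shows "AE x in M. \<forall>e>0. \<forall>\<^sub>F n in sequentially. (\<Sum>k<n. f ((T ^^ k) x)) / n < (\<integral>x. f x \<partial>M) + e"
proof -
  define I where "I = (\<integral>x. f x \<partial>M)"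
  have "AE x in M. \<forall>m::nat. \<exists>B. \<forall>n. (\<Sum>k<n. f ((T ^^ k) x) - (I + 1 / Suc m)) \<le> B"
  proof (subst AE_all_countable, intro allI)
    fix m :: nat
    show "AE x in M. \<exists>B. \<forall>n. (\<Sum>k<n. f ((T ^^ k) x) - (I + 1 / Suc m)) \<le> B"
      by (rule ergodic_sums_bounded_above[OF T mp erg])
         (use f in \<open>auto simp: prob_space I_def add_pos_pos\<close>)
  qed
  then show ?thesis
  proof eventually_elim
    case (elim x)
    show ?case
    proof (intro allI impI)
      fix e :: real assume "e > 0"
      then obtain m where m: "1 / Suc m < e / 2"
        using reals_Archimedean[of "e/2"] by (auto simp: inverse_eq_divide)
      obtain B where B: "\<And>n. (\<Sum>k<n. f ((T ^^ k) x) - (I + 1 / Suc m)) \<le> B"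
        using elim by blast
      have "\<forall>\<^sub>F n in sequentially. real n > 2 * \<bar>B\<bar> / e"
        by (rule eventually_compose_filterlim[OF eventually_gt_at_top filterlim_real_sequentially])
      then show "\<forall>\<^sub>F n in sequentially. (\<Sum>k<n. f ((T ^^ k) x)) / n < (\<integral>x. f x \<partial>M) + e"
        using eventually_gt_at_top[of 0]
      proof eventually_elim
        case (elim n)
        have "(\<Sum>k<n. f ((T ^^ k) x)) \<le> B + n * (I + 1 / Suc m)"
          using B[of n] by (simp add: sum_subtractf)
        also have "\<dots> < n * (e / 2) + n * (I + e / 2)"
        proof (intro add_less_le_mono mult_left_mono)
          show "B < n * (e/2)" using elim \<open>e > 0\<close> by (auto simp: field_simps)
        qed (use m in auto)
        also have "\<dots> = n * (I + e)" by (simp add: field_simps)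
        finally show ?case using elim by (simp add: I_def field_simps)
      qed
    qed
  qed
qed

theorem (in prob_space) ergodic_average_tendsto:
  fixes f :: "'a \<Rightarrow> real"
  assumes T: "T \<in> measurable M M" and mp: "distr M M T = M"
    and erg: "\<And>A. A \<in> sets M \<Longrightarrow> T -` A \<inter> space M = A \<Longrightarrow> measure M A = 0 \<or> measure M A = 1"
    and f: "integrable M f"
  shows "AE x in M. (\<lambda>n. (\<Sum>k<n. f ((T ^^ k) x)) / n) \<longlonglongrightarrow> (\<integral>x. f x \<partial>M)"
proof -
  have up: "AE x in M. \<forall>e>0. \<forall>\<^sub>F n in sequentially. (\<Sum>k<n. g ((T ^^ k) x)) / n < (\<integral>x. g x \<partial>M) + e"
    if "integrable M g" for g
    by (rule ergodic_average_upper[OF T mp _ that]) (use erg in blast)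
  show ?thesis
    using up[OF f] up[OF Bochner_Integration.integrable_minus[OF f]]
  proof eventually_elim
  case (elim x)
  show ?case
  proof (rule order_tendstoI)
    fix a assume "a < (\<integral>x. f x \<partial>M)"
    then have "\<forall>\<^sub>F n in sequentially. (\<Sum>k<n. - f ((T ^^ k) x)) / n < (\<integral>x. - f x \<partial>M) + ((\<integral>x. f x \<partial>M) - a)"
      using elim(2) by (meson diff_gt_0_iff_gt)
    then show "\<forall>\<^sub>F n in sequentially. a < (\<Sum>k<n. f ((T ^^ k) x)) / n"
      by eventually_elim (simp add: sum_negf)
  next
    fix a assume "a > (\<integral>x. f x \<partial>M)"
    then have "\<forall>\<^sub>F n in sequentially. (\<Sum>k<n. f ((T ^^ k) x)) / n < (\<integral>x. f x \<partial>M) + (a - (\<integral>x. f x \<partial>M))"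
      using elim(1) by (meson diff_gt_0_iff_gt)
    then show "\<forall>\<^sub>F n in sequentially. (\<Sum>k<n. f ((T ^^ k) x)) / n < a" by simp
  qed
  qed
qed

section \<open>The Wiener process\<close>

locale wiener = prob_space M for M :: "'w measure" +
  fixes W :: "real \<Rightarrow> 'w \<Rightarrow> real ^ 'd"
  assumes wiener: "wiener_process M W"
begin

lemma W_measurable: "t \<ge> 0 \<Longrightarrow> W t \<in> borel_measurable M"
  and W_0: "w \<in> space M \<Longrightarrow> W 0 w = 0"
  and W_continuous: "w \<in> space M \<Longrightarrow> continuous_on {0..} (\<lambda>t. W t w)"
  and W_increment: "0 \<le> s \<Longrightarrow> s < t \<Longrightarrow>
        distributed M lborel (\<lambda>w. W t w - W s w)
          (\<lambda>x. ennreal (\<Prod>i\<in>UNIV. normal_density 0 (sqrt (t - s)) (x $ i)))"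
  and W_indep: "0 \<le> r 0 \<Longrightarrow> (\<And>i. i < k \<Longrightarrow> r i \<le> r (Suc i)) \<Longrightarrow>
        indep_vars (\<lambda>_. borel) (\<lambda>i w. W (r (Suc i)) w - W (r i) w) {..<k::nat}"
  using wiener unfolding wiener_process_def by blast+

lemma W_telescope:
  assumes "w \<in> space M" "r (0::nat) = (0::real)"
  shows "W (r j) w = (\<Sum>i<j. W (r (Suc i)) w - W (r i) w)"
  using sum_lessThan_telescope[of "\<lambda>i. W (r i) w" j] assms W_0 by simp

end

text \<open>The density of an increment is prescribed over intervals of positive length only; over a degenerate
interval both increments are the constant 0.\<close>

lemma wiener_increment_law_eq:
  fixes W :: "real \<Rightarrow> 'w \<Rightarrow> real ^ 'd" and W' :: "real \<Rightarrow> 'v \<Rightarrow> real ^ 'd"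
  assumes "wiener M W" "wiener M' W'" "0 \<le> s" "s \<le> t" "0 \<le> s'" "t - s = t' - s'"
  shows "distr M borel (\<lambda>w. W t w - W s w) = distr M' borel (\<lambda>w. W' t' w - W' s' w)"
proof -
  interpret A: wiener M W by fact
  interpret B: wiener M' W' by fact
  have [measurable]: "W s \<in> borel_measurable M" "W t \<in> borel_measurable M"
      "W' s' \<in> borel_measurable M'" "W' t' \<in> borel_measurable M'"
    using assms by (auto intro: A.W_measurable B.W_measurable)
  show ?thesis
  proof (cases "s = t")
    case True
    then have [simp]: "s' = t'" using assms by simp
    show ?thesis
    proof (rule measure_eqI)
      fix X :: "(real ^ 'd) set" assume "X \<in> sets (distr M borel (\<lambda>w. W t w - W s w))"
      then show "emeasure (distr M borel (\<lambda>w. W t w - W s w)) X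
          = emeasure (distr M' borel (\<lambda>w. W' t' w - W' s' w)) X"
        using True by (cases "0 \<in> X")
          (auto simp: emeasure_distr A.emeasure_space_1 B.emeasure_space_1 vimage_def)
    qed simp
  next
    case False
    have "distr M borel (\<lambda>w. W t w - W s w) = distr M lborel (\<lambda>w. W t w - W s w)"
      by (rule distr_cong) auto
    also have "\<dots> = density lborel (\<lambda>x. ennreal (\<Prod>i\<in>UNIV. normal_density 0 (sqrt (t - s)) (x $ i)))"
      using A.W_increment[of s t] False assms by (auto simp: distributed_def)
    also have "\<dots> = distr M' lborel (\<lambda>w. W' t' w - W' s' w)"
      using B.W_increment[of s' t'] False assms by (auto simp: distributed_def)
    also have "\<dots> = distr M' borel (\<lambda>w. W' t' w - W' s' w)"
      by (rule distr_cong) auto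
    finally show ?thesis .
  qed
qed

text \<open>An event about finitely many times is an event about the independent increments over a grid that
contains these times. The grid starts at 0, where the process is known, and stops at the last time.\<close>

lemma ex_time_grid:
  assumes "finite J" "J \<subseteq> {0::real..}"
  shows "\<exists>(k::nat) r. mono r \<and> r 0 = 0 \<and> r k = Max (insert 0 J) \<and> (\<forall>s\<in>J. \<exists>i\<le>k. r i = s)"
proof -
  define l where "l = sorted_list_of_set (insert 0 J)"
  have l: "sorted l" "set l = insert 0 J" using assms unfolding l_def
    by (auto simp: sorted_sorted_list_of_set simp del: sorted_list_of_set_insert_remove)
  then have ne: "length l > 0" by auto
  define k where "k = length l - 1"
  then have k: "k < length l" using ne by simp
  define r where "r i = l ! min i k" for i
  have "mono r"
    unfolding r_def by (intro monoI sorted_nth_mono[OF l(1)]) (use k in auto)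
  have mem: "\<exists>i\<le>k. r i = s" if "s \<in> insert 0 J" for s
  proof -
    have "s \<in> set l" using that l(2) by simp
    then obtain i where i: "i < length l" "l ! i = s" unfolding in_set_conv_nth by blast
    then have "i \<le> k" by (simp add: k_def)
    then show ?thesis using i(2) by (intro exI[of _ i]) (simp add: r_def)
  qed
  have rin: "r i \<in> insert 0 J" for i
    using k nth_mem[of "min i k" l] unfolding r_def l(2) by simp
  have "r 0 = 0"
  proof -
    obtain i where "r i = 0" using mem[of 0] by auto
    then have "r 0 \<le> 0" using monoD[OF \<open>mono r\<close>, of 0 i] by simp
    moreover have "r 0 \<ge> 0" using rin[of 0] assms(2) by auto
    ultimately show ?thesis by simp
  qed
  have rk: "r k = Max (insert 0 J)"
  proof (rule Max_eqI[symmetric])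
    fix y assume "y \<in> insert 0 J"
    then obtain i where "i \<le> k" "r i = y" using mem by blast
    then show "y \<le> r k" using monoD[OF \<open>mono r\<close>, of i k] by simp
  qed (use assms rin in auto)
  show ?thesis
    using \<open>mono r\<close> \<open>r 0 = 0\<close> rk mem by blast
qed

lemma floor_grid_tendsto: "(\<lambda>n. real_of_int \<lfloor>real (Suc n) * t\<rfloor> / real (Suc n)) \<longlonglongrightarrow> t"
proof (rule tendsto_sandwich)
  let ?q = "\<lambda>n. real_of_int \<lfloor>real (Suc n) * t\<rfloor> / real (Suc n)"
  show "\<forall>\<^sub>F n in sequentially. t - 1 / Suc n \<le> ?q n"
  proof (intro always_eventually allI)
    fix n
    have "real (Suc n) * t - 1 \<le> of_int \<lfloor>real (Suc n) * t\<rfloor>" by linarith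
    then have "(real (Suc n) * t - 1) / Suc n \<le> ?q n" by (intro divide_right_mono) auto
    moreover have "(real (Suc n) * t - 1) / Suc n = t - 1 / Suc n"
      by (simp add: diff_divide_distrib del: of_nat_Suc)
    ultimately show "t - 1 / Suc n \<le> ?q n" by simp
  qed
  show "\<forall>\<^sub>F n in sequentially. ?q n \<le> t"
  proof (intro always_eventually allI)
    fix n
    have "of_int \<lfloor>real (Suc n) * t\<rfloor> \<le> real (Suc n) * t" by linarith
    then have "?q n \<le> (real (Suc n) * t) / Suc n" by (intro divide_right_mono) auto
    then show "?q n \<le> t" by simp
  qed
  show "(\<lambda>n. t - 1 / Suc n) \<longlonglongrightarrow> t"
    using tendsto_diff[OF tendsto_const LIMSEQ_Suc[OF lim_1_over_n], of t] by simp
qed auto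

abbreviation path_space :: "(real \<Rightarrow> real ^ 'd) measure" where
  "path_space \<equiv> PiM {0..} (\<lambda>_. borel)"

text \<open>A path is reconstructed from its values on a countable set of times, because this makes evaluation
jointly measurable in path and time; evaluation itself is not.\<close>

definition path_at :: "(real \<Rightarrow> real ^ 'd) \<Rightarrow> real \<Rightarrow> real ^ 'd" where
  "path_at x s = lim (\<lambda>n. x (real (nat \<lfloor>real (Suc n) * s\<rfloor>) / real (Suc n)))"

lemma path_at_measurable [measurable]:
  "(\<lambda>p. path_at (fst p) (snd p)) \<in> borel_measurable (path_space \<Otimes>\<^sub>M borel)"
proof -
  have "(\<lambda>p. (fst p) (real (nat \<lfloor>real (Suc n) * snd p\<rfloor>) / real (Suc n)))
      \<in> borel_measurable ((path_space :: (real \<Rightarrow> real ^ 'd) measure) \<Otimes>\<^sub>M borel)" for n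
  proof (rule measurable_compose_countable[where f = "\<lambda>i p. (fst p) (real i / real (Suc n))"
        and g = "\<lambda>p. nat \<lfloor>real (Suc n) * snd p\<rfloor>"])
    show "(\<lambda>p. fst p (real i / real (Suc n))) \<in> borel_measurable (path_space \<Otimes>\<^sub>M borel)" for i
      by (rule measurable_compose[OF measurable_fst]) (auto intro!: measurable_component_singleton)
  qed measurable
  then show ?thesis unfolding path_at_def by (rule borel_measurable_lim_metric)
qed

lemma path_at_measurable' [measurable (raw)]:
  assumes "f \<in> measurable N path_space" "g \<in> borel_measurable N"
  shows "(\<lambda>x. path_at (f x) (g x)) \<in> borel_measurable N"
  using measurable_compose[OF measurable_Pair[OF assms] path_at_measurable] by simp

lemma path_at_continuous:
  assumes "continuous_on {0..} x" "s \<ge> 0" "\<And>t. t \<ge> 0 \<Longrightarrow> x' t = x t"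
  shows "path_at x' s = x s"
proof -
  define q where "q n = real (nat \<lfloor>real (Suc n) * s\<rfloor>) / real (Suc n)" for n
  have "q = (\<lambda>n. of_int \<lfloor>real (Suc n) * s\<rfloor> / real (Suc n))"
    using assms(2) unfolding q_def by simp
  then have "q \<longlonglongrightarrow> s" using floor_grid_tendsto[of s] by simp
  moreover have "q n \<ge> 0" for n by (simp add: q_def)
  ultimately have "(\<lambda>n. x (q n)) \<longlonglongrightarrow> x s"
    using continuous_on_tendsto_compose[OF assms(1), of q s sequentially] assms(2) by auto
  then have "(\<lambda>n. x' (q n)) \<longlonglongrightarrow> x s" using assms(3) \<open>\<And>n. q n \<ge> 0\<close> by simp
  then show ?thesis unfolding path_at_def q_def by (rule limI)
qed

context wiener
begin

definition path :: "'w \<Rightarrow> real \<Rightarrow> real ^ 'd" where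
  "path w = (\<lambda>s\<in>{0..}. W s w)"

lemma path_measurable [measurable]: "path \<in> measurable M path_space"
  unfolding path_def by (intro measurable_restrict W_measurable) auto

lemma path_at_path: "w \<in> space M \<Longrightarrow> s \<ge> 0 \<Longrightarrow> path_at (path w) s = W s w"
  by (rule path_at_continuous[OF W_continuous]) (auto simp: path_def)

lemma path_sets_vimage:
  assumes "finite J" "J \<subseteq> {0..}"
  shows "path -` prod_emb {0..} (\<lambda>_. borel) J (Pi\<^sub>E J A) \<inter> space M = {w \<in> space M. \<forall>s\<in>J. W s w \<in> A s}"
  using assms by (fastforce simp: prod_emb_def path_def PiE_iff)

lemma shifted_wiener:
  assumes "r \<ge> 0"
  shows "wiener_process M (\<lambda>s w. W (r + s) w - W r w)"
  unfolding wiener_process_def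
proof (intro conjI allI impI ballI)
  show "prob_space M" by unfold_locales
  show "(\<lambda>w. W (r + t) w - W r w) \<in> borel_measurable M" if "t \<ge> 0" for t
    using that assms by (intro borel_measurable_diff W_measurable) auto
  show "W (r + 0) w - W r w = 0" for w by simp
  show "continuous_on {0..} (\<lambda>t. W (r + t) w - W r w)" if "w \<in> space M" for w
    by (intro continuous_intros continuous_on_compose2[OF W_continuous[OF that]])
       (use assms in auto)
  show "distributed M lborel (\<lambda>w. W (r + t) w - W r w - (W (r + s) w - W r w))
          (\<lambda>x. ennreal (\<Prod>i\<in>UNIV. normal_density 0 (sqrt (t - s)) (x $ i)))"
    if "0 \<le> s \<and> s < t" for s t
    using W_increment[of "r + s" "r + t"] that assms by simp
  fix k :: nat and q :: "nat \<Rightarrow> real"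
  assume "0 \<le> q 0 \<and> (\<forall>i<k. q i \<le> q (Suc i))"
  then show "indep_vars (\<lambda>_. borel)
      (\<lambda>i w. W (r + q (Suc i)) w - W r w - (W (r + q i) w - W r w)) {..<k}"
    using W_indep[of "\<lambda>i. r + q i" k] assms by simp
qed

end

lemma measurable_partial_sum_set:
  fixes A :: "real \<Rightarrow> (real ^ 'd) set"
  assumes "finite J" "\<And>s. s \<in> J \<Longrightarrow> A s \<in> sets borel" "\<And>s. s \<in> J \<Longrightarrow> K s \<subseteq> I"
  shows "{x \<in> space (PiM I (\<lambda>_. borel)). \<forall>s\<in>J. (\<Sum>i\<in>K s. x i) \<in> A s} \<in> sets (PiM I (\<lambda>_. borel))"
proof -
  have "{x \<in> space (PiM I (\<lambda>_. borel)). (\<Sum>i\<in>K s. x i) \<in> A s} \<in> sets (PiM I (\<lambda>_. borel))"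
    if "s \<in> J" for s
  proof -
    have "(\<lambda>x. \<Sum>i\<in>K s. x i) \<in> measurable (PiM I (\<lambda>_. borel :: (real ^ 'd) measure)) borel"
    proof (rule borel_measurable_sum)
      show "(\<lambda>x. x i) \<in> borel_measurable (PiM I (\<lambda>_. borel :: (real ^ 'd) measure))" if "i \<in> K s" for i
        using assms(3)[OF \<open>s \<in> J\<close>] that by (intro measurable_component_singleton) auto
    qed
    from measurable_sets[OF this assms(2)[OF that]] show ?thesis
      by (simp add: vimage_def Int_def conj_commute)
  qed
  then show ?thesis using assms(1) by (intro sets.sets_Collect_finite_All) auto
qed

text \<open>A cylinder event is an event about the increments over a grid, and these form a product of laws
that depend on the mesh of the grid only.\<close>

lemma wiener_path_law_unique:
  fixes W :: "real \<Rightarrow> 'w \<Rightarrow> real ^ 'd" and W' :: "real \<Rightarrow> 'v \<Rightarrow> real ^ 'd"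
  assumes "wiener M W" "wiener M' W'"
  shows "distr M path_space (wiener.path W) = distr M' path_space (wiener.path W')"
proof -
  interpret A: wiener M W by fact
  interpret B: wiener M' W' by fact
  show ?thesis
  proof (rule measure_eqI_PiM_infinite)
    fix A :: "real \<Rightarrow> (real ^ 'd) set" and J :: "real set"
    assume J: "finite J" "J \<subseteq> {0..}" and AJ: "\<And>i. i \<in> J \<Longrightarrow> A i \<in> sets borel"
    obtain k :: nat and r where r: "mono r" "r 0 = 0" and rmem: "\<And>s. s \<in> J \<Longrightarrow> \<exists>i\<le>k. r i = s"
      using ex_time_grid[OF J] by blast
    from rmem obtain idx where idx: "\<And>s. s \<in> J \<Longrightarrow> idx s \<le> k \<and> r (idx s) = s" by metis
    have r0: "0 \<le> r i" for i using monoD[OF r(1), of 0 i] r(2) by simp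
    have rS: "r i \<le> r (Suc i)" for i using r(1) by (simp add: mono_def)
    let ?I = "{..<Suc k}"
    let ?S = "{x \<in> space (PiM ?I (\<lambda>_. borel :: (real ^ 'd) measure)). \<forall>s\<in>J. (\<Sum>i<idx s. x i) \<in> A s}"
    have S: "?S \<in> sets (PiM ?I (\<lambda>_. borel))"
      by (rule measurable_partial_sum_set[OF J(1) AJ]) (auto dest!: idx)
    have eqn: "emeasure (distr N path_space (wiener.path V)) (prod_emb {0..} (\<lambda>_. borel) J (Pi\<^sub>E J A))
        = emeasure (PiM ?I (\<lambda>i. distr N borel (\<lambda>w. V (r (Suc i)) w - V (r i) w))) ?S"
      if "wiener N V" for N :: "'x measure" and V :: "real \<Rightarrow> 'x \<Rightarrow> real ^ 'd"
    proof -
      interpret C: wiener N V by fact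
      have "emeasure (distr N path_space (wiener.path V)) (prod_emb {0..} (\<lambda>_. borel) J (Pi\<^sub>E J A))
          = emeasure N {w \<in> space N. \<forall>s\<in>J. V s w \<in> A s}"
        using J AJ by (subst emeasure_distr) (auto simp: C.path_sets_vimage intro!: sets_PiM_I)
      also have "{w \<in> space N. \<forall>s\<in>J. V s w \<in> A s}
          = (\<lambda>w. \<lambda>i\<in>?I. V (r (Suc i)) w - V (r i) w) -` ?S \<inter> space N"
      proof -
        have "(\<Sum>i<idx s. (\<lambda>i\<in>?I. V (r (Suc i)) w - V (r i) w) i) = V s w"
          if "s \<in> J" "w \<in> space N" for s w
        proof -
          have "(\<Sum>i<idx s. (\<lambda>i\<in>?I. V (r (Suc i)) w - V (r i) w) i)
              = (\<Sum>i<idx s. V (r (Suc i)) w - V (r i) w)"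
            using idx[OF that(1)] by (intro sum.cong) auto
          also have "\<dots> = V s w" using C.W_telescope[of w r "idx s"] idx[OF that(1)] that r(2) by simp
          finally show ?thesis .
        qed
        then show ?thesis by (auto simp: space_PiM)
      qed
      also have "emeasure N \<dots> = emeasure (distr N (PiM ?I (\<lambda>_. borel))
          (\<lambda>w. \<lambda>i\<in>?I. V (r (Suc i)) w - V (r i) w)) ?S"
        using S by (intro emeasure_distr[symmetric] measurable_restrict borel_measurable_diff
             C.W_measurable r0) auto
      also have "distr N (PiM ?I (\<lambda>_. borel)) (\<lambda>w. \<lambda>i\<in>?I. V (r (Suc i)) w - V (r i) w)
          = PiM ?I (\<lambda>i. distr N borel (\<lambda>w. V (r (Suc i)) w - V (r i) w))"
        by (subst C.indep_vars_iff_distr_eq_PiM'[symmetric])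
           (auto intro!: C.W_indep borel_measurable_diff C.W_measurable r0 rS)
      finally show ?thesis .
    qed
    have "PiM ?I (\<lambda>i. distr M borel (\<lambda>w. W (r (Suc i)) w - W (r i) w))
        = PiM ?I (\<lambda>i. distr M' borel (\<lambda>w. W' (r (Suc i)) w - W' (r i) w))"
      by (intro PiM_cong refl wiener_increment_law_eq assms r0 rS)
    then show "emeasure (distr M path_space (wiener.path W)) (prod_emb {0..} (\<lambda>_. borel) J (Pi\<^sub>E J A))
        = emeasure (distr M' path_space (wiener.path W')) (prod_emb {0..} (\<lambda>_. borel) J (Pi\<^sub>E J A))"
      by (simp add: eqn[OF assms(1)] eqn[OF assms(2)])
  next
    show "finite_measure (distr M path_space (wiener.path W))"
      by (rule A.finite_measure_distr) simp
  qed auto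
qed

context wiener
begin

definition past :: "real \<Rightarrow> 'w \<Rightarrow> real \<Rightarrow> real ^ 'd" where
  "past r w = (\<lambda>s\<in>{0..}. W (min s r) w)"

definition future :: "real \<Rightarrow> 'w \<Rightarrow> real \<Rightarrow> real ^ 'd" where
  "future r w = (\<lambda>s\<in>{0..}. W (r + s) w - W r w)"

lemma past_measurable [measurable]: "r \<ge> 0 \<Longrightarrow> past r \<in> measurable M path_space"
  unfolding past_def by (intro measurable_restrict W_measurable) auto

lemma future_measurable [measurable]: "r \<ge> 0 \<Longrightarrow> future r \<in> measurable M path_space"
  unfolding future_def by (intro measurable_restrict borel_measurable_diff W_measurable) auto

lemma future_law: "r \<ge> 0 \<Longrightarrow> distr M path_space (future r) = distr M path_space path"
proof -
  assume r: "r \<ge> 0"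
  interpret C: wiener M "\<lambda>s w. W (r + s) w - W r w"
    by unfold_locales (rule shifted_wiener[OF r])
  have "C.path = future r" unfolding C.path_def future_def by auto
  then show ?thesis
    using wiener_path_law_unique[OF C.wiener_axioms wiener_axioms] by simp
qed

text \<open>Both events concern the increments over one grid: a grid for the past, which ends at \<open>r\<close>, followed by a
translated grid for the future. They use disjoint blocks of increments.\<close>

lemma past_future_indep_cylinders:
  assumes r: "r \<ge> 0" and J1: "finite J1" "J1 \<subseteq> {0..}" and J2: "finite J2" "J2 \<subseteq> {0..}"
    and A: "\<And>s. s \<in> J1 \<Longrightarrow> A s \<in> sets borel" and B: "\<And>s. s \<in> J2 \<Longrightarrow> B s \<in> sets borel"
  shows "prob ({w \<in> space M. \<forall>s\<in>J1. W (min s r) w \<in> A s} \<inter>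
               {w \<in> space M. \<forall>s\<in>J2. W (r + s) w - W r w \<in> B s})
       = prob {w \<in> space M. \<forall>s\<in>J1. W (min s r) w \<in> A s} *
         prob {w \<in> space M. \<forall>s\<in>J2. W (r + s) w - W r w \<in> B s}"
proof -
  have J1': "finite (insert r ((\<lambda>s. min s r) ` J1))"
    "insert r ((\<lambda>s. min s r) ` J1) \<subseteq> {0..}" using J1 r by auto
  obtain m :: nat and u where u: "mono u" "u 0 = 0"
    "u m = Max (insert 0 (insert r ((\<lambda>s. min s r) ` J1)))"
    "\<And>s. s \<in> insert r ((\<lambda>s. min s r) ` J1) \<Longrightarrow> \<exists>i\<le>m. u i = s"
    using ex_time_grid[OF J1'] by blast
  have um: "u m = r" unfolding u(3) using J1 r by (intro Max_eqI) auto
  obtain i1 where i1: "\<And>s. s \<in> J1 \<Longrightarrow> i1 s \<le> m \<and> u (i1 s) = min s r"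
  proof -
    have "\<forall>s\<in>J1. \<exists>i\<le>m. u i = min s r" using u(4) by simp
    then show ?thesis using that by metis
  qed
  obtain k :: nat and v where v: "mono v" "v 0 = 0" and vmem: "\<And>s. s \<in> J2 \<Longrightarrow> \<exists>i\<le>k. v i = s"
    using ex_time_grid[OF J2] by blast
  from vmem obtain i2 where i2: "\<And>s. s \<in> J2 \<Longrightarrow> i2 s \<le> k \<and> v (i2 s) = s" by metis
  define g where "g i = (if i \<le> m then u i else r + v (i - m))" for i
  have u0: "0 \<le> u i" for i using monoD[OF u(1), of 0 i] u(2) by simp
  have v0: "0 \<le> v i" for i using monoD[OF v(1), of 0 i] v(2) by simp
  have g0: "0 \<le> g i" for i using u0 v0 r by (simp add: g_def)
  have gS: "g i \<le> g (Suc i)" for i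
    using monoD[OF u(1), of i "Suc i"] monoD[OF v(1), of "i - m" "Suc i - m"] v0[of "Suc 0"] um
      monoD[OF u(1), of i m]
    by (auto simp: g_def not_le Suc_diff_le le_Suc_eq)
  have g_late: "g (m + j) = r + v j" for j using um v(2) by (cases j) (auto simp: g_def)
  define X where "X i w = W (g (Suc i)) w - W (g i) w" for i w
  have ind: "indep_vars (\<lambda>_. borel) X {..<m + k}"
    unfolding X_def by (rule W_indep) (use g0 gS in auto)
  let ?A = "{..<m}" and ?B = "{m..<m + k}"
  have iv: "indep_var (PiM ?A (\<lambda>_. borel)) (\<lambda>w. restrict (\<lambda>i. X i w) ?A)
                 (PiM ?B (\<lambda>_. borel)) (\<lambda>w. restrict (\<lambda>i. X i w) ?B)"
    by (rule indep_var_restrict[OF ind]) auto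
  let ?SA = "{x \<in> space (PiM ?A (\<lambda>_. borel :: (real ^ 'd) measure)). \<forall>s\<in>J1. (\<Sum>i<i1 s. x i) \<in> A s}"
  let ?SB = "{x \<in> space (PiM ?B (\<lambda>_. borel :: (real ^ 'd) measure)). \<forall>s\<in>J2. (\<Sum>i\<in>{m..<m + i2 s}. x i) \<in> B s}"
  have SA: "?SA \<in> sets (PiM ?A (\<lambda>_. borel))"
    by (rule measurable_partial_sum_set[OF J1(1) A]) (auto dest!: i1)
  have SB: "?SB \<in> sets (PiM ?B (\<lambda>_. borel))"
    by (rule measurable_partial_sum_set[OF J2(1) B]) (auto dest!: i2)
  have sumA: "(\<Sum>i<i1 s. restrict (\<lambda>i. X i w) ?A i) = W (min s r) w" if "s \<in> J1" "w \<in> space M" for s w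
  proof -
    have "(\<Sum>i<i1 s. restrict (\<lambda>i. X i w) ?A i) = (\<Sum>i<i1 s. X i w)"
      using i1[OF that(1)] by (intro sum.cong) auto
    also have "\<dots> = W (g (i1 s)) w"
      unfolding X_def using u(2) by (subst W_telescope[of w g "i1 s"]) (auto simp: that g_def)
    finally show ?thesis using i1[OF that(1)] by (simp add: g_def)
  qed
  have sumB: "(\<Sum>i\<in>{m..<m + i2 s}. restrict (\<lambda>i. X i w) ?B i) = W (r + s) w - W r w"
    if "s \<in> J2" "w \<in> space M" for s w
  proof -
    have "(\<Sum>i\<in>{m..<m + i2 s}. restrict (\<lambda>i. X i w) ?B i) = (\<Sum>i\<in>{m..<m + i2 s}. X i w)"
      using i2[OF that(1)] by (intro sum.cong) auto
    also have "\<dots> = W (g (m + i2 s)) w - W (g m) w"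
      unfolding X_def by (rule sum_Suc_diff') simp
    finally show ?thesis using i2[OF that(1)] g_late[of 0] g_late[of "i2 s"] v(2) by simp
  qed
  have EA: "{w \<in> space M. \<forall>s\<in>J1. W (min s r) w \<in> A s} = (\<lambda>w. restrict (\<lambda>i. X i w) ?A) -` ?SA \<inter> space M"
    using sumA by (auto simp: space_PiM)
  have EB: "{w \<in> space M. \<forall>s\<in>J2. W (r + s) w - W r w \<in> B s} = (\<lambda>w. restrict (\<lambda>i. X i w) ?B) -` ?SB \<inter> space M"
    using sumB by (auto simp: space_PiM)
  have "{w \<in> space M. \<forall>s\<in>J1. W (min s r) w \<in> A s} \<inter> {w \<in> space M. \<forall>s\<in>J2. W (r + s) w - W r w \<in> B s}
     = (\<lambda>w. (restrict (\<lambda>i. X i w) ?A, restrict (\<lambda>i. X i w) ?B)) -` (?SA \<times> ?SB) \<inter> space M"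
    unfolding EA EB by auto
  with indep_varD[OF iv SA SB] show ?thesis unfolding EA EB by simp
qed

lemma past_future_indep:
  assumes r: "r \<ge> 0"
  shows "indep_var path_space (past r) path_space (future r)"
proof -
  let ?G = "\<lambda>X. {X -` A \<inter> space M |A. A \<in> prod_algebra {0..} (\<lambda>_. borel :: (real ^ 'd) measure)}"
  have gen: "sigma_sets (space M) {X -` A \<inter> space M |A. A \<in> sets path_space} = sigma_sets (space M) (?G X)"
    if "X \<in> measurable M path_space" for X
  proof -
    have X: "X \<in> space M \<rightarrow> (\<Pi>\<^sub>E i\<in>{0..}. space borel)"
      using measurable_space[OF that] by (auto simp: space_PiM)
    show ?thesis
      unfolding sets_PiM sigma_sets_vimage_commute[OF X]
      by (rule sigma_sets_sigma_sets_eq) auto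
  qed
  have stable: "Int_stable (?G X)" for X
  proof (rule Int_stableI)
    fix a b assume "a \<in> ?G X" "b \<in> ?G X"
    then obtain A B where AB: "A \<in> prod_algebra {0..} (\<lambda>_. borel)" "a = X -` A \<inter> space M"
      "B \<in> prod_algebra {0..} (\<lambda>_. borel)" "b = X -` B \<inter> space M" by blast
    then have "A \<inter> B \<in> prod_algebra {0..} (\<lambda>_. borel)"
      using Int_stable_prod_algebra by (blast dest: Int_stableD)
    moreover have "a \<inter> b = X -` (A \<inter> B) \<inter> space M" using AB by auto
    ultimately show "a \<inter> b \<in> ?G X" by blast
  qed
  have sub: "?G X \<subseteq> events" if "X \<in> measurable M path_space" for X
    using measurable_sets[OF that] by (auto simp: sets_PiM)
  have "indep_set (?G (past r)) (?G (future r))"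
    unfolding indep_sets2_eq
  proof (intro conjI ballI)
    show "?G (past r) \<subseteq> events" "?G (future r) \<subseteq> events"
      by (rule sub; use r in measurable)+
    fix a b assume "a \<in> ?G (past r)" "b \<in> ?G (future r)"
    then obtain A B where A: "A \<in> prod_algebra {0..} (\<lambda>_. borel :: (real ^ 'd) measure)"
        and a: "a = past r -` A \<inter> space M"
      and B: "B \<in> prod_algebra {0..} (\<lambda>_. borel :: (real ^ 'd) measure)"
        and b: "b = future r -` B \<inter> space M" by blast
    obtain J1 E1 where 1: "A = prod_emb {0..} (\<lambda>_. borel) J1 (Pi\<^sub>E J1 E1)" "finite J1" "J1 \<subseteq> {0..}"
      "\<And>i. i \<in> J1 \<Longrightarrow> E1 i \<in> sets borel" using prod_algebraE[OF A] by metis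
    obtain J2 E2 where 2: "B = prod_emb {0..} (\<lambda>_. borel) J2 (Pi\<^sub>E J2 E2)" "finite J2" "J2 \<subseteq> {0..}"
      "\<And>i. i \<in> J2 \<Longrightarrow> E2 i \<in> sets borel" using prod_algebraE[OF B] by metis
    have "a = {w \<in> space M. \<forall>s\<in>J1. W (min s r) w \<in> E1 s}"
      unfolding a 1(1) using 1(3) by (fastforce simp: prod_emb_def past_def PiE_iff)
    moreover have "b = {w \<in> space M. \<forall>s\<in>J2. W (r + s) w - W r w \<in> E2 s}"
      unfolding b 2(1) using 2(3) by (fastforce simp: prod_emb_def future_def PiE_iff)
    ultimately show "prob (a \<inter> b) = prob a * prob b"
      using past_future_indep_cylinders[OF r 1(2,3) 2(2,3) 1(4) 2(4)] by simp
  qed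
  then have "indep_set (sigma_sets (space M) (?G (past r))) (sigma_sets (space M) (?G (future r)))"
    by (rule indep_set_sigma_sets[OF _ stable stable])
  then show ?thesis
    unfolding indep_var_eq using r by (simp add: gen)
qed

lemma past_future_law:
  assumes r: "r \<ge> 0"
  shows "distr M (path_space \<Otimes>\<^sub>M path_space) (\<lambda>w. (past r w, future r w))
    = distr M path_space (past r) \<Otimes>\<^sub>M distr M path_space path"
  using past_future_indep[OF r] unfolding indep_var_distribution_eq future_law[OF r] by simp

text \<open>The Markov property in the form used below: a path is its past up to time \<open>r\<close>, continued by the
increments of an independent copy.\<close>

lemma integral_past_future:
  fixes F :: "(real \<Rightarrow> real ^ 'd) \<times> (real \<Rightarrow> real ^ 'd) \<Rightarrow> real"
  assumes r: "r \<ge> 0" and F [measurable]: "F \<in> borel_measurable (path_space \<Otimes>\<^sub>M path_space)"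
  shows "(\<integral>w. F (past r w, future r w) \<partial>M) = (\<integral>p. F (past r (fst p), path (snd p)) \<partial>(M \<Otimes>\<^sub>M M))"
proof -
  note [measurable] = past_measurable[OF r] future_measurable[OF r]
  have "(\<integral>w. F (past r w, future r w) \<partial>M)
      = (\<integral>x. F x \<partial>distr M (path_space \<Otimes>\<^sub>M path_space) (\<lambda>w. (past r w, future r w)))"
    by (rule integral_distr[symmetric]) auto
  also have "\<dots> = (\<integral>x. F x \<partial>(distr M path_space (past r) \<Otimes>\<^sub>M distr M path_space path))"
    by (simp add: past_future_law[OF r])
  also have "distr M path_space (past r) \<Otimes>\<^sub>M distr M path_space path
      = distr (M \<Otimes>\<^sub>M M) (path_space \<Otimes>\<^sub>M path_space) (\<lambda>(x, y). (past r x, path y))"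
    by (rule pair_measure_distr)
       (auto intro!: prob_space_imp_sigma_finite prob_space_distr past_measurable r)
  also have "(\<integral>x. F x \<partial>\<dots>) = (\<integral>p. F (past r (fst p), path (snd p)) \<partial>(M \<Otimes>\<^sub>M M))"
    by (subst integral_distr) (auto simp: case_prod_beta)
  finally show ?thesis .
qed

end

section \<open>Feynman--Kac functionals of a fixed potential\<close>

lemma LINT_shift:
  fixes f :: "real \<Rightarrow> real"
  shows "(LINT s:{r + a..r + b}|lborel. f s) = (LINT s:{a..b}|lborel. f (r + s))"
proof -
  have "(LINT s:{r + a..r + b}|lborel. f s)
      = (\<integral>s. indicator {r + a..r + b} (r + 1 * s) *\<^sub>R f (r + 1 * s) \<partial>lborel)"
    unfolding set_lebesgue_integral_def by (subst lborel_integral_real_affine[of 1 _ r]) auto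
  also have "\<dots> = (LINT s:{a..b}|lborel. f (r + s))"
    unfolding set_lebesgue_integral_def
    by (intro Bochner_Integration.integral_cong) (auto simp: indicator_def)
  finally show ?thesis .
qed

lemma LINT_combine:
  fixes f :: "real \<Rightarrow> real"
  assumes "a \<le> b" "b \<le> c" "continuous_on {a..c} f"
  shows "(LINT s:{a..c}|lborel. f s) = (LINT s:{a..b}|lborel. f s) + (LINT s:{b..c}|lborel. f s)"
proof -
  have i: "set_integrable lborel {a..c} f" "set_integrable lborel {a..b} f" "set_integrable lborel {b..c} f"
    using assms by (auto intro!: borel_integrable_atLeastAtMost' elim: continuous_on_subset)
  show ?thesis
    using Henstock_Kurzweil_Integration.integral_combine[OF assms(1,2) integrable_continuous_real[OF assms(3)]] i
    by (simp add: set_borel_integral_eq_integral)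
qed

lemma LINT_abs_le:
  fixes f g :: "real \<Rightarrow> real"
  assumes "continuous_on {a..b} f" "continuous_on {a..b} g" "\<And>s. s \<in> {a..b} \<Longrightarrow> \<bar>f s\<bar> \<le> g s"
  shows "\<bar>LINT s:{a..b}|lborel. f s\<bar> \<le> (LINT s:{a..b}|lborel. g s)"
proof -
  have i: "set_integrable lborel {a..b} f" "set_integrable lborel {a..b} g"
    using assms by (auto intro!: borel_integrable_atLeastAtMost')
  have "\<bar>LINT s:{a..b}|lborel. f s\<bar> \<le> (LINT s:{a..b}|lborel. \<bar>f s\<bar>)"
    using set_integral_norm_bound[OF i(1)] by simp
  also have "\<dots> \<le> (LINT s:{a..b}|lborel. g s)"
    using assms(3) i by (intro set_integral_mono) (auto simp: set_integrable_abs)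
  finally show ?thesis .
qed

lemma LINT_reverse:
  fixes f :: "real \<Rightarrow> real"
  shows "(LINT s:{0..t}|lborel. f (t - s)) = (LINT s:{0..t}|lborel. f s)"
proof -
  have "(LINT s:{0..t}|lborel. f s) = (\<integral>s. indicator {0..t} (t + - 1 * s) *\<^sub>R f (t + - 1 * s) \<partial>lborel)"
    unfolding set_lebesgue_integral_def by (subst lborel_integral_real_affine[of "-1" _ t]) auto
  also have "\<dots> = (LINT s:{0..t}|lborel. f (t - s))"
    unfolding set_lebesgue_integral_def
    by (intro Bochner_Integration.integral_cong) (auto simp: indicator_def)
  finally show ?thesis ..
qed

text \<open>The envelope \<open>S\<close> depends on time alone. Hence what the potential can do during a time interval is
bounded by the integral of \<open>S\<close> over that interval, whatever the path.\<close>

definition controlled :: "(real ^ 'd \<Rightarrow> real \<Rightarrow> real) \<Rightarrow> (real \<Rightarrow> real) \<Rightarrow> bool" where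
  "controlled V S \<longleftrightarrow> continuous_on UNIV (\<lambda>p. V (fst p) (snd p)) \<and> continuous_on UNIV S \<and>
     (\<forall>y t. \<bar>V y t\<bar> \<le> S t)"

lemma controlled_bound: "controlled V S \<Longrightarrow> \<bar>V y t\<bar> \<le> S t"
  and controlled_S_nonneg: "controlled V S \<Longrightarrow> 0 \<le> S t"
  unfolding controlled_def by (auto intro: order_trans[OF abs_ge_zero])

lemma controlled_shift: "controlled V S \<Longrightarrow> controlled (\<lambda>y s. V y (t + s)) (\<lambda>s. S (t + s))"
  unfolding controlled_def
  by (auto intro!: continuous_on_compose2[of UNIV "\<lambda>p. V (fst p) (snd p)" _ "\<lambda>p. (fst p, t + snd p)", simplified]
      continuous_on_compose2[of UNIV S] continuous_intros)

lemma controlled_continuous: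
  assumes "controlled V S" "continuous_on A f" "continuous_on A g"
  shows "continuous_on A (\<lambda>x. V (f x) (g x))"
  using continuous_on_compose2[of UNIV "\<lambda>p. V (fst p) (snd p)" A "\<lambda>x. (f x, g x)"] assms
  by (auto simp: controlled_def intro: continuous_on_Pair)

lemma controlled_S_continuous: "controlled V S \<Longrightarrow> continuous_on A f \<Longrightarrow> continuous_on A (\<lambda>x. S (f x))"
  by (rule continuous_on_compose2[of UNIV S]) (auto simp: controlled_def)

lemma controlled_measurable:
  assumes "controlled V S" "f \<in> borel_measurable N" "g \<in> borel_measurable N"
  shows "(\<lambda>x. V (f x) (g x)) \<in> borel_measurable N"
proof -
  have "(\<lambda>p. V (fst p) (snd p)) \<in> borel_measurable borel"
    using assms(1) unfolding controlled_def by (intro borel_measurable_continuous_onI) auto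
  then have "(\<lambda>p. V (fst p) (snd p)) \<in> borel_measurable (borel \<Otimes>\<^sub>M borel)"
    by (simp add: borel_prod)
  from measurable_compose[OF measurable_Pair[OF assms(2,3)] this] show ?thesis by simp
qed

definition budget :: "(real \<Rightarrow> real) \<Rightarrow> real \<Rightarrow> real \<Rightarrow> real" where
  "budget S a b = (LINT s:{a..b}|lborel. S s)"

lemma budget_nonneg: "controlled V S \<Longrightarrow> 0 \<le> budget S a b"
  unfolding budget_def set_lebesgue_integral_def
  by (intro integral_nonneg_AE AE_I2) (auto simp: controlled_S_nonneg)

lemma budget_shift: "budget (\<lambda>s. S (r + s)) a b = budget S (r + a) (r + b)"
  unfolding budget_def LINT_shift ..

lemma budget_combine: "controlled V S \<Longrightarrow> a \<le> b \<Longrightarrow> b \<le> c \<Longrightarrow> budget S a c = budget S a b + budget S b c"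
  unfolding budget_def by (rule LINT_combine) (auto intro: controlled_S_continuous continuous_on_id)

lemma budget_mono: "controlled V S \<Longrightarrow> a \<le> b \<Longrightarrow> b \<le> c \<Longrightarrow> budget S a b \<le> budget S a c"
  using budget_combine[of V S a b c] budget_nonneg[of V S b c] by simp

context wiener
begin

lemma W_cont': "w \<in> space M \<Longrightarrow> continuous_on A f \<Longrightarrow> (\<And>x. x \<in> A \<Longrightarrow> f x \<ge> 0) \<Longrightarrow> continuous_on A (\<lambda>x. W (f x) w)"
  by (rule continuous_on_compose2[OF W_continuous]) auto

text \<open>As a function of \<open>t\<close> and \<open>y\<close> this is the mild solution, with initial value \<open>g\<close>, of the heat equation in which
the time derivative equals half the Laplacian plus multiplication by \<open>V\<close>. Along the path time runs backwards.\<close>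

definition fk :: "(real ^ 'd \<Rightarrow> real \<Rightarrow> real) \<Rightarrow> real \<Rightarrow> (real ^ 'd \<Rightarrow> real) \<Rightarrow> real ^ 'd \<Rightarrow> real" where
  "fk V t g y = (\<integral>w. exp (LINT s:{0..t}|lborel. V (y + W s w) (t - s)) * g (y + W t w) \<partial>M)"

lemma action_measurable:
  assumes V: "controlled V S" and x [measurable]: "x \<in> measurable N path_space"
    and y [measurable]: "y \<in> borel_measurable N"
  shows "(\<lambda>q. LINT s:{0..t}|lborel. V (y q + path_at (x q) s) (c - s)) \<in> borel_measurable N"
proof -
  note [measurable (raw)] = controlled_measurable[OF V]
  show ?thesis unfolding set_lebesgue_integral_def by measurable
qed

lemma action_bound:
  assumes V: "controlled V S" and w: "w \<in> space M" and "0 \<le> t"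
  shows "\<bar>LINT s:{0..t}|lborel. V (y + W s w) (c + t - s)\<bar> \<le> budget S c (c + t)"
proof -
  have "\<bar>LINT s:{0..t}|lborel. V (y + W s w) (c + t - s)\<bar> \<le> (LINT s:{0..t}|lborel. S (c + t - s))"
    by (rule LINT_abs_le)
       (use w in \<open>auto intro!: controlled_bound[OF V] controlled_continuous[OF V] controlled_S_continuous[OF V]
          continuous_intros W_cont'\<close>)
  also have "\<dots> = budget S c (c + t)"
    unfolding budget_def using LINT_shift[of c 0 t S] LINT_reverse[of t "\<lambda>s. S (c + s)"] by (simp add: add_diff_eq)
  finally show ?thesis .
qed

text \<open>Joint measurability is obtained by passing through the path space.\<close>

lemma W_path_measurable:
  assumes V: "controlled V S" and f [measurable]: "f \<in> measurable N M" and y [measurable]: "y \<in> borel_measurable N"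
  shows "(\<lambda>q. LINT s:{0..t}|lborel. V (y q + W s (f q)) (c - s)) \<in> borel_measurable N"
proof -
  have "(\<lambda>q. LINT s:{0..t}|lborel. V (y q + path_at (path (f q)) s) (c - s)) \<in> borel_measurable N"
    by (rule action_measurable[OF V]) measurable
  then show ?thesis
  proof (rule measurable_cong[THEN iffD1, rotated])
    fix q assume "q \<in> space N"
    then have "f q \<in> space M" using f by (rule measurable_space[rotated])
    then show "(LINT s:{0..t}|lborel. V (y q + path_at (path (f q)) s) (c - s))
        = (LINT s:{0..t}|lborel. V (y q + W s (f q)) (c - s))"
      by (intro set_lebesgue_integral_cong) (auto simp: path_at_path)
  qed
qed

lemma W_compose_measurable: "t \<ge> 0 \<Longrightarrow> f \<in> measurable N M \<Longrightarrow> (\<lambda>q. W t (f q)) \<in> borel_measurable N"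
  by (rule measurable_compose[OF _ W_measurable])

lemma fk_integrable:
  assumes V: "controlled V S" and t: "0 \<le> t" and g [measurable]: "g \<in> borel_measurable borel"
    and K: "\<And>x. \<bar>g x\<bar> \<le> K"
  shows "integrable M (\<lambda>w. exp (LINT s:{0..t}|lborel. V (y + W s w) (t - s)) * g (y + W t w))"
proof (rule integrable_const_bound)
  note [measurable (raw)] = W_path_measurable[OF V] W_compose_measurable[OF t]
  show "(\<lambda>w. exp (LINT s:{0..t}|lborel. V (y + W s w) (t - s)) * g (y + W t w)) \<in> borel_measurable M"
    by measurable
  show "AE w in M. norm (exp (LINT s:{0..t}|lborel. V (y + W s w) (t - s)) * g (y + W t w))
      \<le> exp (budget S 0 t) * K"
  proof (intro AE_I2)
    fix w assume w: "w \<in> space M"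
    have "(LINT s:{0..t}|lborel. V (y + W s w) (t - s)) \<le> budget S 0 t"
      using action_bound[OF V w t, of y 0] by simp
    then show "norm (exp (LINT s:{0..t}|lborel. V (y + W s w) (t - s)) * g (y + W t w))
      \<le> exp (budget S 0 t) * K"
      unfolding norm_mult using K by (intro mult_mono) auto
  qed
qed

lemma fk_measurable:
  assumes V: "controlled V S" and t: "0 \<le> t" and g [measurable]: "g \<in> borel_measurable borel"
  shows "fk V t g \<in> borel_measurable borel"
proof -
  note [measurable (raw)] = W_path_measurable[OF V] W_compose_measurable[OF t]
  show ?thesis unfolding fk_def[abs_def] by measurable
qed

lemma fk_mono:
  assumes V: "controlled V S" and t: "0 \<le> t" and [measurable]: "g \<in> borel_measurable borel" "h \<in> borel_measurable borel"
    and K: "\<And>x. \<bar>g x\<bar> \<le> K" "\<And>x. \<bar>h x\<bar> \<le> K" and le: "\<And>x. g x \<le> h x"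
  shows "fk V t g y \<le> fk V t h y"
  unfolding fk_def by (intro integral_mono fk_integrable[OF V t _ K(1)] fk_integrable[OF V t _ K(2)] mult_left_mono le) auto

lemma fk_cmult: "fk V t (\<lambda>x. c * g x) y = c * fk V t g y"
proof -
  have "fk V t (\<lambda>x. c * g x) y
    = (\<integral>w. c * (exp (LINT s:{0..t}|lborel. V (y + W s w) (t - s)) * g (y + W t w)) \<partial>M)"
    unfolding fk_def by (intro Bochner_Integration.integral_cong) (auto simp: mult_ac)
  then show ?thesis by (simp add: fk_def)
qed

lemma controlled_zero: "controlled (\<lambda>_ _. 0) (\<lambda>_. 0)"
  by (auto simp: controlled_def)

lemma fk_between_heat:
  assumes V: "controlled V S" and t: "0 \<le> t" and [measurable]: "g \<in> borel_measurable borel"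
    and K: "\<And>x. \<bar>g x\<bar> \<le> K" and pos: "\<And>x. 0 \<le> g x"
  shows "exp (- budget S 0 t) * (\<integral>w. g (y + W t w) \<partial>M) \<le> fk V t g y"
    and "fk V t g y \<le> exp (budget S 0 t) * (\<integral>w. g (y + W t w) \<partial>M)"
proof -
  have i: "integrable M (\<lambda>w. g (y + W t w))"
    using fk_integrable[OF controlled_zero t, of g K y] K by simp
  have b: "- budget S 0 t \<le> (LINT s:{0..t}|lborel. V (y + W s w) (t - s))"
    "(LINT s:{0..t}|lborel. V (y + W s w) (t - s)) \<le> budget S 0 t" if "w \<in> space M" for w
    using action_bound[OF V that t, of y 0] by auto
  show "exp (- budget S 0 t) * (\<integral>w. g (y + W t w) \<partial>M) \<le> fk V t g y"
    unfolding fk_def integral_mult_right_zero[symmetric]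
    by (rule integral_mono) (use i fk_integrable[OF V t, of g K y] K pos b in \<open>auto intro!: mult_right_mono\<close>)
  show "fk V t g y \<le> exp (budget S 0 t) * (\<integral>w. g (y + W t w) \<partial>M)"
    unfolding fk_def integral_mult_right_zero[symmetric]
    by (rule integral_mono) (use i fk_integrable[OF V t, of g K y] K pos b in \<open>auto intro!: mult_right_mono\<close>)
qed

lemma fk_bounded:
  assumes V: "controlled V S" and t: "0 \<le> t" and [measurable]: "g \<in> borel_measurable borel"
    and K: "\<And>x. \<bar>g x\<bar> \<le> K"
  shows "\<bar>fk V t g y\<bar> \<le> exp (budget S 0 t) * K"
proof -
  have K0: "0 \<le> K" using K[of 0] by linarith
  have c: "fk V t (\<lambda>_. K) y \<le> exp (budget S 0 t) * K" if "0 \<le> K" for K :: real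
    using fk_between_heat(2)[OF V t, of "\<lambda>_. K" K y] that by (simp add: prob_space)
  have "fk V t g y \<le> fk V t (\<lambda>_. K) y"
    by (rule fk_mono[OF V t, of _ _ K]) (use K K0 in \<open>auto simp: abs_le_iff\<close>)
  moreover have "fk V t (\<lambda>x. - 1 * g x) y \<le> fk V t (\<lambda>_. K) y"
    by (rule fk_mono[OF V t, of _ _ K]) (use K K0 in \<open>auto simp: abs_le_iff minus_le_iff\<close>)
  ultimately show ?thesis unfolding fk_cmult using c[OF K0] by linarith
qed

lemma fk_pos:
  assumes V: "controlled V S" and t: "0 \<le> t" and "g \<in> borel_measurable borel"
    and K: "\<And>x. \<bar>g x\<bar> \<le> K" and c: "0 < c" "\<And>x. c \<le> g x"
  shows "exp (- budget S 0 t) * c \<le> fk V t g y" "0 < fk V t g y"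
proof -
  have "c \<le> K" using c(2)[of 0] K[of 0] by linarith
  then have "exp (- budget S 0 t) * c \<le> fk V t (\<lambda>_. c) y"
    using fk_between_heat(1)[OF V t, of "\<lambda>_. c" c y] c(1) by (simp add: prob_space)
  also have "\<dots> \<le> fk V t g y"
    by (rule fk_mono[OF V t, of _ _ K]) (use assms \<open>c \<le> K\<close> in auto)
  finally show "exp (- budget S 0 t) * c \<le> fk V t g y" .
  with c(1) show "0 < fk V t g y"
    by (meson exp_gt_zero less_le_trans mult_pos_pos)
qed

text \<open>The action along a path of duration \<open>r + t\<close> that follows \<open>w\<close> and then repeats the increments of \<open>w'\<close>.\<close>

definition split_action :: "(real ^ 'd \<Rightarrow> real \<Rightarrow> real) \<Rightarrow> real \<Rightarrow> real \<Rightarrow> real ^ 'd \<Rightarrow> 'w \<Rightarrow> 'w \<Rightarrow> real" where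
  "split_action V r t y w w' =
     (LINT s:{0..r}|lborel. V (y + W s w) (r + t - s)) +
     (LINT s:{0..t}|lborel. V (y + W r w + W s w') (t - s))"

lemma split_action_measurable:
  assumes V: "controlled V S" and "0 \<le> r" and [measurable]: "f \<in> measurable N M" "f' \<in> measurable N M"
    "y \<in> borel_measurable N"
  shows "(\<lambda>q. split_action V r t (y q) (f q) (f' q)) \<in> borel_measurable N"
proof -
  note [measurable (raw)] = W_path_measurable[OF V] W_compose_measurable[OF \<open>0 \<le> r\<close>]
  show ?thesis unfolding split_action_def by measurable
qed

lemma split_action_bound:
  assumes V: "controlled V S" and "w \<in> space M" "w' \<in> space M" "0 \<le> r" "0 \<le> t"
  shows "\<bar>split_action V r t y w w'\<bar> \<le> budget S 0 (r + t)"
  using action_bound[OF V assms(2,4), of y t] action_bound[OF V assms(3,5), of "y + W r w" 0]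
    budget_combine[OF V, of 0 t "r + t"] assms(4,5)
  unfolding split_action_def by (simp add: add.commute)

lemma fk_split:
  assumes V: "controlled V S" and r: "0 \<le> r" and t: "0 \<le> t" and g [measurable]: "g \<in> borel_measurable borel"
  shows "fk V (r + t) g y =
    (\<integral>p. exp (split_action V r t y (fst p) (snd p)) * g (y + W r (fst p) + W t (snd p)) \<partial>(M \<Otimes>\<^sub>M M))"
proof -
  define F where "F q = exp ((LINT s:{0..r}|lborel. V (y + path_at (fst q) s) (r + t - s)) +
      (LINT s:{0..t}|lborel. V (y + path_at (fst q) r + path_at (snd q) s) (t - s)))
      * g (y + path_at (fst q) r + path_at (snd q) t)" for q :: "(real \<Rightarrow> real ^ 'd) \<times> (real \<Rightarrow> real ^ 'd)"
  have past: "path_at (past r w) s = W (min s r) w" if "w \<in> space M" "0 \<le> s" for w s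
    by (rule path_at_continuous)
       (use that r in \<open>auto simp: past_def intro!: W_cont' continuous_intros\<close>)
  have future: "path_at (future r w) s = W (r + s) w - W r w" if "w \<in> space M" "0 \<le> s" for w s
    by (rule path_at_continuous)
       (use that r in \<open>auto simp: future_def intro!: W_cont' continuous_intros\<close>)
  have F [measurable]: "F \<in> borel_measurable (path_space \<Otimes>\<^sub>M path_space)"
  proof -
    note [measurable (raw)] = action_measurable[OF V]
    show ?thesis unfolding F_def by measurable
  qed
  have "fk V (r + t) g y = (\<integral>w. F (past r w, future r w) \<partial>M)"
    unfolding fk_def
  proof (rule Bochner_Integration.integral_cong[OF refl])
    fix w assume w: "w \<in> space M"
    let ?f = "\<lambda>s. V (y + W s w) (r + t - s)"
    have "(LINT s:{0..r + t}|lborel. ?f s) = (LINT s:{0..r}|lborel. ?f s) + (LINT s:{r..r + t}|lborel. ?f s)"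
      by (rule LINT_combine) (use r t w in \<open>auto intro!: controlled_continuous[OF V] continuous_intros W_cont'\<close>)
    also have "(LINT s:{r..r + t}|lborel. ?f s) = (LINT s:{0..t}|lborel. V (y + W (r + s) w) (t - s))"
      using LINT_shift[of r 0 t ?f] by simp
    also have "\<dots> = (LINT s:{0..t}|lborel. V (y + path_at (past r w) r + path_at (future r w) s) (t - s))"
      using w r by (intro set_lebesgue_integral_cong) (auto simp: past future)
    also have "(LINT s:{0..r}|lborel. ?f s) = (LINT s:{0..r}|lborel. V (y + path_at (past r w) s) (r + t - s))"
      using w r by (intro set_lebesgue_integral_cong) (auto simp: past)
    finally show "exp (LINT s:{0..r + t}|lborel. ?f s) * g (y + W (r + t) w) = F (past r w, future r w)"
      unfolding F_def using w r t by (simp add: past future)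
  qed
  also have "\<dots> = (\<integral>p. F (past r (fst p), path (snd p)) \<partial>(M \<Otimes>\<^sub>M M))"
    by (rule integral_past_future[OF r F])
  also have "\<dots> = (\<integral>p. exp (split_action V r t y (fst p) (snd p)) * g (y + W r (fst p) + W t (snd p)) \<partial>(M \<Otimes>\<^sub>M M))"
  proof (rule Bochner_Integration.integral_cong[OF refl])
    fix p assume "p \<in> space (M \<Otimes>\<^sub>M M)"
    then have p: "fst p \<in> space M" "snd p \<in> space M" by (auto simp: space_pair_measure)
    have "(LINT s:{0..r}|lborel. V (y + path_at (past r (fst p)) s) (r + t - s))
        = (LINT s:{0..r}|lborel. V (y + W s (fst p)) (r + t - s))"
      using p r by (intro set_lebesgue_integral_cong) (auto simp: past)
    moreover have "(LINT s:{0..t}|lborel. V (y + path_at (past r (fst p)) r + path_at (path (snd p)) s) (t - s))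
        = (LINT s:{0..t}|lborel. V (y + W r (fst p) + W s (snd p)) (t - s))"
      using p r by (intro set_lebesgue_integral_cong) (auto simp: past path_at_path)
    ultimately show "F (past r (fst p), path (snd p))
        = exp (split_action V r t y (fst p) (snd p)) * g (y + W r (fst p) + W t (snd p))"
      unfolding F_def split_action_def using p r t by (simp add: past path_at_path)
  qed
  finally show ?thesis .
qed

sublocale pair: pair_prob_space M M ..

lemma split_integrable:
  assumes V: "controlled V S" and r: "0 \<le> r" and t: "0 \<le> t" and g [measurable]: "g \<in> borel_measurable borel"
    and K: "\<And>x. \<bar>g x\<bar> \<le> K"
  shows "integrable (M \<Otimes>\<^sub>M M) (\<lambda>p. exp (split_action V r t y (fst p) (snd p)) * g (y + W r (fst p) + W t (snd p)))"
proof (rule pair.P.integrable_const_bound)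
  note [measurable (raw)] = split_action_measurable[OF V r] W_compose_measurable[OF r] W_compose_measurable[OF t]
  show "(\<lambda>p. exp (split_action V r t y (fst p) (snd p)) * g (y + W r (fst p) + W t (snd p)))
      \<in> borel_measurable (M \<Otimes>\<^sub>M M)" by measurable
  show "AE p in M \<Otimes>\<^sub>M M. norm (exp (split_action V r t y (fst p) (snd p)) * g (y + W r (fst p) + W t (snd p)))
      \<le> exp (budget S 0 (r + t)) * K"
  proof (intro AE_I2)
    fix p assume "p \<in> space (M \<Otimes>\<^sub>M M)"
    then have p: "fst p \<in> space M" "snd p \<in> space M" by (auto simp: space_pair_measure)
    show "norm (exp (split_action V r t y (fst p) (snd p)) * g (y + W r (fst p) + W t (snd p)))
      \<le> exp (budget S 0 (r + t)) * K"
      unfolding norm_mult using K split_action_bound[OF V p r t, of y] by (intro mult_mono) auto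
  qed
qed

text \<open>Since time runs backwards along the path, the first piece of the path meets the last time interval.\<close>

lemma fk_semigroup:
  assumes V: "controlled V S" and r: "0 \<le> r" and t: "0 \<le> t" and g [measurable]: "g \<in> borel_measurable borel"
    and K: "\<And>x. \<bar>g x\<bar> \<le> K"
  shows "fk V (r + t) g y = fk (\<lambda>y s. V y (t + s)) r (fk V t g) y"
proof -
  let ?F = "\<lambda>w w'. exp (split_action V r t y w w') * g (y + W r w + W t w')"
  have "fk V (r + t) g y = (\<integral>w. (\<integral>w'. ?F w w' \<partial>M) \<partial>M)"
    unfolding fk_split[OF V r t g] using split_integrable[OF V r t g K, of y]
    by (subst pair.integral_fst'[symmetric]) auto
  also have "\<dots> = fk (\<lambda>y s. V y (t + s)) r (fk V t g) y"
    unfolding fk_def split_action_def exp_add mult.assoc integral_mult_right_zero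
    by (simp add: add.assoc algebra_simps)
  finally show ?thesis .
qed

end

section \<open>Periodic functions and averages over a cell\<close>

lemma cell_periodicD: "cell_periodic L g \<Longrightarrow> g (y + L *\<^sub>R axis i 1) = g y"
  by (simp add: cell_periodic_def)

lemma cell_periodic_int:
  assumes "cell_periodic L g"
  shows "g (y + (L * of_int k) *\<^sub>R axis i 1) = g y"
proof -
  have nat: "g (y + (L * of_nat n) *\<^sub>R axis i 1) = g y" for n y
  proof (induction n arbitrary: y)
    case (Suc n)
    have eq: "y + (L * of_nat (Suc n)) *\<^sub>R axis i 1 = (y + L *\<^sub>R axis i 1) + (L * of_nat n) *\<^sub>R axis i 1"
      by (simp add: algebra_simps)
    show ?case unfolding eq Suc[of "y + L *\<^sub>R axis i 1"] by (rule cell_periodicD[OF assms])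
  qed simp
  show ?thesis
  proof (cases k)
    case (nonneg n) then show ?thesis using nat by simp
  next
    case (neg n)
    have "(y + (L * of_int k) *\<^sub>R axis i 1) + (L * of_nat (Suc n)) *\<^sub>R axis i 1 = y"
      using neg by (simp add: scaleR_left_distrib[symmetric] add.assoc) (simp add: algebra_simps)
    then show ?thesis
      using nat[of "y + (L * of_int k) *\<^sub>R axis i 1" "Suc n"] by metis
  qed
qed

lemma vec_eq_sum_axis: "(z :: real ^ 'd) = (\<Sum>i\<in>UNIV. (z $ i) *\<^sub>R axis i 1)"
  using basis_expansion[of z] by (simp add: scalar_mult_eq_scaleR)

lemma cell_periodic_lattice:
  assumes "cell_periodic L (g :: real ^ 'd \<Rightarrow> real)"
  shows "g (y + (\<chi> i. L * of_int (k i))) = g y"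
proof -
  have "g (y + (\<Sum>i\<in>F. (L * of_int (k i)) *\<^sub>R axis i 1)) = g y" if "finite F" for F
    using that
  proof (induction F arbitrary: y)
    case (insert i F)
    have eq: "y + (\<Sum>i\<in>insert i F. (L * of_int (k i)) *\<^sub>R axis i 1)
        = (y + (\<Sum>i\<in>F. (L * of_int (k i)) *\<^sub>R axis i 1)) + (L * of_int (k i)) *\<^sub>R axis i 1"
      using insert by (simp add: algebra_simps)
    show ?case unfolding eq cell_periodic_int[OF assms] by (rule insert.IH)
  qed simp
  from this[of UNIV] show ?thesis
    by (subst vec_eq_sum_axis) simp
qed

lemma open_emeasure_lborel_pos:
  fixes A :: "'a :: euclidean_space set"
  assumes "open A" "A \<noteq> {}"
  shows "0 < emeasure lborel A"
proof (rule ccontr)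
  assume "\<not> ?thesis"
  then have "A \<in> null_sets lborel" using assms by (auto simp: null_sets_def)
  then have "negligible A" by (simp add: negligible_iff_null_sets null_sets_completionI)
  then show False using open_not_negligible[OF assms] by simp
qed

text \<open>The half-open cell is a fundamental domain of the period lattice, which the closed one is not.\<close>

definition half_open_cell :: "real \<Rightarrow> (real ^ 'd) set" where
  "half_open_cell L = {y. \<forall>i. 0 \<le> y $ i \<and> y $ i < L}"

lemma half_open_cell_subset: "half_open_cell L \<subseteq> period_cell L"
  by (auto simp: half_open_cell_def period_cell_def less_imp_le)

definition cell_rep :: "real \<Rightarrow> real ^ 'd \<Rightarrow> real ^ 'd" where
  "cell_rep L y = (\<chi> i. y $ i - L * of_int \<lfloor>y $ i / L\<rfloor>)"

lemma cell_rep_mem: "L > 0 \<Longrightarrow> cell_rep L y \<in> half_open_cell L"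
proof -
  assume L: "L > 0"
  have "0 \<le> a - L * of_int \<lfloor>a / L\<rfloor>" "a - L * of_int \<lfloor>a / L\<rfloor> < L" for a :: real
  proof -
    have "of_int \<lfloor>a / L\<rfloor> \<le> a / L" "a / L < of_int \<lfloor>a / L\<rfloor> + 1" by linarith+
    then show "0 \<le> a - L * of_int \<lfloor>a / L\<rfloor>" "a - L * of_int \<lfloor>a / L\<rfloor> < L"
      using L mult_left_mono[of "of_int \<lfloor>a / L\<rfloor>" "a / L" L] by (auto simp: field_simps)
  qed
  then show ?thesis by (simp add: cell_rep_def half_open_cell_def)
qed

lemma cell_periodic_rep: "cell_periodic L g \<Longrightarrow> g (z + cell_rep L y) = g (z + y)"
proof -
  assume g: "cell_periodic L g"
  have "z + y = (z + cell_rep L y) + (\<chi> i. L * of_int \<lfloor>y $ i / L\<rfloor>)"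
    by (simp add: vec_eq_iff cell_rep_def)
  then show ?thesis using cell_periodic_lattice[OF g] by metis
qed

lemma cell_periodic_rep': "cell_periodic L g \<Longrightarrow> g (cell_rep L y) = g y"
  using cell_periodic_rep[of L g 0 y] by simp

lemma half_open_cell_measurable [measurable]: "half_open_cell L \<in> sets borel"
proof -
  have "half_open_cell L = (\<Inter>i. {y :: real ^ 'd. 0 \<le> y $ i} \<inter> {y. y $ i < L})"
    by (auto simp: half_open_cell_def)
  also have "\<dots> \<in> sets borel"
    by (intro sets.countable_INT'' sets.Int borel_closed borel_open closed_Collect_le open_Collect_less continuous_intros) auto
  finally show ?thesis .
qed

lemma box_subset_half_open_cell: "box 0 (\<chi> i. L) \<subseteq> half_open_cell L"
  by (auto simp: half_open_cell_def mem_box_cart less_imp_le)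

lemma half_open_cell_emeasure:
  assumes "L > 0"
  shows "emeasure lborel (half_open_cell L :: (real ^ 'd) set) \<noteq> 0"
    "emeasure lborel (half_open_cell L :: (real ^ 'd) set) \<noteq> \<infinity>"
proof -
  have "0 < emeasure lborel (box 0 (\<chi> i. L) :: (real ^ 'd) set)"
    using assms by (intro open_emeasure_lborel_pos open_box) (auto simp: interval_eq_empty_cart not_le)
  also have "\<dots> \<le> emeasure lborel (half_open_cell L :: (real ^ 'd) set)"
    by (intro emeasure_mono box_subset_half_open_cell) auto
  finally show "emeasure lborel (half_open_cell L :: (real ^ 'd) set) \<noteq> 0" by simp
  have "emeasure lborel (half_open_cell L :: (real ^ 'd) set) \<le> emeasure lborel (cbox 0 (\<chi> i. L) :: (real ^ 'd) set)"
    by (intro emeasure_mono) (auto simp: half_open_cell_def mem_box_cart less_imp_le)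
  also have "\<dots> < \<infinity>" by (simp add: emeasure_lborel_cbox_eq)
  finally show "emeasure lborel (half_open_cell L :: (real ^ 'd) set) \<noteq> \<infinity>" by simp
qed

definition cell_unif :: "real \<Rightarrow> (real ^ 'd) measure" where
  "cell_unif L = uniform_measure lborel (half_open_cell L)"

lemma sets_cell_unif [simp, measurable_cong]: "sets (cell_unif L) = sets borel"
  and space_cell_unif [simp]: "space (cell_unif L) = UNIV"
  by (auto simp: cell_unif_def)

lemma prob_space_cell_unif: "L > 0 \<Longrightarrow> prob_space (cell_unif L)"
  unfolding cell_unif_def using half_open_cell_emeasure by (intro prob_space_uniform_measure) auto

lemma cell_unif_open_pos:
  assumes "open A" "y \<in> A" "y \<in> half_open_cell L" and "L > 0"
  shows "measure (cell_unif L) (A :: (real ^ 'd) set) > 0"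
proof -
  obtain e where e: "e > 0" "ball y e \<subseteq> A" using assms openE by blast
  \<comment> \<open>The point \<open>y\<close> may lie on the boundary of the cell; a step \<open>d\<close> along the diagonal leads into its interior.\<close>
  define d where "d = Min (insert (e / 2 / CARD('d)) (range (\<lambda>i. (L - y $ i) / 2)))"
  have d: "0 < d"
    unfolding d_def using e assms by (subst Min_gr_iff) (auto simp: half_open_cell_def)
  have d_le: "d \<le> e / 2 / CARD('d)" "d \<le> (L - y $ i) / 2" for i
  proof -
    show "d \<le> e / 2 / CARD('d)" unfolding d_def by (rule Min_le) auto
    show "d \<le> (L - y $ i) / 2" unfolding d_def by (rule Min_le) auto
  qed
  let ?z = "y + (\<chi> i. d)"
  have "dist y ?z \<le> (\<Sum>i\<in>UNIV. \<bar>((\<chi> i. d) :: real ^ 'd) $ i\<bar>)"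
    using norm_le_l1_cart[of "(\<chi> i. d) :: real ^ 'd"] by (simp add: dist_norm)
  also have "\<dots> \<le> e / 2" using d d_le(1) by (simp add: field_simps)
  also have "\<dots> < e" using e by simp
  finally have "?z \<in> A" using e(2) by auto
  moreover have "?z \<in> box 0 (\<chi> i. L)"
  proof -
    have "y $ i + d < L" for i
      using d_le(2)[of i] assms(3) by (simp add: half_open_cell_def) (smt (verit) field_sum_of_halves)
    moreover have "0 < y $ i + d" for i
      using d assms(3) by (simp add: half_open_cell_def add_nonneg_pos)
    ultimately show ?thesis by (simp add: mem_box_cart)
  qed
  ultimately have ne: "A \<inter> box 0 (\<chi> i. L) \<noteq> {}" by blast
  have "0 < emeasure lborel (A \<inter> box 0 (\<chi> i. L))"
    by (rule open_emeasure_lborel_pos) (use assms ne in \<open>auto intro: open_Int open_box\<close>)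
  also have "\<dots> \<le> emeasure lborel (half_open_cell L \<inter> A)"
    using box_subset_half_open_cell assms(1) by (intro emeasure_mono) auto
  finally have "emeasure (cell_unif L) A \<noteq> 0"
    unfolding cell_unif_def using assms half_open_cell_emeasure[OF \<open>L > 0\<close>, where 'd = 'd]
    by (simp add: ennreal_divide_eq_0_iff)
  then show ?thesis
    using finite_measure.emeasure_eq_measure[OF prob_space.finite_measure, OF prob_space_cell_unif[OF \<open>L > 0\<close>], of A] by (simp add: zero_less_measure_iff)
qed

text \<open>The average over a cell does not see translations: in each coordinate direction the part of the cell
that leaves it on one side re-enters on the other.\<close>

lemma nn_integral_half_open_cell_axis:
  fixes g :: "real ^ 'd \<Rightarrow> ennreal"
  assumes g [measurable]: "g \<in> borel_measurable borel" and per: "\<And>y. g (y + L *\<^sub>R axis i 1) = g y"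
    and s: "0 \<le> s" "s < L"
  shows "(\<integral>\<^sup>+y. g (y + s *\<^sub>R axis i 1) * indicator (half_open_cell L) y \<partial>lborel)
       = (\<integral>\<^sup>+y. g y * indicator (half_open_cell L) y \<partial>lborel)"
proof -
  have tr: "(\<integral>\<^sup>+y. h (c + y) \<partial>lborel) = (\<integral>\<^sup>+y. h y \<partial>lborel)"
    if [measurable]: "h \<in> borel_measurable borel" for h :: "real ^ 'd \<Rightarrow> ennreal" and c
    by (subst (2) lborel_distr_plus[of c, symmetric]) (auto simp: nn_integral_distr)
  define R where "R a b = {y :: real ^ 'd. (\<forall>j. j \<noteq> i \<longrightarrow> 0 \<le> y $ j \<and> y $ j < L) \<and> a \<le> y $ i \<and> y $ i < b}" for a b
  have R [measurable]: "R a b \<in> sets borel" for a b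
  proof -
    have "R a b = (\<Inter>j. {y :: real ^ 'd. (if j = i then a else 0) \<le> y $ j} \<inter> {y. y $ j < (if j = i then b else L)})"
      by (auto simp: R_def split: if_splits)
    also have "\<dots> \<in> sets borel"
      by (intro sets.countable_INT'' sets.Int borel_closed borel_open closed_Collect_le open_Collect_less continuous_intros) auto
    finally show ?thesis .
  qed
  have mem: "c + y \<in> R a b \<longleftrightarrow> y \<in> R (a - c $ i) (b - c $ i)" if "\<And>j. j \<noteq> i \<Longrightarrow> c $ j = 0" for c y a b
    using that by (auto simp: R_def algebra_simps)
  have mem_s: "y + s *\<^sub>R axis i 1 \<in> R s (L + s) \<longleftrightarrow> y \<in> R 0 L"
    and mem_L: "y + L *\<^sub>R axis i 1 \<in> R L (L + s) \<longleftrightarrow> y \<in> R 0 s" for y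
    using mem[of "s *\<^sub>R axis i 1" y s "L + s"] mem[of "L *\<^sub>R axis i 1" y L "L + s"]
    by (simp_all add: add.commute axis_def)
  have cell: "half_open_cell L = R 0 L" by (force simp: half_open_cell_def R_def)
  have "(\<integral>\<^sup>+y. g (y + s *\<^sub>R axis i 1) * indicator (half_open_cell L) y \<partial>lborel)
      = (\<integral>\<^sup>+y. g (s *\<^sub>R axis i 1 + y) * indicator (R s (L + s)) (s *\<^sub>R axis i 1 + y) \<partial>lborel)"
    unfolding cell by (intro nn_integral_cong arg_cong2[where f = "(*)"])
      (auto simp: indicator_def mem_s add.commute)
  also have "\<dots> = (\<integral>\<^sup>+y. g y * indicator (R s (L + s)) y \<partial>lborel)"
    by (rule tr) simp
  also have "\<dots> = (\<integral>\<^sup>+y. g y * indicator (R s L) y + g y * indicator (R L (L + s)) y \<partial>lborel)"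
    using s by (intro nn_integral_cong) (auto simp: R_def indicator_def)
  also have "\<dots> = (\<integral>\<^sup>+y. g y * indicator (R s L) y \<partial>lborel) + (\<integral>\<^sup>+y. g y * indicator (R L (L + s)) y \<partial>lborel)"
    by (rule nn_integral_add) auto
  also have "(\<integral>\<^sup>+y. g y * indicator (R L (L + s)) y \<partial>lborel)
      = (\<integral>\<^sup>+y. g (L *\<^sub>R axis i 1 + y) * indicator (R L (L + s)) (L *\<^sub>R axis i 1 + y) \<partial>lborel)"
    by (rule tr[symmetric]) simp
  also have "\<dots> = (\<integral>\<^sup>+y. g y * indicator (R 0 s) y \<partial>lborel)"
    using per by (intro nn_integral_cong arg_cong2[where f = "(*)"])
      (auto simp: indicator_def mem_L add.commute)
  also have "(\<integral>\<^sup>+y. g y * indicator (R s L) y \<partial>lborel) + (\<integral>\<^sup>+y. g y * indicator (R 0 s) y \<partial>lborel)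
      = (\<integral>\<^sup>+y. g y * indicator (R s L) y + g y * indicator (R 0 s) y \<partial>lborel)"
    by (rule nn_integral_add[symmetric]) auto
  also have "\<dots> = (\<integral>\<^sup>+y. g y * indicator (half_open_cell L) y \<partial>lborel)"
    unfolding cell using s by (intro nn_integral_cong) (auto simp: R_def indicator_def)
  finally show ?thesis .
qed

lemma nn_integral_half_open_cell_translate:
  fixes g :: "real ^ 'd \<Rightarrow> ennreal"
  assumes g [measurable]: "g \<in> borel_measurable borel" and per: "\<And>y i. g (y + L *\<^sub>R axis i 1) = g y"
    and z: "z \<in> half_open_cell L"
  shows "(\<integral>\<^sup>+y. g (y + z) * indicator (half_open_cell L) y \<partial>lborel)
       = (\<integral>\<^sup>+y. g y * indicator (half_open_cell L) y \<partial>lborel)"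
proof -
  have "(\<integral>\<^sup>+y. g (y + (\<Sum>i\<in>F. (z $ i) *\<^sub>R axis i 1)) * indicator (half_open_cell L) y \<partial>lborel)
       = (\<integral>\<^sup>+y. g y * indicator (half_open_cell L) y \<partial>lborel)" if "finite F" for F
    using that
  proof (induction F)
    case (insert j F)
    let ?z = "\<Sum>i\<in>F. (z $ i) *\<^sub>R axis i 1"
    have "(\<integral>\<^sup>+y. g ((y + (z $ j) *\<^sub>R axis j 1) + ?z) * indicator (half_open_cell L) y \<partial>lborel)
        = (\<integral>\<^sup>+y. g (y + ?z) * indicator (half_open_cell L) y \<partial>lborel)"
      by (rule nn_integral_half_open_cell_axis[where g = "\<lambda>y. g (y + ?z)"])
         (use z per[of "_ + ?z"] in \<open>auto simp: half_open_cell_def add.assoc add.commute add.left_commute\<close>)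
    then show ?case using insert by (simp add: add.assoc)
  qed simp
  from this[of UNIV] show ?thesis using vec_eq_sum_axis[of z] by simp
qed

lemma cell_unif_translate:
  assumes L: "L > 0" and g [measurable]: "g \<in> borel_measurable borel" and per: "cell_periodic L g"
    and K: "\<And>y. \<bar>g y\<bar> \<le> K"
  shows "(\<integral>y. g (y + z) \<partial>cell_unif L) = (\<integral>y. g y \<partial>cell_unif L)"
proof -
  interpret prob_space "cell_unif L" by (rule prob_space_cell_unif[OF L])
  have int: "integrable (cell_unif L) (\<lambda>y. g (y + c))" for c
    by (rule integrable_const_bound[of _ K]) (use K in auto)
  have nn: "(\<integral>y. g (y + c) + K \<partial>cell_unif L) = enn2real (\<integral>\<^sup>+y. ennreal (g y + K) \<partial>cell_unif L)"
    if "c \<in> half_open_cell L" for c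
  proof -
    have "(\<integral>\<^sup>+y. ennreal (g (y + c) + K) \<partial>cell_unif L) = (\<integral>\<^sup>+y. ennreal (g y + K) \<partial>cell_unif L)"
      unfolding cell_unif_def
      by (subst (1 2) nn_integral_uniform_measure)
         (auto intro!: arg_cong2[where f = "(/)"]
           nn_integral_half_open_cell_translate[where g = "\<lambda>y. ennreal (g y + K)"] that simp: cell_periodicD[OF per])
    moreover have nonneg: "0 \<le> g y + K" for y using K[of y] by linarith
    ultimately show ?thesis
      using nonneg by (subst integral_eq_nn_integral) auto
  qed
  have "0 \<in> half_open_cell L" using L by (simp add: half_open_cell_def)
  then have "(\<integral>y. g (y + cell_rep L z) + K \<partial>cell_unif L) = (\<integral>y. g (y + 0) + K \<partial>cell_unif L)"
    unfolding nn[OF cell_rep_mem[OF L]] by (subst nn) simp_all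
  then show ?thesis
    using int[of 0] int[of "cell_rep L z"] by (simp add: prob_space cell_periodic_rep[OF per])
qed

section \<open>Comparison of starting points\<close>

text \<open>Doubling the variance absorbs a bounded shift, since \<open>(a + c)\<^sup>2 \<le> 2 * a\<^sup>2 + 2 * c\<^sup>2\<close>.\<close>

lemma normal_density_shift_le:
  assumes "\<bar>c\<bar> \<le> L"
  shows "normal_density 0 1 a \<le> sqrt 2 * exp (L\<^sup>2 / 2) * normal_density 0 (sqrt 2) (a + c)"
proof -
  have "(a + c)\<^sup>2 \<le> 2 * a\<^sup>2 + 2 * c\<^sup>2"
    using zero_le_power2[of "a - c"] by (simp add: power2_eq_square algebra_simps)
  moreover have "c\<^sup>2 \<le> L\<^sup>2" using assms by (metis abs_ge_zero power2_abs power_mono)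
  ultimately have "exp (- a\<^sup>2 / 2) \<le> exp (L\<^sup>2 / 2) * exp (- (a + c)\<^sup>2 / 4)"
    unfolding exp_add[symmetric] by (subst exp_le_cancel_iff) (simp add: field_simps)
  moreover have "normal_density 0 1 a = exp (- a\<^sup>2 / 2) / sqrt (2 * pi)"
    by (simp add: normal_density_def)
  moreover have "sqrt 2 * exp (L\<^sup>2 / 2) * normal_density 0 (sqrt 2) (a + c)
      = exp (L\<^sup>2 / 2) * exp (- (a + c)\<^sup>2 / 4) / sqrt (2 * pi)"
  proof -
    have "sqrt (2 * pi * 2) = sqrt 2 * sqrt (2 * pi)" by (simp add: real_sqrt_mult)
    then show ?thesis by (simp add: normal_density_def)
  qed
  ultimately show ?thesis by (simp add: divide_right_mono)
qed

text \<open>The type argument carries the dimension.\<close>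

definition harnack_const :: "real \<Rightarrow> 'd itself \<Rightarrow> real" where
  "harnack_const L _ = (sqrt 2 * exp (L\<^sup>2 / 2)) ^ CARD('d)"

lemma harnack_const_ge_1: "1 \<le> harnack_const L TYPE('d)"
proof -
  have "1 * 1 \<le> sqrt 2 * exp (L\<^sup>2 / 2)" by (intro mult_mono) auto
  then show ?thesis unfolding harnack_const_def by (intro one_le_power) simp
qed

context wiener
begin

lemma heat_eq:
  assumes t: "0 < t" and g [measurable]: "g \<in> borel_measurable borel" and K: "\<And>x. \<bar>g x\<bar> \<le> K"
  shows "(\<integral>w. g (y + W t w) \<partial>M) = (\<integral>z. (\<Prod>i\<in>UNIV. normal_density 0 (sqrt t) (z $ i - y $ i)) * g z \<partial>lborel)"
    and "integrable lborel (\<lambda>z. (\<Prod>i\<in>UNIV. normal_density 0 (sqrt t) (z $ i - y $ i)) * g z)"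
proof -
  let ?p = "\<lambda>x :: real ^ 'd. \<Prod>i\<in>UNIV. normal_density 0 (sqrt t) (x $ i)"
  have D: "distributed M lborel (\<lambda>w. W t w - W 0 w) (\<lambda>x. ennreal (?p x))"
    using W_increment[of 0 t] t by simp
  have p0: "0 \<le> ?p x" for x by (auto intro: prod_nonneg)
  have pm [measurable]: "?p \<in> borel_measurable borel"
    by (rule borel_measurable_continuous_onI) (use t in \<open>auto simp: normal_density_def intro!: continuous_intros\<close>)
  have gm: "(\<lambda>x. g (y + x)) \<in> borel_measurable lborel" by simp
  have [measurable]: "W t \<in> borel_measurable M" "W 0 \<in> borel_measurable M" using t by (auto intro: W_measurable)
  have "integrable M (\<lambda>w. g (y + (W t w - W 0 w)))"
    by (rule integrable_const_bound[of _ K]) (use K in auto)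
  then have int: "integrable lborel (\<lambda>x. ?p x * g (y + x))"
    using distributed_integrable[OF D gm p0] by simp
  have eq: "(\<lambda>x. ?p x * g (y + x)) = (\<lambda>x. (\<lambda>z. (\<Prod>i\<in>UNIV. normal_density 0 (sqrt t) (z $ i - y $ i)) * g z) (y + x))"
    by simp
  have zm [measurable]: "(\<lambda>z :: real ^ 'd. (\<Prod>i\<in>UNIV. normal_density 0 (sqrt t) (z $ i - y $ i))) \<in> borel_measurable borel"
    by (rule borel_measurable_continuous_onI) (use t in \<open>auto simp: normal_density_def intro!: continuous_intros\<close>)
  show "integrable lborel (\<lambda>z. (\<Prod>i\<in>UNIV. normal_density 0 (sqrt t) (z $ i - y $ i)) * g z)"
    using int unfolding eq
    by (subst lborel_distr_plus[of y, symmetric], subst integrable_distr_eq) auto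
  have "(\<integral>w. g (y + W t w) \<partial>M) = (\<integral>w. g (y + (W t w - W 0 w)) \<partial>M)"
    by (intro Bochner_Integration.integral_cong) (auto simp: W_0)
  also have "\<dots> = (\<integral>x. ?p x * g (y + x) \<partial>lborel)"
    by (rule distributed_integral[OF D gm p0, symmetric])
  also have "\<dots> = (\<integral>z. (\<Prod>i\<in>UNIV. normal_density 0 (sqrt t) (z $ i - y $ i)) * g z \<partial>lborel)"
    unfolding eq by (subst (2) lborel_distr_plus[of y, symmetric], subst integral_distr) auto
  finally show "(\<integral>w. g (y + W t w) \<partial>M) = (\<integral>z. (\<Prod>i\<in>UNIV. normal_density 0 (sqrt t) (z $ i - y $ i)) * g z \<partial>lborel)" .
qed

lemma heat_compare:
  assumes g: "g \<in> borel_measurable borel" and K: "\<And>x. \<bar>g x\<bar> \<le> K" and pos: "\<And>x. 0 \<le> g x"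
    and near: "\<And>i. \<bar>y $ i - y' $ i\<bar> \<le> L"
  shows "(\<integral>w. g (y + W 1 w) \<partial>M) \<le> harnack_const L TYPE('d) * (\<integral>w. g (y' + W 2 w) \<partial>M)"
proof -
  have "(\<Prod>i\<in>UNIV. normal_density 0 (sqrt 1) (z $ i - y $ i))
      \<le> harnack_const L TYPE('d) * (\<Prod>i\<in>UNIV. normal_density 0 (sqrt 2) (z $ i - y' $ i))" for z
  proof -
    have "(\<Prod>i\<in>UNIV. normal_density 0 (sqrt 1) (z $ i - y $ i))
        \<le> (\<Prod>i\<in>UNIV. sqrt 2 * exp (L\<^sup>2 / 2) * normal_density 0 (sqrt 2) (z $ i - y' $ i))"
      
    proof (intro prod_mono conjI)
      fix i show "normal_density 0 (sqrt 1) (z $ i - y $ i)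
          \<le> sqrt 2 * exp (L\<^sup>2 / 2) * normal_density 0 (sqrt 2) (z $ i - y' $ i)"
        using normal_density_shift_le[OF near[of i], of "z $ i - y $ i"] by simp
    qed auto
    then show ?thesis by (simp add: prod.distrib harnack_const_def)
  qed
  then have "(\<Prod>i\<in>UNIV. normal_density 0 (sqrt 1) (z $ i - y $ i)) * g z
      \<le> harnack_const L TYPE('d) * ((\<Prod>i\<in>UNIV. normal_density 0 (sqrt 2) (z $ i - y' $ i)) * g z)" for z
    unfolding mult.assoc[symmetric] by (intro mult_right_mono pos)
  then show ?thesis
    unfolding heat_eq(1)[OF zero_less_one g K] heat_eq(1)[OF zero_less_numeral g K] integral_mult_right_zero[symmetric]
    by (intro integral_mono integrable_mult_right heat_eq(2)[OF _ g K]) auto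
qed

abbreviation fk1 :: "(real ^ 'd \<Rightarrow> real \<Rightarrow> real) \<Rightarrow> real \<Rightarrow> real ^ 'd \<Rightarrow> real" where
  "fk1 V t \<equiv> fk V t (\<lambda>_. 1)"

lemma fk_periodic:
  assumes "\<And>t. cell_periodic L (\<lambda>y. V y t)" "cell_periodic L g"
  shows "cell_periodic L (fk V t g)"
proof -
  have "V (y + L *\<^sub>R axis i 1 + w) s = V (y + w) s" "g (y + L *\<^sub>R axis i 1 + w) = g (y + w)" for y i w s
    using cell_periodicD[OF assms(1), where y = "y + w"] cell_periodicD[OF assms(2), where y = "y + w"]
    by (simp_all add: algebra_simps)
  then show ?thesis unfolding cell_periodic_def fk_def by simp
qed

lemma fk1_bounds:
  assumes V: "controlled V S" and t: "0 \<le> t"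
  shows "exp (- budget S 0 t) \<le> fk1 V t y" "fk1 V t y \<le> exp (budget S 0 t)" "0 < fk1 V t y"
    "\<bar>fk1 V t y\<bar> \<le> exp (budget S 0 t)" "\<bar>ln (fk1 V t y)\<bar> \<le> budget S 0 t"
proof -
  show 1: "exp (- budget S 0 t) \<le> fk1 V t y" and 3: "0 < fk1 V t y"
    using fk_pos[OF V t, of "\<lambda>_. 1" 1 1 y] by auto
  show 4: "\<bar>fk1 V t y\<bar> \<le> exp (budget S 0 t)"
    using fk_bounded[OF V t, of "\<lambda>_. 1" 1 y] by auto
  then show 2: "fk1 V t y \<le> exp (budget S 0 t)" by simp
  show "\<bar>ln (fk1 V t y)\<bar> \<le> budget S 0 t"
    using ln_mono[OF 2 3] 1 3 by (auto simp: abs_le_iff minus_le_iff ln_ge_iff)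
qed

lemma fk1_measurable: "controlled V S \<Longrightarrow> 0 \<le> t \<Longrightarrow> fk1 V t \<in> borel_measurable borel"
  by (rule fk_measurable) auto

lemma fk1_step:
  assumes V: "controlled V S" and "0 \<le> r" "0 \<le> t"
  shows "fk1 V (r + t) y = fk (\<lambda>y s. V y (t + s)) r (fk1 V t) y"
  by (rule fk_semigroup[OF assms, where K = 1]) auto

text \<open>By the shift estimate, the heat kernel at time 1 from one point is dominated by the heat kernel at
time 2 from any other point of the same cell; periodicity puts both starting points into one cell.
The last two units of time suffice for this comparison, so the potential contributes only
what it accumulates there.\<close>

lemma harnack:
  assumes L: "L > 0" and V: "controlled V S" and per: "\<And>t. cell_periodic L (\<lambda>y. V y t)" and t: "2 \<le> t"
  shows "fk1 V t y \<le> harnack_const L TYPE('d) * exp (3 * budget S (t - 2) t) * fk1 V t y'"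
proof -
  define B where "B = budget S (t - 2) t"
  define C where "C = harnack_const L TYPE('d)"
  have C: "1 \<le> C" unfolding C_def by (rule harnack_const_ge_1)
  note V1 = controlled_shift[OF V]
  have per1: "cell_periodic L (fk1 V s)" for s
    by (rule fk_periodic) (auto simp: per, simp add: cell_periodic_def)
  let ?g = "fk1 V (t - 2)"
  have g: "?g \<in> borel_measurable borel" "\<And>x. \<bar>?g x\<bar> \<le> exp (budget S 0 (t - 2))" "\<And>x. 0 \<le> ?g x"
    using t fk1_measurable[OF V, of "t - 2"] fk1_bounds[OF V, of "t - 2"] by (auto intro: less_imp_le)
  have b1: "budget (\<lambda>s. S (t - 2 + s)) 0 1 \<le> B"
    using budget_mono[OF V, of "t - 2" "t - 1" t] by (simp add: budget_shift B_def)
  have b2: "budget (\<lambda>s. S (t - 2 + s)) 0 2 = B" by (simp add: budget_shift B_def)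
  have b3: "budget (\<lambda>s. S (t - 1 + s)) 0 1 \<le> B"
    using budget_combine[OF V, of "t - 2" "t - 1" t] budget_nonneg[OF V, of "t - 2" "t - 1"]
    by (simp add: budget_shift B_def)
  have lower: "exp (- B) * (\<integral>w. ?g (cell_rep L y' + W 2 w) \<partial>M) \<le> fk1 V t y'"
  proof -
    have "fk1 V t y' = fk1 V (2 + (t - 2)) (cell_rep L y')" by (simp add: cell_periodic_rep'[OF per1])
    also have "\<dots> = fk (\<lambda>y s. V y (t - 2 + s)) 2 ?g (cell_rep L y')"
      by (rule fk1_step[OF V]) (use t in auto)
    finally show ?thesis using fk_between_heat(1)[OF V1[of "t - 2"] _ g, of 2] b2 by simp
  qed
  have upper: "fk1 V (t - 1) x \<le> C * exp (2 * B) * fk1 V t y'" for x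
  proof -
    have "fk1 V (t - 1) x = fk1 V (1 + (t - 2)) (cell_rep L x)" by (simp add: cell_periodic_rep'[OF per1])
    also have "\<dots> = fk (\<lambda>y s. V y (t - 2 + s)) 1 ?g (cell_rep L x)"
      by (rule fk1_step[OF V]) (use t in auto)
    also have "\<dots> \<le> exp (budget (\<lambda>s. S (t - 2 + s)) 0 1) * (\<integral>w. ?g (cell_rep L x + W 1 w) \<partial>M)"
      by (rule fk_between_heat(2)[OF V1]) (use g in auto)
    also have "\<dots> \<le> exp B * (C * (\<integral>w. ?g (cell_rep L y' + W 2 w) \<partial>M))"
    proof (intro mult_mono)
      show "(\<integral>w. ?g (cell_rep L x + W 1 w) \<partial>M) \<le> C * (\<integral>w. ?g (cell_rep L y' + W 2 w) \<partial>M)"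
        unfolding C_def
      proof (rule heat_compare[OF g(1,2,3)])
        fix i show "\<bar>cell_rep L x $ i - cell_rep L y' $ i\<bar> \<le> L"
          using cell_rep_mem[OF L, of x] cell_rep_mem[OF L, of y']
          by (auto simp: half_open_cell_def abs_le_iff) (smt (verit))+
      qed
    qed (use b1 g(3) in \<open>auto intro!: integral_nonneg_AE\<close>)
    also have "\<dots> = C * exp (2 * B) * (exp (- B) * (\<integral>w. ?g (cell_rep L y' + W 2 w) \<partial>M))"
    proof -
      have "exp B = exp (2 * B) * exp (- B)" by (simp add: mult_exp_exp)
      then show ?thesis by (simp only: mult_ac)
    qed
    also have "\<dots> \<le> C * exp (2 * B) * fk1 V t y'"
      using lower C by (intro mult_left_mono) auto
    finally show ?thesis .
  qed
  let ?D = "C * exp (2 * B) * fk1 V t y'"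
  have D: "0 < ?D" using C fk1_bounds(3)[OF V, of t y'] t by simp
  have "fk1 V t y = fk1 V (1 + (t - 1)) y" by simp
  also have "\<dots> = fk (\<lambda>y s. V y (t - 1 + s)) 1 (fk1 V (t - 1)) y"
    by (rule fk1_step[OF V]) (use t in auto)
  also have "\<dots> \<le> exp (budget (\<lambda>s. S (t - 1 + s)) 0 1) * (\<integral>w. fk1 V (t - 1) (y + W 1 w) \<partial>M)"
    using t fk1_bounds(3,4)[OF V, of "t - 1"] fk1_measurable[OF V, of "t - 1"]
    by (intro fk_between_heat(2)[OF V1, where K = "exp (budget S 0 (t - 1))"]) (auto intro: less_imp_le)
  also have "\<dots> \<le> exp B * (\<integral>w. ?D \<partial>M)"
  proof (intro mult_mono)
    show "(\<integral>w. fk1 V (t - 1) (y + W 1 w) \<partial>M) \<le> (\<integral>w. ?D \<partial>M)"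
    proof (rule integral_mono)
      note [measurable] = fk1_measurable[OF V, of "t - 1"] W_measurable[of 1]
      show "integrable M (\<lambda>w. fk1 V (t - 1) (y + W 1 w))"
        by (rule integrable_const_bound[of _ "exp (budget S 0 (t - 1))"])
           (use t fk1_bounds(4)[OF V, of "t - 1"] in auto)
    qed (use upper in auto)
  qed (use b3 fk1_bounds(3)[OF V, of "t - 1"] t in \<open>auto intro!: integral_nonneg_AE AE_I2 intro: less_imp_le\<close>)
  also have "\<dots> = C * exp (3 * B) * fk1 V t y'"
  proof -
    have "exp (3 * B) = exp B * exp (2 * B)" by (simp add: mult_exp_exp)
    then show ?thesis by (simp add: prob_space)
  qed
  finally show ?thesis by (simp add: C_def B_def)
qed

text \<open>At time \<open>s\<close> the solution is constant in space up to the Harnack factor, and restarting from a constant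
is restarting from 1.\<close>

lemma fk1_almost_additive:
  assumes L: "L > 0" and V: "controlled V S" and per: "\<And>t. cell_periodic L (\<lambda>y. V y t)"
    and s: "2 \<le> s" and r: "0 \<le> r"
  shows "\<bar>ln (fk1 V (r + s) y) - ln (fk1 V s z) - ln (fk1 (\<lambda>y t. V y (s + t)) r y)\<bar>
    \<le> ln (harnack_const L TYPE('d)) + 3 * budget S (s - 2) s"
proof -
  define D where "D = harnack_const L TYPE('d) * exp (3 * budget S (s - 2) s)"
  have D: "0 < D" "ln D = ln (harnack_const L TYPE('d)) + 3 * budget S (s - 2) s"
    using harnack_const_ge_1[of L, where 'd = 'd] by (auto simp: D_def ln_mult)
  have h: "fk1 V s x \<le> D * fk1 V s x'" for x x'
    using harnack[OF L V per s] by (simp add: D_def)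
  note V1 = controlled_shift[OF V, of s]
  have u: "0 < fk1 V s z" using fk1_bounds(3)[OF V] s by simp
  have v: "0 < fk1 (\<lambda>y t. V y (s + t)) r y" by (rule fk1_bounds(3)[OF V1 r])
  have w: "0 < fk1 V (r + s) y" using fk1_bounds(3)[OF V] s r by simp
  have step: "fk1 V (r + s) y = fk (\<lambda>y t. V y (s + t)) r (fk1 V s) y"
    by (rule fk1_step[OF V r]) (use s in simp)
  let ?K = "max (exp (budget S 0 s)) (D * fk1 V s z + fk1 V s z / D)"
  have Kc: "D * fk1 V s z \<le> ?K" "fk1 V s z / D \<le> ?K"
    using D u by (intro max.coboundedI2; simp)+
  have K: "\<bar>fk1 V s x\<bar> \<le> ?K" for x using fk1_bounds(4)[OF V, of s x] s by (intro max.coboundedI1) simp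
  have meas: "fk1 V s \<in> borel_measurable borel" using fk1_measurable[OF V, of s] s by simp
  have "fk1 V (r + s) y \<le> fk (\<lambda>y t. V y (s + t)) r (\<lambda>_. D * fk1 V s z * 1) y"
    unfolding step using K Kc meas h D u by (intro fk_mono[OF V1 r, where K = ?K]) auto
  then have le: "fk1 V (r + s) y \<le> D * fk1 V s z * fk1 (\<lambda>y t. V y (s + t)) r y"
    unfolding fk_cmult .
  have "fk (\<lambda>y t. V y (s + t)) r (\<lambda>_. fk1 V s z / D * 1) y \<le> fk1 V (r + s) y"
    unfolding step using K Kc meas h[of z] D u by (intro fk_mono[OF V1 r, where K = ?K])
      (auto simp: field_simps)
  then have ge: "fk1 V s z / D * fk1 (\<lambda>y t. V y (s + t)) r y \<le> fk1 V (r + s) y"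
    unfolding fk_cmult .
  have "ln (fk1 V (r + s) y) \<le> ln D + ln (fk1 V s z) + ln (fk1 (\<lambda>y t. V y (s + t)) r y)"
    using ln_mono[OF le w] D u v by (simp add: ln_mult)
  moreover have "ln (fk1 V s z) - ln D + ln (fk1 (\<lambda>y t. V y (s + t)) r y) \<le> ln (fk1 V (r + s) y)"
  proof -
    have "0 < fk1 V s z / D * fk1 (\<lambda>y t. V y (s + t)) r y" using D u v by simp
    from ln_mono[OF ge this] show ?thesis using D u v by (simp add: ln_mult ln_div)
  qed
  ultimately show ?thesis using D(2) by (simp add: abs_le_iff)
qed

end

section \<open>The gain from exchanging two pieces of the path\<close>

lemma (in prob_space) exp_integral_le:
  fixes Z :: "'a \<Rightarrow> real"
  assumes Z: "integrable M Z" and eZ: "integrable M (\<lambda>x. exp (Z x))"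
  shows "exp (\<integral>x. Z x \<partial>M) \<le> (\<integral>x. exp (Z x) \<partial>M)"
proof -
  define m where "m = (\<integral>x. Z x \<partial>M)"
  have "exp m * (1 + (Z x - m)) \<le> exp (Z x)" for x
    using mult_left_mono[OF exp_ge_add_one_self[of "Z x - m"], of "exp m"] by (simp add: mult_exp_exp)
  then have "(\<integral>x. exp m * (1 + (Z x - m)) \<partial>M) \<le> (\<integral>x. exp (Z x) \<partial>M)"
    using Z eZ by (intro integral_mono) auto
  moreover have "(\<integral>x. exp m * (1 + (Z x - m)) \<partial>M) = exp m"
    using Z by (simp add: prob_space m_def)
  ultimately show ?thesis by (simp add: m_def)
qed

lemma ln_cosh_nonneg: "0 \<le> ln (cosh x)" for x :: real
  using cosh_real_ge_1[of x] by simp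

lemma ln_cosh_le_abs: "ln (cosh x) \<le> \<bar>x\<bar>" for x :: real
proof -
  have "cosh x = (exp \<bar>x\<bar> + exp (- \<bar>x\<bar>)) / 2" by (auto simp: cosh_def abs_if)
  also have "\<dots> \<le> exp \<bar>x\<bar>" by simp
  finally have "ln (cosh x) \<le> ln (exp \<bar>x\<bar>)" using cosh_real_pos[of x] by (rule ln_mono)
  then show ?thesis by simp
qed

lemma ln_cosh_mono: "0 \<le> c \<Longrightarrow> c \<le> \<bar>x\<bar> \<Longrightarrow> ln (cosh c) \<le> ln (cosh x)" for x :: real
  using cosh_real_nonneg_le_iff[of c "\<bar>x\<bar>"] cosh_real_pos[of c] cosh_real_pos[of x]
  by (auto simp: abs_if split: if_splits)

lemma LINT_near_const:
  fixes f :: "real \<Rightarrow> real"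
  assumes "continuous_on {0..r} f" "0 \<le> r" "\<And>s. s \<in> {0..r} \<Longrightarrow> \<bar>f s - c\<bar> \<le> e"
  shows "\<bar>(LINT s:{0..r}|lborel. f s) - r * c\<bar> \<le> r * e"
proof -
  have const: "(LINT s:{0..r}|lborel. k) = r * k" for k :: real
    using assms(2) by (simp add: set_lebesgue_integral_def)
  have "(LINT s:{0..r}|lborel. f s - c) = (LINT s:{0..r}|lborel. f s) - (LINT s:{0..r}|lborel. c)"
    by (rule set_integral_diff) (auto intro!: borel_integrable_atLeastAtMost' assms)
  moreover have "\<bar>LINT s:{0..r}|lborel. f s - c\<bar> \<le> (LINT s:{0..r}|lborel. e)"
    using assms by (intro LINT_abs_le) (auto intro!: continuous_intros)
  ultimately show ?thesis by (simp add: const)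
qed

text \<open>At each time the displacement \<open>X s\<close> is invisible to the average over a cell.\<close>

lemma cell_unif_integral_action:
  assumes L: "L > 0" and V: "controlled V S" and per: "\<And>t. cell_periodic L (\<lambda>y. V y t)"
    and X [measurable]: "X \<in> borel_measurable borel" and t: "0 \<le> t"
  shows "(\<integral>y. (LINT s:{0..t}|lborel. V (y + X s) (k - s)) \<partial>cell_unif L)
    = (LINT s:{0..t}|lborel. (\<integral>y. V y (k - s) \<partial>cell_unif L))"
proof -
  interpret U: prob_space "cell_unif L" by (rule prob_space_cell_unif[OF L])
  interpret P: pair_sigma_finite "cell_unif L" "lborel :: real measure" ..
  note [measurable (raw)] = controlled_measurable[OF V]
  let ?F = "\<lambda>y s. indicator {0..t} s *\<^sub>R V (y + X s) (k - s)"
  let ?B = "LINT s:{0..t}|lborel. S (k - s)"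
  have Sint: "integrable lborel (\<lambda>s. indicator {0..t} s *\<^sub>R S (k - s))"
    using borel_integrable_atLeastAtMost'[of 0 t "\<lambda>s. S (k - s)"]
      controlled_S_continuous[OF V, of "{0..t}" "\<lambda>s. k - s"]
    by (auto simp: set_integrable_def continuous_intros)
  have le: "norm (?F y s) \<le> indicator {0..t} s *\<^sub>R S (k - s)" for y s
    using controlled_bound[OF V] by (simp add: indicator_def)
  have Fs: "integrable lborel (?F y)" for y
    by (rule Bochner_Integration.integrable_bound[OF Sint]) (use le in \<open>auto intro: order_trans[OF _ abs_ge_self]\<close>)
  have "integrable (cell_unif L \<Otimes>\<^sub>M lborel) (case_prod ?F)"
  proof (rule P.Fubini_integrable)
    show "case_prod ?F \<in> borel_measurable (cell_unif L \<Otimes>\<^sub>M lborel)" by measurable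
    show "integrable (cell_unif L) (\<lambda>y. \<integral>s. norm (case_prod ?F (y, s)) \<partial>lborel)"
    proof (rule U.integrable_const_bound[of _ ?B])
      show "AE y in cell_unif L. norm (\<integral>s. norm (case_prod ?F (y, s)) \<partial>lborel) \<le> ?B"
      proof (intro AE_I2)
        fix y
        have "(\<integral>s. norm (?F y s) \<partial>lborel) \<le> ?B"
          unfolding set_lebesgue_integral_def using Fs Sint le by (intro integral_mono) auto
        moreover have "0 \<le> (\<integral>s. norm (?F y s) \<partial>lborel)" by (intro integral_nonneg_AE) auto
        ultimately show "norm (\<integral>s. norm (case_prod ?F (y, s)) \<partial>lborel) \<le> ?B" by simp
      qed
    qed measurable
    show "AE y in cell_unif L. integrable lborel (\<lambda>s. case_prod ?F (y, s))" using Fs by simp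
  qed
  from P.Fubini_integral[OF this]
  have "(\<integral>y. (LINT s:{0..t}|lborel. V (y + X s) (k - s)) \<partial>cell_unif L)
      = (\<integral>s. (\<integral>y. ?F y s \<partial>cell_unif L) \<partial>lborel)"
    by (simp add: set_lebesgue_integral_def)
  also have "\<dots> = (LINT s:{0..t}|lborel. (\<integral>y. V y (k - s) \<partial>cell_unif L))"
    unfolding set_lebesgue_integral_def
  proof (rule Bochner_Integration.integral_cong[OF refl])
    fix s
    have "(\<integral>y. V (y + X s) (k - s) \<partial>cell_unif L) = (\<integral>y. V y (k - s) \<partial>cell_unif L)"
      by (rule cell_unif_translate[OF L _ per, where K = "S (k - s)"])
         (use controlled_bound[OF V] in \<open>auto intro!: controlled_measurable[OF V]\<close>)
    then show "(\<integral>y. ?F y s \<partial>cell_unif L) = indicator {0..t} s *\<^sub>R (\<integral>y. V y (k - s) \<partial>cell_unif L)"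
      by simp
  qed
  finally show ?thesis .
qed

context wiener
begin

text \<open>The two terms are the actions along paths made of the same two pieces, of durations \<open>r\<close> and \<open>h\<close>, glued
in either order. Both paths have the same end point and the same law.\<close>

definition swap_diff :: "(real ^ 'd \<Rightarrow> real \<Rightarrow> real) \<Rightarrow> real \<Rightarrow> real \<Rightarrow> real ^ 'd \<Rightarrow> 'w \<times> 'w \<Rightarrow> real" where
  "swap_diff V r h y p = split_action V r h y (fst p) (snd p) - split_action V h r y (snd p) (fst p)"

definition swap_gap :: "(real ^ 'd \<Rightarrow> real \<Rightarrow> real) \<Rightarrow> real \<Rightarrow> real \<Rightarrow> real ^ 'd \<Rightarrow> real" where
  "swap_gap V r h y = (\<integral>p. ln (cosh (swap_diff V r h y p / 2)) \<partial>(M \<Otimes>\<^sub>M M))"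

lemma swap_diff_measurable:
  assumes V: "controlled V S" and "0 \<le> r" "0 \<le> h" and [measurable]: "y \<in> borel_measurable N" "f \<in> measurable N (M \<Otimes>\<^sub>M M)"
  shows "(\<lambda>q. swap_diff V r h (y q) (f q)) \<in> borel_measurable N"
proof -
  note [measurable (raw)] = split_action_measurable[OF V \<open>0 \<le> r\<close>] split_action_measurable[OF V \<open>0 \<le> h\<close>]
  show ?thesis unfolding swap_diff_def by measurable
qed

lemma swap_diff_bound:
  assumes V: "controlled V S" and "p \<in> space (M \<Otimes>\<^sub>M M)" "0 \<le> r" "0 \<le> h"
  shows "\<bar>swap_diff V r h y p\<bar> \<le> 2 * budget S 0 (r + h)"
  using split_action_bound[OF V, of "fst p" "snd p" r h y] split_action_bound[OF V, of "snd p" "fst p" h r y] assms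
  by (auto simp: swap_diff_def space_pair_measure add.commute abs_le_iff)

lemma ln_cosh_measurable:
  assumes "f \<in> borel_measurable N"
  shows "(\<lambda>x. ln (cosh (f x / 2 :: real))) \<in> borel_measurable N"
  by (rule borel_measurable_continuous_on[OF _ assms]) (auto intro!: continuous_intros simp: cosh_real_pos less_imp_neq[symmetric] cosh_real_nonzero)

lemma swap_gap_integrable:
  assumes V: "controlled V S" and r: "0 \<le> r" and h: "0 \<le> h"
  shows "integrable (M \<Otimes>\<^sub>M M) (\<lambda>p. ln (cosh (swap_diff V r h y p / 2)))"
proof (rule pair.P.integrable_const_bound[of _ "budget S 0 (r + h)"])
  show "(\<lambda>p. ln (cosh (swap_diff V r h y p / 2))) \<in> borel_measurable (M \<Otimes>\<^sub>M M)"
    by (intro ln_cosh_measurable swap_diff_measurable[OF V r h]) auto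
  show "AE p in M \<Otimes>\<^sub>M M. norm (ln (cosh (swap_diff V r h y p / 2))) \<le> budget S 0 (r + h)"
    using swap_diff_bound[OF V _ r h, of _ y] ln_cosh_le_abs ln_cosh_nonneg
    by (intro AE_I2) (smt (verit) divide_real_def field_sum_of_halves real_norm_def)
qed

lemma swap_gap_bounds:
  assumes V: "controlled V S" and r: "0 \<le> r" and h: "0 \<le> h"
  shows "0 \<le> swap_gap V r h y" "swap_gap V r h y \<le> budget S 0 (r + h)"
proof -
  show "0 \<le> swap_gap V r h y"
    unfolding swap_gap_def by (intro integral_nonneg_AE) (auto simp: ln_cosh_nonneg)
  have "swap_gap V r h y \<le> (\<integral>p. budget S 0 (r + h) \<partial>(M \<Otimes>\<^sub>M M))"
    unfolding swap_gap_def
  proof (rule integral_mono[OF swap_gap_integrable[OF V r h]])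
    fix p assume "p \<in> space (M \<Otimes>\<^sub>M M)"
    then show "ln (cosh (swap_diff V r h y p / 2)) \<le> budget S 0 (r + h)"
      using swap_diff_bound[OF V _ r h, of p y] ln_cosh_le_abs[of "swap_diff V r h y p / 2"] by simp
  qed auto
  then show "swap_gap V r h y \<le> budget S 0 (r + h)" by (simp add: pair.P.prob_space)
qed

lemma swap_gap_measurable:
  assumes V: "controlled V S" and "0 \<le> r" "0 \<le> h"
  shows "swap_gap V r h \<in> borel_measurable borel"
proof -
  note [measurable (raw)] = ln_cosh_measurable swap_diff_measurable[OF assms]
  show ?thesis unfolding swap_gap_def[abs_def] by measurable
qed

lemma fk_split_swapped:
  assumes V: "controlled V S" and r: "0 \<le> r" and h: "0 \<le> h" and g [measurable]: "g \<in> borel_measurable borel"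
  shows "fk V (r + h) g y =
    (\<integral>p. exp (split_action V h r y (snd p) (fst p)) * g (y + W r (fst p) + W h (snd p)) \<partial>(M \<Otimes>\<^sub>M M))"
proof -
  note [measurable (raw)] = split_action_measurable[OF V h] W_compose_measurable[OF r] W_compose_measurable[OF h]
  have "fk V (r + h) g y = fk V (h + r) g y" by (simp add: add.commute)
  also have "\<dots> = (\<integral>p. exp (split_action V h r y (fst p) (snd p)) * g (y + W h (fst p) + W r (snd p)) \<partial>(M \<Otimes>\<^sub>M M))"
    by (rule fk_split[OF V h r g])
  also have "\<dots> = (\<integral>(w, w'). exp (split_action V h r y w' w) * g (y + W h w' + W r w) \<partial>(M \<Otimes>\<^sub>M M))"
    by (subst pair.integral_product_swap[symmetric]) (auto simp: case_prod_beta)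
  also have "\<dots> = (\<integral>p. exp (split_action V h r y (snd p) (fst p)) * g (y + W r (fst p) + W h (snd p)) \<partial>(M \<Otimes>\<^sub>M M))"
    by (intro Bochner_Integration.integral_cong) (auto simp: algebra_simps)
  finally show ?thesis .
qed

text \<open>With \<open>a\<close> and \<open>a'\<close> the actions for the two orders and \<open>v\<close> taken at the common end point, the functional is the
expectation of \<open>(exp a + exp a') / 2 * exp v\<close>, which equals \<open>exp ((a + a') / 2 + v) * cosh ((a - a') / 2)\<close>.
Compared with Jensen's inequality for one order alone, the hyperbolic cosine is a gain, and it does not
depend on \<open>v\<close>.\<close>

lemma fk_swap_jensen:
  assumes V: "controlled V S" and r: "0 \<le> r" and h: "0 \<le> h" and v [measurable]: "v \<in> borel_measurable borel"
    and K: "\<And>x. \<bar>v x\<bar> \<le> K"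
  shows "(\<integral>p. (split_action V r h y (fst p) (snd p) + split_action V h r y (snd p) (fst p)) / 2
             + v (y + W r (fst p) + W h (snd p)) \<partial>(M \<Otimes>\<^sub>M M)) + swap_gap V r h y
       \<le> ln (fk V (r + h) (\<lambda>x. exp (v x)) y)"
proof -
  let ?MM = "M \<Otimes>\<^sub>M M"
  define a where "a p = split_action V r h y (fst p) (snd p)" for p
  define a' where "a' p = split_action V h r y (snd p) (fst p)" for p
  define e where "e p = v (y + W r (fst p) + W h (snd p))" for p
  define Z where "Z p = (a p + a' p) / 2 + e p + ln (cosh ((a p - a' p) / 2))" for p
  note [measurable (raw)] = split_action_measurable[OF V h] split_action_measurable[OF V r]
      W_compose_measurable[OF r] W_compose_measurable[OF h] ln_cosh_measurable
  have [measurable]: "a \<in> borel_measurable ?MM" "a' \<in> borel_measurable ?MM" "e \<in> borel_measurable ?MM"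
    unfolding a_def a'_def e_def by measurable
  define B where "B = budget S 0 (r + h)"
  have b: "\<bar>a p\<bar> \<le> B" "\<bar>a' p\<bar> \<le> B" "\<bar>e p\<bar> \<le> K" if "p \<in> space ?MM" for p
    using split_action_bound[OF V, of "fst p" "snd p" r h y] split_action_bound[OF V, of "snd p" "fst p" h r y]
      r h K that by (auto simp: space_pair_measure add.commute a_def a'_def e_def B_def)
  have int1: "integrable ?MM (\<lambda>p. (a p + a' p) / 2 + e p)"
  proof (rule pair.P.integrable_const_bound[of _ "B + K"])
    show "AE p in ?MM. norm ((a p + a' p) / 2 + e p) \<le> B + K"
    proof (intro AE_I2)
      fix p assume "p \<in> space ?MM"
      from b[OF this] show "norm ((a p + a' p) / 2 + e p) \<le> B + K"
        unfolding real_norm_def abs_le_iff by (simp add: field_simps)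
    qed
  qed measurable
  have int2: "integrable ?MM (\<lambda>p. ln (cosh ((a p - a' p) / 2)))"
    using swap_gap_integrable[OF V r h, of y] by (simp add: swap_diff_def a_def a'_def)
  have Z: "integrable ?MM Z" unfolding Z_def using int1 int2 by (rule Bochner_Integration.integrable_add)
  have exp_Z: "exp (Z p) = (exp (a p) * exp (e p) + exp (a' p) * exp (e p)) / 2" for p
  proof -
    have "exp (Z p) = exp ((a p + a' p) / 2) * exp (e p) * cosh ((a p - a' p) / 2)"
      unfolding Z_def exp_add by (simp add: cosh_real_pos)
    also have "\<dots> = exp (e p) * (exp ((a p + a' p) / 2 + (a p - a' p) / 2) + exp ((a p + a' p) / 2 + - ((a p - a' p) / 2))) / 2"
      unfolding exp_add cosh_def by (simp add: field_simps)
    also have "(a p + a' p) / 2 + (a p - a' p) / 2 = a p" by (simp add: field_simps)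
    also have "(a p + a' p) / 2 + - ((a p - a' p) / 2) = a' p" by (simp add: field_simps)
    finally show ?thesis by (simp add: algebra_simps)
  qed
  have eK: "\<bar>exp (v x)\<bar> \<le> exp K" for x using K[of x] by simp
  have i1: "integrable ?MM (\<lambda>p. exp (a p) * exp (e p))"
    using split_integrable[OF V r h, of "\<lambda>x. exp (v x)" "exp K" y] eK by (simp add: a_def e_def)
  have i2: "integrable ?MM (\<lambda>p. exp (a' p) * exp (e p))"
  proof (rule pair.P.integrable_const_bound[of _ "exp B * exp K"])
    show "AE p in ?MM. norm (exp (a' p) * exp (e p)) \<le> exp B * exp K"
    proof (intro AE_I2)
      fix p assume p: "p \<in> space ?MM"
      show "norm (exp (a' p) * exp (e p)) \<le> exp B * exp K"
        unfolding norm_mult using b[OF p] by (intro mult_mono) auto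
    qed
  qed measurable
  have fk: "(\<integral>p. exp (Z p) \<partial>?MM) = fk V (r + h) (\<lambda>x. exp (v x)) y"
  proof -
    have "(\<integral>p. exp (Z p) \<partial>?MM) = ((\<integral>p. exp (a p) * exp (e p) \<partial>?MM) + (\<integral>p. exp (a' p) * exp (e p) \<partial>?MM)) / 2"
      unfolding exp_Z using i1 i2 by simp
    then show ?thesis
      using fk_split[OF V r h, of "\<lambda>x. exp (v x)" y] fk_split_swapped[OF V r h, of "\<lambda>x. exp (v x)" y]
      by (simp add: a_def a'_def e_def)
  qed
  have eZ: "integrable ?MM (\<lambda>p. exp (Z p))" unfolding exp_Z using i1 i2 by auto
  have "exp (\<integral>p. Z p \<partial>?MM) \<le> fk V (r + h) (\<lambda>x. exp (v x)) y"
    using pair.P.exp_integral_le[OF Z eZ] unfolding fk .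
  then have "(\<integral>p. Z p \<partial>?MM) \<le> ln (fk V (r + h) (\<lambda>x. exp (v x)) y)"
    by (metis exp_gt_zero less_le_trans ln_ge_iff)
  moreover have "(\<integral>p. Z p \<partial>?MM) = (\<integral>p. (a p + a' p) / 2 + e p \<partial>?MM) + swap_gap V r h y"
    unfolding Z_def swap_gap_def swap_diff_def a_def[symmetric] a'_def[symmetric]
    by (rule Bochner_Integration.integral_add[OF int1 int2])
  ultimately show ?thesis by (simp add: a_def a'_def e_def)
qed

lemma split_action_cell_average:
  assumes L: "L > 0" and V: "controlled V S" and per: "\<And>t. cell_periodic L (\<lambda>y. V y t)"
    and m: "continuous_on UNIV (\<lambda>s. \<integral>y. V y s \<partial>cell_unif L)"
    and w: "w \<in> space M" "w' \<in> space M" and r: "0 \<le> r" and h: "0 \<le> h"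
  shows "(\<integral>y. split_action V r h y w w' \<partial>cell_unif L) = (LINT s:{0..r + h}|lborel. (\<integral>y. V y s \<partial>cell_unif L))"
proof -
  interpret U: prob_space "cell_unif L" by (rule prob_space_cell_unif[OF L])
  let ?m = "\<lambda>s. \<integral>y. V y s \<partial>cell_unif L"
  have mA: "continuous_on A ?m" for A using m continuous_on_subset by blast
  have int: "integrable (cell_unif L) (\<lambda>y. LINT s:{0..t}|lborel. V (y + x + W s u) (k + t - s))"
    if "u \<in> space M" "0 \<le> t" for u t k x
  proof (rule U.integrable_const_bound[of _ "budget S k (k + t)"])
    note [measurable (raw)] = W_path_measurable[OF V, of "\<lambda>_. u"]
    show "(\<lambda>y. LINT s:{0..t}|lborel. V (y + x + W s u) (k + t - s)) \<in> borel_measurable (cell_unif L)"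
      using that(1) by measurable
  qed (use action_bound[OF V that] in auto)
  have path: "path_at (path u) \<in> borel_measurable borel" if "u \<in> space M" for u
    by (rule path_at_measurable'[OF measurable_const[OF measurable_space[OF path_measurable that]]
          measurable_ident_sets[OF refl]])
  have avg: "(\<integral>y. (LINT s:{0..t}|lborel. V (y + x + W s u) (k + t - s)) \<partial>cell_unif L) = (LINT s:{k..k + t}|lborel. ?m s)"
    if u: "u \<in> space M" and t: "0 \<le> t" for u t k x
  proof -
    have "(\<integral>y. (LINT s:{0..t}|lborel. V (y + x + W s u) (k + t - s)) \<partial>cell_unif L)
        = (\<integral>y. (LINT s:{0..t}|lborel. V (y + (x + path_at (path u) s)) (k + t - s)) \<partial>cell_unif L)"
      using u by (intro Bochner_Integration.integral_cong set_lebesgue_integral_cong)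
        (auto simp: path_at_path add.assoc)
    also have "\<dots> = (LINT s:{0..t}|lborel. ?m (k + t - s))"
      by (intro cell_unif_integral_action[OF L V per _ t] borel_measurable_add borel_measurable_const path[OF u])
    also have "\<dots> = (LINT s:{0..t}|lborel. ?m (k + (t - s)))" by (simp add: add_diff_eq)
    also have "\<dots> = (LINT s:{0..t}|lborel. ?m (k + s))"
      by (rule LINT_reverse[where f = "\<lambda>s. ?m (k + s)"])
    also have "\<dots> = (LINT s:{k..k + t}|lborel. ?m s)"
      using LINT_shift[of k 0 t ?m] by simp
    finally show ?thesis .
  qed
  have "(\<integral>y. split_action V r h y w w' \<partial>cell_unif L)
     = (\<integral>y. (LINT s:{0..r}|lborel. V (y + 0 + W s w) (h + r - s)) \<partial>cell_unif L)
     + (\<integral>y. (LINT s:{0..h}|lborel. V (y + W r w + W s w') (0 + h - s)) \<partial>cell_unif L)"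
    unfolding split_action_def
    using int[OF w(1) r, of 0 h] int[OF w(2) h, of "W r w" 0]
    by (subst Bochner_Integration.integral_add[symmetric]) (auto simp: add.commute[of h r])
  also have "\<dots> = (LINT s:{h..h + r}|lborel. ?m s) + (LINT s:{0..h}|lborel. ?m s)"
    unfolding avg[OF w(1) r] avg[OF w(2) h] by simp
  also have "\<dots> = (LINT s:{0..r + h}|lborel. ?m s)"
    using LINT_combine[of 0 h "h + r" ?m] r h mA by (simp add: add.commute)
  finally show ?thesis .
qed

text \<open>Averaging over the starting point turns the action into the time integral of the cell average of the
potential, and makes \<open>v\<close> enter both sides in the same way.\<close>

lemma cell_average_gain:
  assumes L: "L > 0" and V: "controlled V S" and per: "\<And>t. cell_periodic L (\<lambda>y. V y t)"
    and m: "continuous_on UNIV (\<lambda>s. \<integral>y. V y s \<partial>cell_unif L)"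
    and r: "0 \<le> r" and h: "0 \<le> h" and v [measurable]: "v \<in> borel_measurable borel"
    and K: "\<And>x. \<bar>v x\<bar> \<le> K" and perv: "cell_periodic L v"
  shows "(LINT s:{0..r + h}|lborel. (\<integral>y. V y s \<partial>cell_unif L)) + (\<integral>y. swap_gap V r h y \<partial>cell_unif L)
      + (\<integral>y. v y \<partial>cell_unif L) \<le> (\<integral>y. ln (fk V (r + h) (\<lambda>x. exp (v x)) y) \<partial>cell_unif L)"
proof -
  interpret U: prob_space "cell_unif L" by (rule prob_space_cell_unif[OF L])
  interpret UP: pair_prob_space "cell_unif L" "M \<Otimes>\<^sub>M M" ..
  let ?MM = "M \<Otimes>\<^sub>M M"
  note [measurable (raw)] = split_action_measurable[OF V h] split_action_measurable[OF V r]
      W_compose_measurable[OF r] W_compose_measurable[OF h]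
  define B where "B = budget S 0 (r + h)"
  define I where "I = (LINT s:{0..r + h}|lborel. (\<integral>y. V y s \<partial>cell_unif L))"
  define F where "F y p = (split_action V r h y (fst p) (snd p) + split_action V h r y (snd p) (fst p)) / 2
             + v (y + W r (fst p) + W h (snd p))" for y p
  have sb: "\<bar>split_action V r h y (fst p) (snd p)\<bar> \<le> B" "\<bar>split_action V h r y (snd p) (fst p)\<bar> \<le> B"
    if "p \<in> space ?MM" for y p
    using split_action_bound[OF V, of "fst p" "snd p" r h y] split_action_bound[OF V, of "snd p" "fst p" h r y]
      r h that by (auto simp: space_pair_measure add.commute B_def)
  have [measurable]: "case_prod F \<in> borel_measurable (cell_unif L \<Otimes>\<^sub>M ?MM)"
    unfolding F_def by measurable
  have Fb: "\<bar>F y p\<bar> \<le> B + K" if "p \<in> space ?MM" for y p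
    using sb[OF that, of y] K[of "y + W r (fst p) + W h (snd p)"] unfolding F_def abs_le_iff by (simp add: field_simps)
  have int: "integrable (cell_unif L \<Otimes>\<^sub>M ?MM) (case_prod F)"
    by (rule UP.P.integrable_const_bound[of _ "B + K"]) (use Fb in \<open>auto simp: space_pair_measure\<close>)
  have "(\<integral>y. (\<integral>p. F y p \<partial>?MM) \<partial>cell_unif L) = (\<integral>p. (\<integral>y. F y p \<partial>cell_unif L) \<partial>?MM)"
    by (rule UP.Fubini_integral[OF int, symmetric])
  also have "\<dots> = (\<integral>p. I + (\<integral>y. v y \<partial>cell_unif L) \<partial>?MM)"
  proof (rule Bochner_Integration.integral_cong[OF refl])
    fix p assume p: "p \<in> space ?MM"
    then have p': "fst p \<in> space M" "snd p \<in> space M" by (auto simp: space_pair_measure)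
    have i1: "integrable (cell_unif L) (\<lambda>y. split_action V r h y (fst p) (snd p))"
      by (rule U.integrable_const_bound[of _ B])
        (use sb[OF p] p' in \<open>auto intro!: split_action_measurable[OF V r, where f = "\<lambda>_. fst p" and f' = "\<lambda>_. snd p"]\<close>)
    have i2: "integrable (cell_unif L) (\<lambda>y. split_action V h r y (snd p) (fst p))"
      by (rule U.integrable_const_bound[of _ B])
        (use sb[OF p] p' in \<open>auto intro!: split_action_measurable[OF V h, where f = "\<lambda>_. snd p" and f' = "\<lambda>_. fst p"]\<close>)
    have i3: "integrable (cell_unif L) (\<lambda>y. v (y + W r (fst p) + W h (snd p)))"
      by (rule U.integrable_const_bound[of _ K]) (use K in auto)
    have "(\<integral>y. v (y + W r (fst p) + W h (snd p)) \<partial>cell_unif L) = (\<integral>y. v y \<partial>cell_unif L)"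
      using cell_unif_translate[OF L v perv K, of "W r (fst p) + W h (snd p)"] by (simp add: add.assoc)
    then show "(\<integral>y. F y p \<partial>cell_unif L) = I + (\<integral>y. v y \<partial>cell_unif L)"
      unfolding F_def using i1 i2 i3 split_action_cell_average[OF L V per m p' r h]
        split_action_cell_average[OF L V per m p'(2,1) h r] by (simp add: I_def add.commute[of h r])
  qed
  also have "\<dots> = I + (\<integral>y. v y \<partial>cell_unif L)" by (simp add: pair.P.prob_space)
  finally have avg: "(\<integral>y. (\<integral>p. F y p \<partial>?MM) \<partial>cell_unif L) = I + (\<integral>y. v y \<partial>cell_unif L)" .
  have iF: "integrable (cell_unif L) (\<lambda>y. \<integral>p. F y p \<partial>?MM)"
    using UP.integrable_fst[OF int] .
  have iG: "integrable (cell_unif L) (swap_gap V r h)"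
    using swap_gap_bounds[OF V r h] swap_gap_measurable[OF V r h]
    by (intro U.integrable_const_bound[of _ B]) (auto simp: B_def)
  let ?u = "fk V (r + h) (\<lambda>x. exp (v x))"
  have eK: "\<bar>exp (v x)\<bar> \<le> exp K" "exp (- K) \<le> exp (v x)" for x using K[of x] by auto
  have rh: "0 \<le> r + h" using r h by simp
  have iL: "integrable (cell_unif L) (\<lambda>y. ln (?u y))"
  proof (rule U.integrable_const_bound[of _ "B + K"])
    have [measurable]: "?u \<in> borel_measurable borel" by (rule fk_measurable[OF V rh]) measurable
    show "(\<lambda>y. ln (?u y)) \<in> borel_measurable (cell_unif L)" by measurable
    show "AE y in cell_unif L. norm (ln (?u y)) \<le> B + K"
    proof (intro AE_I2)
      fix y
      have pos: "0 < ?u y" and lo: "exp (- B) * exp (- K) \<le> ?u y"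
        using fk_pos[OF V rh, of "\<lambda>x. exp (v x)" "exp K" "exp (- K)" y] eK by (auto simp: B_def)
      have "?u y \<le> exp B * exp K"
        using fk_bounded[OF V rh, of "\<lambda>x. exp (v x)" "exp K" y] eK by (auto simp: B_def)
      from ln_mono[OF this pos] have "ln (?u y) \<le> B + K" by (simp add: mult_exp_exp)
      moreover have "- (B + K) \<le> ln (?u y)"
        using lo pos by (subst ln_ge_iff) (auto simp: mult_exp_exp)
      ultimately show "norm (ln (?u y)) \<le> B + K" by simp
    qed
  qed
  have "(\<integral>y. (\<integral>p. F y p \<partial>?MM) + swap_gap V r h y \<partial>cell_unif L) \<le> (\<integral>y. ln (?u y) \<partial>cell_unif L)"
  proof (rule integral_mono)
    show "(\<integral>p. F y p \<partial>?MM) + swap_gap V r h y \<le> ln (?u y)" for y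
      unfolding F_def by (rule fk_swap_jensen[OF V r h v K])
  qed (use iF iG iL in auto)
  then show ?thesis using iF iG avg by (simp add: I_def)
qed

section \<open>Positivity of the gain\<close>

lemma W_ball_pos:
  assumes t: "0 < t" and d: "0 < d"
  shows "0 < prob {w \<in> space M. W t w \<in> ball c d}"
proof -
  let ?p = "\<lambda>x :: real ^ 'd. \<Prod>i\<in>UNIV. normal_density 0 (sqrt t) (x $ i)"
  have D: "distributed M lborel (\<lambda>w. W t w - W 0 w) (\<lambda>x. ennreal (?p x))"
    using W_increment[of 0 t] t by simp
  have pm [measurable]: "?p \<in> borel_measurable borel"
    by (rule borel_measurable_continuous_onI) (use t in \<open>auto simp: normal_density_def intro!: continuous_intros\<close>)
  have pos: "0 < ?p x" for x using t by (intro prod_pos) (auto intro: normal_density_pos)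
  have eq: "{w \<in> space M. W t w \<in> ball c d} = (\<lambda>w. W t w - W 0 w) -` ball c d \<inter> space M"
    by (auto simp: W_0)
  have "emeasure M {w \<in> space M. W t w \<in> ball c d} = (\<integral>\<^sup>+x. ennreal (?p x) * indicator (ball c d) x \<partial>lborel)"
    unfolding eq by (rule distributed_emeasure[OF D]) simp
  moreover have "(\<integral>\<^sup>+x. ennreal (?p x) * indicator (ball c d) x \<partial>lborel) \<noteq> 0"
  proof
    assume "(\<integral>\<^sup>+x. ennreal (?p x) * indicator (ball c d) x \<partial>lborel) = 0"
    then have "AE x in lborel. ennreal (?p x) * indicator (ball c d) x = 0"
    proof (subst (asm) nn_integral_0_iff_AE)
      show "(\<lambda>x. ennreal (?p x) * indicator (ball c d) x) \<in> borel_measurable lborel"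
        using measurable_compose[OF pm measurable_ennreal]
        by (intro borel_measurable_times_ennreal borel_measurable_indicator) auto
    qed
    then have "AE x in lborel. x \<notin> ball c d"
    proof eventually_elim
      case (elim x)
      then show ?case using pos[of x] by (auto simp: indicator_def ennreal_eq_0_iff not_le split: if_splits)
    qed
    then have "emeasure lborel (ball c d) = 0"
      by (subst (asm) AE_iff_measurable[OF _ refl]) (auto simp: ball_def)
    then show False using open_emeasure_lborel_pos[of "ball c d"] d by simp
  qed
  ultimately have "emeasure M {w \<in> space M. W t w \<in> ball c d} \<noteq> 0" by simp
  then show ?thesis unfolding emeasure_eq_measure by (metis ennreal_0 zero_less_measure_iff)
qed

text \<open>By continuity rational times suffice, and they make the event measurable.\<close>

definition small_paths :: "real \<Rightarrow> real \<Rightarrow> 'w set" where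
  "small_paths d r = {w \<in> space M. \<forall>q\<in>\<rat>. 0 \<le> q \<and> q \<le> r \<longrightarrow> norm (W q w) \<le> d}"

lemma small_paths_measurable [measurable]: "small_paths d r \<in> events"
  unfolding small_paths_def
proof (rule sets.sets_Collect_countable_All'[OF _ countable_rat])
  fix q :: real
  show "{w \<in> space M. 0 \<le> q \<and> q \<le> r \<longrightarrow> norm (W q w) \<le> d} \<in> events"
  proof (cases "0 \<le> q")
    case True
    note [measurable] = W_measurable[OF True]
    show ?thesis by measurable
  qed simp
qed

lemma small_pathsD:
  assumes w: "w \<in> small_paths d r" and s: "0 \<le> s" "s \<le> r"
  shows "norm (W s w) \<le> d"
proof (cases "r = 0")
  case True
  then show ?thesis using w s by (auto simp: small_paths_def)
next
  case False
  then have r: "0 < r" using s by simp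
  let ?A = "{0<..<r} \<inter> \<rat>"
  have wM: "w \<in> space M" using w by (simp add: small_paths_def)
  have cl: "closure ?A = {0..r}"
    using closure_open_Int_superset[of "{0<..<r}" "\<rat> :: real set"] Rats_closure_real r by (simp add: closure_greaterThanLessThan)
  have "(\<lambda>s. norm (W s w)) ` closure ?A \<subseteq> {..d}"
    by (rule image_closure_subset)
       (use w r cl in \<open>auto simp: small_paths_def intro!: continuous_intros W_cont'[OF wM]\<close>)
  then have "\<forall>s\<in>{0..r}. norm (W s w) \<le> d" unfolding cl by (simp add: image_subset_iff)
  then show ?thesis using s by simp
qed

text \<open>All paths are continuous at 0, so these events exhaust the space as the duration shrinks.\<close>

lemma small_paths_pos:
  assumes "0 < d"
  shows "\<exists>n0. \<forall>n\<ge>n0. 0 < prob (small_paths d (1 / real (Suc n)))"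
proof -
  have ex: "\<exists>n. w \<in> small_paths d (1 / real (Suc n))" if w: "w \<in> space M" for w
  proof -
    have "continuous (at 0 within {0..}) (\<lambda>s. W s w)"
      using W_continuous[OF w] by (auto simp: continuous_on_eq_continuous_within)
    then obtain e where e: "e > 0" "\<And>s. 0 \<le> s \<Longrightarrow> dist s 0 < e \<Longrightarrow> dist (W s w) (W 0 w) < d"
      using assms unfolding continuous_within_eps_delta by (metis atLeast_iff)
    obtain n where n: "1 / real (Suc n) < e"
      using reals_Archimedean[OF e(1)] by (auto simp: inverse_eq_divide)
    have "norm (W q w) \<le> d" if "0 \<le> q" "q \<le> 1 / real (Suc n)" for q
      using e(2)[of q] that n W_0[OF w] by (auto simp: dist_norm)
    then show ?thesis using w by (auto simp: small_paths_def intro!: exI[of _ n])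
  qed
  have "\<exists>n. prob (small_paths d (1 / real (Suc n))) \<noteq> 0"
  proof (rule ccontr)
    assume "\<not> ?thesis"
    then have "AE w in M. w \<notin> small_paths d (1 / real (Suc n))" for n
      by (intro AE_not_in null_setsI) (auto simp: emeasure_eq_measure)
    then have "AE w in M. \<forall>n. w \<notin> small_paths d (1 / real (Suc n))"
      by (simp add: AE_all_countable)
    then have "AE w in M. False" using AE_space by eventually_elim (use ex in blast)
    then show False by simp
  qed
  then obtain n0 where n0: "0 < prob (small_paths d (1 / real (Suc n0)))"
    by (auto simp: zero_less_measure_iff)
  have "0 < prob (small_paths d (1 / real (Suc n)))" if "n0 \<le> n" for n
  proof -
    have "1 / real (Suc n) \<le> 1 / real (Suc n0)" using that by (simp add: frac_le)
    then have "small_paths d (1 / real (Suc n0)) \<subseteq> small_paths d (1 / real (Suc n))"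
      unfolding small_paths_def by (blast intro: order_trans)
    from finite_measure_mono[OF this] n0 show ?thesis by simp
  qed
  then show ?thesis by blast
qed

text \<open>The piece of duration \<open>r\<close> hardly moves: it stays near \<open>y1\<close> if it comes first and near \<open>y2\<close> if it
comes after the jump. The jump takes only the time \<open>r * r\<close>, so its action is of smaller order.\<close>

lemma swap_diff_lower:
  assumes V: "controlled V S" and r: "0 < r" "r \<le> 1" "2 * r < d" and h: "h = r * r"
    and unif: "\<And>y z t. dist y z < d \<Longrightarrow> 0 \<le> t \<Longrightarrow> t < d \<Longrightarrow> \<bar>V y t - V z 0\<bar> \<le> e"
    and K: "\<And>t. 0 \<le> t \<Longrightarrow> t \<le> 2 \<Longrightarrow> S t \<le> K" "2 * K * r \<le> e"
    and y: "dist y y1 < d / 4" and w: "w \<in> small_paths (d / 4) r"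
    and w': "w' \<in> space M" "dist (W h w') (y2 - y1) < d / 4"
  shows "r * (\<bar>V y1 0 - V y2 0\<bar> - 3 * e) \<le> \<bar>swap_diff V r h y (w, w')\<bar>"
proof -
  have wM: "w \<in> space M" using w by (simp add: small_paths_def)
  have h0: "0 \<le> h" and hr: "h \<le> r" using r h by (auto simp: mult_left_le)
  have d: "0 < d" using r by linarith
  note cont = controlled_continuous[OF V]
  let ?a1 = "LINT s:{0..r}|lborel. V (y + W s w) (r + h - s)"
  let ?a2 = "LINT s:{0..h}|lborel. V (y + W r w + W s w') (h - s)"
  let ?b1 = "LINT s:{0..h}|lborel. V (y + W s w') (h + r - s)"
  let ?b2 = "LINT s:{0..r}|lborel. V (y + W h w' + W s w) (r - s)"
  have a1: "\<bar>?a1 - r * V y1 0\<bar> \<le> r * e"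
  proof (rule LINT_near_const)
    show "continuous_on {0..r} (\<lambda>s. V (y + W s w) (r + h - s))"
      using wM by (intro cont continuous_intros W_cont') auto
    fix s assume s: "s \<in> {0..r}"
    have "dist (y + W s w) y1 \<le> dist y y1 + norm (W s w)"
      using norm_triangle_ineq[of "y - y1" "W s w"] by (simp add: dist_norm algebra_simps)
    then have "dist (y + W s w) y1 < d" using y small_pathsD[OF w, of s] s d by simp
    then show "\<bar>V (y + W s w) (r + h - s) - V y1 0\<bar> \<le> e"
      using s h0 hr r by (intro unif) auto
  qed (use r in simp)
  have b2: "\<bar>?b2 - r * V y2 0\<bar> \<le> r * e"
  proof (rule LINT_near_const)
    show "continuous_on {0..r} (\<lambda>s. V (y + W h w' + W s w) (r - s))"
      using wM by (intro cont continuous_intros W_cont') auto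
    fix s assume s: "s \<in> {0..r}"
    have "norm (y + W h w' + W s w - y2) \<le> norm (y - y1) + norm (W h w' - (y2 - y1)) + norm (W s w)"
      using norm_triangle_ineq[of "(y - y1) + (W h w' - (y2 - y1))" "W s w"]
        norm_triangle_ineq[of "y - y1" "W h w' - (y2 - y1)"] by (simp add: algebra_simps)
    then have "dist (y + W h w' + W s w) y2 < d"
      using y w'(2) small_pathsD[OF w, of s] s d by (simp add: dist_norm)
    then show "\<bar>V (y + W h w' + W s w) (r - s) - V y2 0\<bar> \<le> e"
      using s r by (intro unif) auto
  qed (use r in simp)
  have SK: "\<bar>V x t\<bar> \<le> K" if "0 \<le> t" "t \<le> 2" for x t
    using controlled_bound[OF V, of x t] K(1)[OF that] by simp
  have a2: "\<bar>?a2 - h * 0\<bar> \<le> h * K"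
    by (rule LINT_near_const) (use w'(1) h0 hr r SK in \<open>auto intro!: cont continuous_intros W_cont'\<close>)
  have b1: "\<bar>?b1 - h * 0\<bar> \<le> h * K"
    by (rule LINT_near_const) (use w'(1) h0 hr r SK in \<open>auto intro!: cont continuous_intros W_cont'\<close>)
  have "2 * (h * K) \<le> r * e"
    using mult_left_mono[OF K(2), of r] r(1) by (simp add: h mult_ac)
  moreover have "\<bar>r * V y1 0 - r * V y2 0\<bar> = r * \<bar>V y1 0 - V y2 0\<bar>"
    using r(1) by (simp add: abs_mult right_diff_distrib[symmetric])
  moreover have "swap_diff V r h y (w, w') = (?a1 + ?a2) - (?b1 + ?b2)"
    by (simp add: swap_diff_def split_action_def)
  moreover have "r * (\<bar>V y1 0 - V y2 0\<bar> - 3 * e) = r * \<bar>V y1 0 - V y2 0\<bar> - 3 * (r * e)"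
    by (simp add: algebra_simps)
  moreover have "\<bar>p - q\<bar> - 3 * c \<le> \<bar>(a + a') - (b' + b)\<bar>"
    if "\<bar>a - p\<bar> \<le> c" "\<bar>b - q\<bar> \<le> c" "\<bar>a'\<bar> \<le> k" "\<bar>b'\<bar> \<le> k" "2 * k \<le> c" for p q a a' b b' c k :: real
    using that by linarith
  from this[OF a1 b2] have "\<bar>r * V y1 0 - r * V y2 0\<bar> - 3 * (r * e) \<le> \<bar>(?a1 + ?a2) - (?b1 + ?b2)\<bar>"
    if "2 * (h * K) \<le> r * e" using that a2 b1 by simp
  ultimately show ?thesis by metis
qed

text \<open>A piece that hardly moves and a much shorter piece that jumps between two places where the potential
differs have different actions in the two orders. Both kinds of pieces have positive probability,
and they are independent.\<close>

lemma swap_gap_pos: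
  assumes L: "L > 0" and V: "controlled V S" and per: "\<And>t. cell_periodic L (\<lambda>y. V y t)"
    and unif: "\<And>e. 0 < e \<Longrightarrow> \<exists>d>0. \<forall>y z t. dist y z < d \<longrightarrow> 0 \<le> t \<longrightarrow> t < d \<longrightarrow> \<bar>V y t - V z 0\<bar> \<le> e"
    and ne: "V y1 0 \<noteq> V y2 0"
  shows "\<exists>n. 0 < (\<integral>y. swap_gap V (1 / Suc n) (1 / Suc n * (1 / Suc n)) y \<partial>cell_unif L)"
proof -
  interpret U: prob_space "cell_unif L" by (rule prob_space_cell_unif[OF L])
  define x1 where "x1 = cell_rep L y1"
  have x1: "x1 \<in> half_open_cell L" "V x1 0 = V y1 0"
    unfolding x1_def using cell_rep_mem[OF L] cell_periodic_rep'[OF per] by auto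
  \<comment> \<open>A quarter, because three errors of this size are to be subtracted.\<close>
  define e where "e = \<bar>V x1 0 - V y2 0\<bar> / 4"
  have e: "0 < e" using ne x1 by (simp add: e_def)
  obtain d where d: "0 < d" "\<And>y z t. dist y z < d \<Longrightarrow> 0 \<le> t \<Longrightarrow> t < d \<Longrightarrow> \<bar>V y t - V z 0\<bar> \<le> e"
    using unif[OF e] by blast
  have "compact (S ` {0..2})"
    using controlled_S_continuous[OF V continuous_on_id] by (intro compact_continuous_image) auto
  then have "bdd_above (S ` {0..2})" by (intro bounded_imp_bdd_above compact_imp_bounded)
  then obtain K0 where "\<forall>t\<in>{0..2}. S t \<le> K0" by (auto simp: bdd_above_def)
  then have K0: "\<And>t. 0 \<le> t \<Longrightarrow> t \<le> 2 \<Longrightarrow> S t \<le> K0" by simp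
  define K where "K = max K0 1"
  have K: "\<And>t. 0 \<le> t \<Longrightarrow> t \<le> 2 \<Longrightarrow> S t \<le> K" "0 < K" using K0 by (fastforce simp: K_def)+
  obtain n0 where n0: "\<And>n. n \<ge> n0 \<Longrightarrow> 0 < prob (small_paths (d / 4) (1 / real (Suc n)))"
    using small_paths_pos[of "d / 4"] d by auto
  have "(\<lambda>n. 1 / real (Suc n)) \<longlonglongrightarrow> 0" by (rule LIMSEQ_Suc[OF lim_1_over_n])
  moreover have "0 < min (d / 2) (e / (2 * K))" using d e K by simp
  ultimately have "\<forall>\<^sub>F n in sequentially. 1 / real (Suc n) < min (d / 2) (e / (2 * K))"
    by (rule order_tendstoD)
  then have "\<forall>\<^sub>F n in sequentially. 1 / real (Suc n) < min (d / 2) (e / (2 * K)) \<and> n \<ge> n0"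
    using eventually_ge_at_top by (rule eventually_conj)
  then obtain n where n: "1 / real (Suc n) < min (d / 2) (e / (2 * K))" "n \<ge> n0"
    unfolding eventually_sequentially by blast
  define r where "r = 1 / real (Suc n)"
  define h where "h = r * r"
  have r0: "0 < r" "r \<le> 1" by (auto simp: r_def)
  have "r < d / 2" "r < e / (2 * K)" using n(1) by (auto simp: r_def)
  then have r: "0 < r" "r \<le> 1" "2 * r < d" "2 * K * r \<le> e" "0 \<le> h" "0 < h"
    using r0 K(2) by (auto simp: h_def field_simps)
  define E where "E = small_paths (d / 4) r"
  define G where "G = {w \<in> space M. W h w \<in> ball (y2 - x1) (d / 4)}"
  define A where "A = ball x1 (d / 4)"
  have [measurable]: "E \<in> events" by (simp add: E_def)
  have [measurable]: "G \<in> events"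
    unfolding G_def using measurable_sets[OF W_measurable[OF r(5)], of "ball (y2 - x1) (d / 4)"]
    by (simp add: vimage_def Int_def conj_commute)
  have pos: "0 < prob E" "0 < prob G" "0 < measure (cell_unif L) A"
  proof -
    show "0 < prob E" using n0[OF n(2)] by (simp only: E_def r_def)
    show "0 < prob G" unfolding G_def by (rule W_ball_pos[OF r(6)]) (use d in simp)
    show "0 < measure (cell_unif L) A"
      using cell_unif_open_pos[OF _ _ x1(1) L, of A] d by (simp add: A_def)
  qed
  define k where "k = ln (cosh (r * e / 2))"
  have k: "0 < k" unfolding k_def using r e cosh_real_strict_mono[of 0 "r * e / 2"] by simp
  have re: "0 \<le> r" using r by simp
  have gap: "k * (prob E * prob G) \<le> swap_gap V r h y" if "y \<in> A" for y
  proof -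
    have "(\<integral>p. k * indicator (E \<times> G) p \<partial>(M \<Otimes>\<^sub>M M)) \<le> swap_gap V r h y"
      unfolding swap_gap_def
    proof (rule integral_mono[OF _ swap_gap_integrable[OF V re r(5)]])
      fix p assume "p \<in> space (M \<Otimes>\<^sub>M M)"
      show "k * indicator (E \<times> G) p \<le> ln (cosh (swap_diff V r h y p / 2))"
      proof (cases "p \<in> E \<times> G")
        case True
        then obtain w w' where p: "p = (w, w')" "w \<in> E" "w' \<in> G" by auto
        have "r * (\<bar>V x1 0 - V y2 0\<bar> - 3 * e) \<le> \<bar>swap_diff V r h y (w, w')\<bar>"
          by (rule swap_diff_lower[OF V r(1,2,3) h_def d(2) K(1) r(4)])
             (use that p in \<open>auto simp: A_def E_def G_def dist_commute\<close>)
        then have "r * e / 2 \<le> \<bar>swap_diff V r h y p / 2\<bar>" by (simp add: e_def p(1))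
        moreover have "0 \<le> r * e / 2" using r e by simp
        ultimately show ?thesis using True ln_cosh_mono[of "r * e / 2" "swap_diff V r h y p / 2"] unfolding k_def
          by (simp only: indicator_simps mult_1_right)
      qed (simp add: ln_cosh_nonneg)
    qed (auto intro!: integrable_mult_right pair.P.integrable_const_bound[of _ 1])
    also have "(\<integral>p. k * indicator (E \<times> G) p \<partial>(M \<Otimes>\<^sub>M M)) = k * (prob E * prob G)"
      by (simp add: measure_def pair.emeasure_pair_measure_Times emeasure_pair_measure_Times enn2real_mult)
    finally show ?thesis .
  qed
  have "0 < (k * (prob E * prob G)) * measure (cell_unif L) A"
    using k pos by simp
  also have "\<dots> = (\<integral>y. (k * (prob E * prob G)) * indicator A y \<partial>cell_unif L)"
    by (simp add: A_def)
  also have "\<dots> \<le> (\<integral>y. swap_gap V r h y \<partial>cell_unif L)"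
  proof (rule integral_mono)
    show "integrable (cell_unif L) (\<lambda>y. (k * (prob E * prob G)) * indicator A y)"
      by (intro integrable_mult_right U.integrable_const_bound[of _ 1])
        (auto simp: A_def intro!: borel_measurable_indicator)
    show "integrable (cell_unif L) (\<lambda>y. swap_gap V r h y)"
      using swap_gap_bounds[OF V re r(5)] swap_gap_measurable[OF V re r(5)]
      by (intro U.integrable_const_bound[of _ "budget S 0 (r + h)"]) auto
    show "(k * (prob E * prob G)) * indicator A y \<le> swap_gap V r h y" for y
      using gap[of y] swap_gap_bounds(1)[OF V re r(5), of y] by (simp add: indicator_def)
  qed
  finally show ?thesis unfolding r_def h_def by (intro exI[of _ n]) simp
qed

end

section \<open>Separated fields\<close>

text \<open>By induction on \<open>J\<close>. If interpolation at \<open>P\<close> does not already reproduce the new function, one further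
point where the interpolation error \<open>r\<close> is nonzero determines its coefficient (a step of Gaussian
elimination on the point evaluations). The predicate \<open>good\<close> stands for any linear space that contains the
given functions; the interpolation weights belong to it.\<close>

lemma finite_interpolation:
  fixes g :: "'j \<Rightarrow> 'x \<Rightarrow> real"
  assumes J: "finite J" and g: "\<And>j. j \<in> J \<Longrightarrow> good (g j)"
    and zero: "good (\<lambda>_. 0)" and lin: "\<And>f k a. good f \<Longrightarrow> good k \<Longrightarrow> good (\<lambda>x. f x + a * k x)"
  shows "\<exists>P h. finite P \<and> (\<forall>p\<in>P. good (h p)) \<and>
    (\<forall>c x. (\<Sum>j\<in>J. c j * g j x) = (\<Sum>p\<in>P. h p x * (\<Sum>j\<in>J. c j * g j p)))"
  using J g
proof (induction J)
  case empty
  show ?case by (intro exI[of _ "{}"]) simp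
next
  case (insert j J)
  obtain P h where P: "finite P" "\<And>p. p \<in> P \<Longrightarrow> good (h p)"
    and I: "\<And>c x. (\<Sum>j\<in>J. c j * g j x) = (\<Sum>p\<in>P. h p x * (\<Sum>j\<in>J. c j * g j p))"
  proof -
    have "\<exists>P h. finite P \<and> (\<forall>p\<in>P. good (h p)) \<and>
        (\<forall>c x. (\<Sum>j\<in>J. c j * g j x) = (\<Sum>p\<in>P. h p x * (\<Sum>j\<in>J. c j * g j p)))"
      by (rule insert.IH) (simp add: insert.prems)
    then show ?thesis using that by blast
  qed
  have good_sum: "good (\<lambda>x. f x + (\<Sum>p\<in>A. a p * h p x))" if "finite A" "A \<subseteq> P" "good f" for A f a
    using that
  proof (induction A)
    case (insert p A)
    then show ?case using lin[of "\<lambda>x. f x + (\<Sum>p\<in>A. a p * h p x)" "h p" "a p"] P(2)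
      by (simp add: add.assoc add.commute add.left_commute)
  qed simp
  define r where "r x = g j x - (\<Sum>p\<in>P. h p x * g j p)" for x
  have r_good: "good r"
    using good_sum[of P "g j" "\<lambda>p. - g j p"] P(1) insert.prems by (simp add: r_def[abs_def] sum_negf mult.commute)
  define F where "F c x = (\<Sum>j\<in>insert j J. c j * g j x)" for c x
  have F: "(\<Sum>p\<in>P. h p x * F c p) = F c x - c j * r x" for c x
  proof -
    have "(\<Sum>p\<in>P. h p x * F c p) = (\<Sum>p\<in>P. h p x * (\<Sum>j\<in>J. c j * g j p)) + c j * (\<Sum>p\<in>P. h p x * g j p)"
      unfolding F_def using insert.hyps by (simp add: algebra_simps sum.distrib sum_distrib_left)
    then show ?thesis unfolding I[symmetric] F_def r_def using insert.hyps by (simp add: algebra_simps)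
  qed
  show ?case
  proof (cases "\<forall>x. r x = 0")
    case True
    then show ?thesis using P F by (intro exI[of _ P] exI[of _ h]) (auto simp: F_def[symmetric])
  next
    case False
    then obtain x0 where x0: "r x0 \<noteq> 0" by blast
    define k where "k p x = h p x - h p x0 * (r x / r x0)" for p x
    define h' where "h' p x = (if p \<in> P then k p x else 0) + (if p = x0 then r x / r x0 else 0)" for p x
    have k_good: "good (k p)" if "p \<in> P" for p
      using lin[OF P(2)[OF that] r_good, of "- (h p x0 / r x0)"] by (simp add: k_def[abs_def])
    have h'_good: "good (h' p)" for p
    proof -
      have 1: "good (\<lambda>x. if p \<in> P then k p x else 0)" using k_good zero by (cases "p \<in> P") auto
      show ?thesis
      proof (cases "p = x0")
        case True
        then show ?thesis using lin[OF 1 r_good, of "1 / r x0"] unfolding h'_def[abs_def] by simp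
      next
        case False
        then show ?thesis using 1 by (simp add: h'_def[abs_def])
      qed
    qed
    have "F c x = (\<Sum>p\<in>insert x0 P. h' p x * F c p)" for c x
    proof -
      have c: "c j = (F c x0 - (\<Sum>p\<in>P. h p x0 * F c p)) / r x0" using F[of x0 c] x0 by simp
      have "(\<Sum>p\<in>insert x0 P. h' p x * F c p)
          = (\<Sum>p\<in>insert x0 P. (if p \<in> P then k p x * F c p else 0)) + (\<Sum>p\<in>insert x0 P. (if p = x0 then r x / r x0 * F c p else 0))"
        unfolding sum.distrib[symmetric] by (intro sum.cong) (auto simp: h'_def algebra_simps)
      also have "(\<Sum>p\<in>insert x0 P. (if p \<in> P then k p x * F c p else 0)) = (\<Sum>p\<in>P. k p x * F c p)"
        using P(1) by (intro sum.mono_neutral_cong_right) auto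
      also have "(\<Sum>p\<in>insert x0 P. (if p = x0 then r x / r x0 * F c p else 0)) = r x / r x0 * F c x0"
        using P(1) by simp
      also have "(\<Sum>p\<in>P. k p x * F c p) = (\<Sum>p\<in>P. h p x * F c p) - r x / r x0 * (\<Sum>p\<in>P. h p x0 * F c p)"
        unfolding k_def by (simp add: algebra_simps sum_subtractf sum_distrib_left)
      finally show ?thesis unfolding F[of x c] c using x0 by (simp add: field_simps)
    qed
    then have "\<forall>c x. (\<Sum>j\<in>insert j J. c j * g j x) = (\<Sum>p\<in>insert x0 P. h' p x * (\<Sum>j\<in>insert j J. c j * g j p))"
      unfolding F_def by blast
    moreover have "finite (insert x0 P)" "\<forall>p\<in>insert x0 P. good (h' p)" using P(1) h'_good by auto
    ultimately show ?thesis by blast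
  qed
qed

lemma C01_periodic_lin:
  assumes "f \<in> C01_periodic L" "k \<in> C01_periodic L"
  shows "(\<lambda>x. f x + a * k x) \<in> C01_periodic L"
proof -
  obtain C D where "C-lipschitz_on UNIV f" "D-lipschitz_on UNIV k"
    using assms by (auto simp: C01_periodic_def)
  then have "(C + \<bar>a\<bar> * D)-lipschitz_on UNIV (\<lambda>x. f x + a * k x)"
    by (intro lipschitz_on_add lipschitz_on_cmult_real)
  then show ?thesis using assms by (auto simp: C01_periodic_def cell_periodic_def)
qed

lemma C01_periodic_zero: "(\<lambda>_. 0) \<in> C01_periodic L"
  using lipschitz_on_constant[of UNIV 0] by (auto simp: C01_periodic_def cell_periodic_def)

lemma C01_periodic_continuous: "g \<in> C01_periodic L \<Longrightarrow> continuous_on A g"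
  unfolding C01_periodic_def using lipschitz_on_continuous_on continuous_on_subset by blast

lemma C01_periodic_per: "g \<in> C01_periodic L \<Longrightarrow> cell_periodic L g"
  by (simp add: C01_periodic_def)

lemma C01_periodic_bounded:
  assumes L: "L > 0" and g: "g \<in> C01_periodic L"
  shows "bdd_above (range (\<lambda>y :: real ^ 'd. \<bar>g y\<bar>))"
proof -
  obtain C where C: "C-lipschitz_on UNIV g" using g by (auto simp: C01_periodic_def)
  have "\<bar>g y\<bar> \<le> \<bar>g 0\<bar> + C * (real CARD('d) * L)" for y
  proof -
    have "norm (cell_rep L y) \<le> (\<Sum>i\<in>UNIV. \<bar>cell_rep L y $ i\<bar>)" by (rule norm_le_l1_cart)
    also have "\<dots> \<le> (\<Sum>i\<in>(UNIV :: 'd set). L)"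
      using cell_rep_mem[OF L, of y] by (intro sum_mono) (auto simp: half_open_cell_def less_imp_le)
    finally have "norm (cell_rep L y) \<le> real CARD('d) * L" by simp
    then have "C * norm (cell_rep L y) \<le> C * (real CARD('d) * L)"
      using lipschitz_on_nonneg[OF C] by (rule mult_left_mono)
    moreover have "dist (g (cell_rep L y)) (g 0) \<le> C * dist (cell_rep L y) 0"
      using C by (rule lipschitz_onD) auto
    moreover have "g (cell_rep L y) = g y" using cell_periodic_rep'[OF C01_periodic_per[OF g]] .
    ultimately show ?thesis by (simp add: dist_real_def)
  qed
  then show ?thesis by (auto simp: bdd_above_def)
qed

lemma abs_le_C01_norm:
  assumes L: "L > 0" and g: "(g :: real ^ 'd \<Rightarrow> real) \<in> C01_periodic L"
  shows "\<bar>g y\<bar> \<le> C01_norm g"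
proof -
  obtain C where C: "C-lipschitz_on UNIV g" using g by (auto simp: C01_periodic_def)
  let ?Q = "\<lambda>(y, z). \<bar>g y - g z\<bar> / dist y z"
  let ?D = "{(y, z). y \<noteq> z} :: ((real ^ 'd) \<times> (real ^ 'd)) set"
  have bdd: "bdd_above (?Q ` ?D)"
    using lipschitz_onD[OF C] by (intro bdd_aboveI2[of _ _ C]) (auto simp: dist_real_def field_simps)
  have "(0, \<chi> i. 1) \<in> ?D" by (simp add: vec_eq_iff)
  then have "0 \<le> (SUP p\<in>?D. ?Q p)"
    by (intro cSUP_upper2[OF bdd, of "(0, \<chi> i. 1)"]) auto
  moreover have "\<bar>g y\<bar> \<le> (SUP y. \<bar>g y\<bar>)"
    by (rule cSUP_upper[OF _ C01_periodic_bounded[OF L g]]) simp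
  ultimately show ?thesis unfolding C01_norm_def by linarith
qed

lemma continuous_process_measurable:
  fixes f :: "real \<Rightarrow> 'o \<Rightarrow> real"
  assumes m: "\<And>t. f t \<in> borel_measurable Q" and c: "\<And>\<omega>. \<omega> \<in> space Q \<Longrightarrow> continuous_on UNIV (\<lambda>t. f t \<omega>)"
  shows "(\<lambda>p. f (fst p) (snd p)) \<in> borel_measurable (borel \<Otimes>\<^sub>M Q)"
proof (rule borel_measurable_LIMSEQ_real)
  let ?q = "\<lambda>n t. real_of_int \<lfloor>real (Suc n) * t\<rfloor> / real (Suc n)"
  show "(\<lambda>n. f (?q n (fst p)) (snd p)) \<longlonglongrightarrow> f (fst p) (snd p)" if p: "p \<in> space (borel \<Otimes>\<^sub>M Q)" for p
  proof -
    have "(\<lambda>n. ?q n t) \<longlonglongrightarrow> t" for t by (rule floor_grid_tendsto)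
    then show ?thesis
      using continuous_on_tendsto_compose[OF c, of "snd p" "\<lambda>n. ?q n (fst p)" "fst p" sequentially] p
      by (auto simp: space_pair_measure)
  qed
  show "(\<lambda>p. f (?q n (fst p)) (snd p)) \<in> borel_measurable (borel \<Otimes>\<^sub>M Q)" for n
  proof (rule measurable_compose_countable[where f = "\<lambda>i p. f (real_of_int i / real (Suc n)) (snd p)"
        and g = "\<lambda>p. \<lfloor>real (Suc n) * fst p\<rfloor>"])
    show "(\<lambda>p. f (real_of_int i / real (Suc n)) (snd p)) \<in> borel_measurable (borel \<Otimes>\<^sub>M Q)" for i
      by (rule measurable_compose[OF measurable_snd m])
  qed measurable
qed

lemma gaussian_rv_integrable:
  assumes "prob_space Q" "gaussian_rv Q X"
  shows "integrable Q X"
proof -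
  interpret prob_space Q by fact
  have [measurable]: "X \<in> borel_measurable Q" using assms(2) by (simp add: gaussian_rv_def)
  obtain m where "(\<exists>s>0. distributed Q lborel X (\<lambda>x. ennreal (normal_density m s x))) \<or> (AE w in Q. X w = m)"
    using assms(2) by (auto simp: gaussian_rv_def)
  then show ?thesis
  proof
    assume "\<exists>s>0. distributed Q lborel X (\<lambda>x. ennreal (normal_density m s x))"
    then obtain s where s: "s > 0" "distributed Q lborel X (\<lambda>x. ennreal (normal_density m s x))" by blast
    have "integrable lborel (\<lambda>x. normal_density m s x * x)"
      using s(1) by (rule integrable_normal_moment_nz_1)
    then show ?thesis using distributed_integrable[OF s(2), of "\<lambda>x. x"] by simp
  next
    assume "AE w in Q. X w = m"
    then show ?thesis by (subst integrable_cong_AE[of _ _ "\<lambda>_. m"]) auto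
  qed
qed

lemma (in prob_space) Fubini_LINT:
  fixes f :: "real \<Rightarrow> 'a \<Rightarrow> real"
  assumes f [measurable]: "(\<lambda>p. f (fst p) (snd p)) \<in> borel_measurable (borel \<Otimes>\<^sub>M M)"
    and i: "\<And>s. s \<in> {a..b} \<Longrightarrow> integrable M (f s)" and k: "\<And>s. s \<in> {a..b} \<Longrightarrow> (\<integral>x. \<bar>f s x\<bar> \<partial>M) \<le> k"
  shows "integrable M (\<lambda>x. LINT s:{a..b}|lborel. f s x)"
    and "(\<integral>x. (LINT s:{a..b}|lborel. f s x) \<partial>M) = (LINT s:{a..b}|lborel. (\<integral>x. f s x \<partial>M))"
proof -
  interpret P: pair_sigma_finite "lborel :: real measure" M ..
  let ?F = "\<lambda>s x. indicator {a..b} s *\<^sub>R f s x"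
  have [measurable (raw)]: "(\<lambda>q. f (g q) (k q)) \<in> borel_measurable N"
    if "g \<in> borel_measurable N" "k \<in> measurable N M" for g k N
    using measurable_compose[OF measurable_Pair[OF that] f] by simp
  have m: "case_prod ?F \<in> borel_measurable (lborel \<Otimes>\<^sub>M M)" by measurable
  have I: "integrable (lborel \<Otimes>\<^sub>M M) (case_prod ?F)"
  proof (rule P.Fubini_integrable[OF m])
    have k0: "0 \<le> max k 0" by simp
    show "integrable lborel (\<lambda>s. \<integral>x. norm (case_prod ?F (s, x)) \<partial>M)"
    proof (rule Bochner_Integration.integrable_bound)
      show "integrable lborel (\<lambda>s. max k 0 * indicator {a..b} s)"
        by (intro integrable_mult_right integrable_real_indicator) (auto simp: emeasure_lborel_Icc_eq)
      show "(\<lambda>s. \<integral>x. norm (case_prod ?F (s, x)) \<partial>M) \<in> borel_measurable lborel"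
        using m by measurable
      show "AE s in lborel. norm (\<integral>x. norm (case_prod ?F (s, x)) \<partial>M) \<le> norm (max k 0 * indicator {a..b} s)"
        using k by (intro AE_I2) (auto simp: indicator_def abs_of_nonneg intro: order_trans[OF _ max.cobounded1])
    qed
    show "AE s in lborel. integrable M (\<lambda>x. case_prod ?F (s, x))"
      using i by (intro AE_I2) (auto simp: indicator_def)
  qed
  show "integrable M (\<lambda>x. LINT s:{a..b}|lborel. f s x)"
    using P.integrable_snd[OF I] by (simp add: set_lebesgue_integral_def)
  show "(\<integral>x. (LINT s:{a..b}|lborel. f s x) \<partial>M) = (LINT s:{a..b}|lborel. (\<integral>x. f s x \<partial>M))"
    using P.Fubini_integral[OF I] by (simp add: set_lebesgue_integral_def)
qed

lemma (in wiener) fk_cong_potential: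
  assumes "\<And>y s. 0 \<le> s \<Longrightarrow> s \<le> t \<Longrightarrow> V y s = V' y s"
  shows "fk V t g y = fk V' t g y"
  unfolding fk_def using assms
  by (intro Bochner_Integration.integral_cong arg_cong2[where f = "(*)"] arg_cong[where f = exp]
      set_lebesgue_integral_cong) auto

lemma (in wiener) swap_gap_cong_potential:
  assumes "\<And>y s. 0 \<le> s \<Longrightarrow> s \<le> r + h \<Longrightarrow> V y s = V' y s" and r: "0 \<le> r" and h: "0 \<le> h"
  shows "swap_gap V r h y = swap_gap V' r h y"
proof -
  have "split_action V r h y w w' = split_action V' r h y w w'" "split_action V h r y w w' = split_action V' h r y w w'" for w w'
    unfolding split_action_def using r h
    by (auto intro!: arg_cong2[where f = "(+)"] set_lebesgue_integral_cong assms)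
  then show ?thesis unfolding swap_gap_def swap_diff_def by simp
qed

lemma budget_cong:
  assumes "\<And>s. a \<le> s \<Longrightarrow> s \<le> b \<Longrightarrow> S s = S' s"
  shows "budget S a b = budget S' a b"
  unfolding budget_def using assms by (intro set_lebesgue_integral_cong) auto

text \<open>The values at the finitely many points \<open>P\<close> determine the field. Through the bounded weights \<open>h\<close> its supremum
over space is controlled by finitely many integrable stationary processes.\<close>

locale separated_field = F: random_shear_field Q L b \<tau> + wiener M W
  for Q :: "'o measure" and L :: real and b :: "real ^ 'd \<Rightarrow> real \<Rightarrow> 'o \<Rightarrow> real" and \<tau> :: "real \<Rightarrow> 'o \<Rightarrow> 'o"
    and M :: "'w measure" and W :: "real \<Rightarrow> 'w \<Rightarrow> real ^ 'd" +
  fixes P :: "(real ^ 'd) set" and h :: "real ^ 'd \<Rightarrow> real ^ 'd \<Rightarrow> real"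
  assumes P_fin: "finite P" and h: "\<And>p. p \<in> P \<Longrightarrow> h p \<in> C01_periodic L"
    and sep: "\<And>y t \<omega>. t \<ge> 0 \<Longrightarrow> \<omega> \<in> space Q \<Longrightarrow> b y t \<omega> = (\<Sum>p\<in>P. h p y * b p t \<omega>)"
begin

lemmas L_pos = F.L_pos

abbreviation "\<rho> \<equiv> rho Q M W b"

text \<open>Freezing the field at times before 0 makes it continuous on the whole time axis.\<close>

definition B :: "real ^ 'd \<Rightarrow> real \<Rightarrow> 'o \<Rightarrow> real" where
  "B p t \<omega> = b p (max 0 t) \<omega>"

text \<open>With this potential, \<open>fk1 (V lam \<omega>)\<close> is the functional whose growth rate is the exponent.\<close>

definition V :: "real \<Rightarrow> 'o \<Rightarrow> real ^ 'd \<Rightarrow> real \<Rightarrow> real" where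
  "V lam \<omega> y t = - lam * (\<Sum>p\<in>P. h p y * B p t \<omega>)"

definition S :: "real \<Rightarrow> 'o \<Rightarrow> real \<Rightarrow> real" where
  "S lam \<omega> t = \<bar>lam\<bar> * (\<Sum>p\<in>P. (SUP y. \<bar>h p y\<bar>) * \<bar>B p t \<omega>\<bar>)"

lemma V_eq: "\<omega> \<in> space Q \<Longrightarrow> 0 \<le> t \<Longrightarrow> V lam \<omega> y t = - lam * b y t \<omega>"
  using sep by (simp add: V_def B_def)

lemma h_le: "p \<in> P \<Longrightarrow> \<bar>h p y\<bar> \<le> (SUP y. \<bar>h p y\<bar>)"
  by (rule cSUP_upper[OF _ C01_periodic_bounded[OF L_pos h]]) auto

lemma B_continuous:
  assumes w: "\<omega> \<in> space Q"
  shows "continuous_on A (\<lambda>t. B p t \<omega>)"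
proof -
  have "continuous_on {0..} (\<lambda>t. b p t \<omega>)"
    unfolding continuous_on_def
  proof
    fix t :: real assume t: "t \<in> {0..}"
    have C: "(\<lambda>y. b y s \<omega>) \<in> C01_periodic L" if "0 \<le> s" for s using F.A1 w that by auto
    have lim: "((\<lambda>s. C01_norm (\<lambda>y. b y s \<omega> - b y t \<omega>)) \<longlongrightarrow> 0) (at t within {0..})"
      using F.A1 w t by auto
    have "\<forall>\<^sub>F s in at t within {0..}. norm (b p s \<omega> - b p t \<omega>) \<le> C01_norm (\<lambda>y. b y s \<omega> - b y t \<omega>)"
      unfolding eventually_at_filter
    proof (intro always_eventually allI impI)
      fix s assume "s \<noteq> t" "s \<in> {0..}"
      then show "norm (b p s \<omega> - b p t \<omega>) \<le> C01_norm (\<lambda>y. b y s \<omega> - b y t \<omega>)"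
        using abs_le_C01_norm[OF L_pos C01_periodic_lin[OF C[of s] C[of t], of "- 1"], of p] t by simp
    qed
    from Lim_null_comparison[OF this lim]
    show "((\<lambda>t. b p t \<omega>) \<longlongrightarrow> b p t \<omega>) (at t within {0..})" by (simp add: LIM_zero_iff)
  qed
  then show ?thesis
    unfolding B_def by (rule continuous_on_compose2) (auto intro!: continuous_intros)
qed

lemma gaussian_value: "0 \<le> t \<Longrightarrow> gaussian_rv Q (b y t)"
  using F.gaussian[unfolded gaussian_process_def, rule_format, of "{(y, t)}" "\<lambda>_. 1"] by simp

lemma B_integrable: "integrable Q (B p t)"
  using gaussian_rv_integrable[OF F.prob_space_axioms gaussian_value[of "max 0 t" p]] by (simp add: B_def[abs_def])

lemma B_measurable [measurable]: "B p t \<in> borel_measurable Q"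
  using B_integrable by simp

lemma B_joint: "(\<lambda>q. B p (fst q) (snd q)) \<in> borel_measurable (borel \<Otimes>\<^sub>M Q)"
  by (rule continuous_process_measurable) (auto intro: B_continuous)

lemma B_measurable' [measurable (raw)]:
  assumes "f \<in> borel_measurable N" "g \<in> measurable N Q"
  shows "(\<lambda>q. B p (f q) (g q)) \<in> borel_measurable N"
  using measurable_compose[OF measurable_Pair[OF assms] B_joint] by simp

lemma V_measurable [measurable (raw)]:
  assumes [measurable]: "f \<in> measurable N Q" "y \<in> borel_measurable N" "t \<in> borel_measurable N"
  shows "(\<lambda>q. V lam (f q) (y q) (t q)) \<in> borel_measurable N"
proof -
  have "(\<lambda>q. h p (y q)) \<in> borel_measurable N" if "p \<in> P" for p
    by (rule borel_measurable_continuous_on[OF C01_periodic_continuous[OF h[OF that]]]) simp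
  then show ?thesis
    unfolding V_def by (intro borel_measurable_times borel_measurable_const borel_measurable_sum B_measurable' assms)
qed

lemma S_measurable [measurable (raw)]:
  assumes [measurable]: "f \<in> measurable N Q" "t \<in> borel_measurable N"
  shows "(\<lambda>q. S lam (f q) (t q)) \<in> borel_measurable N"
  unfolding S_def by measurable

lemma controlled_V:
  assumes w: "\<omega> \<in> space Q"
  shows "controlled (V lam \<omega>) (S lam \<omega>)"
  unfolding controlled_def
proof (intro conjI allI)
  have hc: "continuous_on UNIV (\<lambda>q :: (real ^ 'd) \<times> real. h p (fst q))" if "p \<in> P" for p
    by (rule continuous_on_compose2[OF C01_periodic_continuous[OF h[OF that], of UNIV]]) (auto intro!: continuous_intros)
  have Bc: "continuous_on UNIV (\<lambda>q :: (real ^ 'd) \<times> real. B p (snd q) \<omega>)" for p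
    by (rule continuous_on_compose2[OF B_continuous[OF w, of UNIV]]) (auto intro!: continuous_intros)
  show "continuous_on UNIV (\<lambda>q. V lam \<omega> (fst q) (snd q))"
    unfolding V_def by (intro continuous_intros hc Bc)
  show "continuous_on UNIV (S lam \<omega>)"
    unfolding S_def by (intro continuous_intros B_continuous[OF w])
  fix y t
  have "\<bar>\<Sum>p\<in>P. h p y * B p t \<omega>\<bar> \<le> (\<Sum>p\<in>P. \<bar>h p y * B p t \<omega>\<bar>)" by (rule sum_abs)
  also have "\<dots> \<le> (\<Sum>p\<in>P. (SUP y. \<bar>h p y\<bar>) * \<bar>B p t \<omega>\<bar>)"
    unfolding abs_mult by (intro sum_mono mult_right_mono h_le) auto
  finally show "\<bar>V lam \<omega> y t\<bar> \<le> S lam \<omega> t"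
    unfolding V_def S_def abs_mult by (simp add: mult_left_mono)
qed

lemma V_periodic: "cell_periodic L (\<lambda>y. V lam \<omega> y t)"
  unfolding cell_periodic_def V_def
  using cell_periodicD[OF C01_periodic_per[OF h]] by simp

lemma tau_space: "0 \<le> s \<Longrightarrow> \<omega> \<in> space Q \<Longrightarrow> \<tau> s \<omega> \<in> space Q"
  using F.A2 measurable_space[of "\<tau> s" Q Q \<omega>] by simp

lemma B_shift: "0 \<le> s \<Longrightarrow> 0 \<le> t \<Longrightarrow> \<omega> \<in> space Q \<Longrightarrow> B p (s + t) \<omega> = B p t (\<tau> s \<omega>)"
  using F.A2 by (simp add: B_def add.commute)

lemma tau_iter_space: "0 \<le> T \<Longrightarrow> \<omega> \<in> space Q \<Longrightarrow> (\<tau> T ^^ k) \<omega> \<in> space Q"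
  by (induction k) (auto intro: tau_space)

text \<open>The map \<open>\<tau> (real k * T)\<close> need not be the iterate \<open>\<tau> T ^^ k\<close>, but both shift the field by \<open>real k * T\<close>.\<close>

lemma B_iter: "0 \<le> T \<Longrightarrow> 0 \<le> t \<Longrightarrow> \<omega> \<in> space Q \<Longrightarrow> B p (real k * T + t) \<omega> = B p t ((\<tau> T ^^ k) \<omega>)"
proof (induction k arbitrary: \<omega>)
  case (Suc k)
  have "B p (real (Suc k) * T + t) \<omega> = B p (T + (real k * T + t)) \<omega>" by (simp add: algebra_simps)
  also have "\<dots> = B p (real k * T + t) (\<tau> T \<omega>)" using Suc.prems by (intro B_shift) auto
  also have "\<dots> = B p t ((\<tau> T ^^ k) (\<tau> T \<omega>))" using Suc.prems by (intro Suc.IH tau_space) auto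
  finally show ?case by (simp add: funpow_swap1)
qed simp

lemma V_iter: "0 \<le> T \<Longrightarrow> 0 \<le> t \<Longrightarrow> \<omega> \<in> space Q \<Longrightarrow> V lam \<omega> y (real k * T + t) = V lam ((\<tau> T ^^ k) \<omega>) y t"
  and S_iter: "0 \<le> T \<Longrightarrow> 0 \<le> t \<Longrightarrow> \<omega> \<in> space Q \<Longrightarrow> S lam \<omega> (real k * T + t) = S lam ((\<tau> T ^^ k) \<omega>) t"
  by (simp_all add: V_def S_def B_iter)

lemma B_stationary:
  assumes g [measurable]: "g \<in> borel_measurable borel"
  shows "(\<integral>\<omega>. (g (B p t \<omega>) :: real) \<partial>Q) = (\<integral>\<omega>. g (B p 0 \<omega>) \<partial>Q)"
proof -
  have t: "0 \<le> max 0 t" by simp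
  have [measurable]: "\<tau> (max 0 t) \<in> measurable Q Q" and d: "distr Q Q (\<tau> (max 0 t)) = Q"
    using F.A2 t by blast+
  have "(\<integral>\<omega>. g (B p t \<omega>) \<partial>Q) = (\<integral>\<omega>. g (B p 0 (\<tau> (max 0 t) \<omega>)) \<partial>Q)"
    by (intro Bochner_Integration.integral_cong) (auto simp: B_shift[OF t, of 0, symmetric], simp add: B_def)
  also have "\<dots> = (\<integral>\<omega>. g (B p 0 \<omega>) \<partial>distr Q Q (\<tau> (max 0 t)))"
    by (subst integral_distr) auto
  finally show ?thesis by (simp add: d)
qed

lemma B_abs_mean: "(\<integral>\<omega>. \<bar>B p t \<omega>\<bar> \<partial>Q) = (\<integral>\<omega>. \<bar>B p 0 \<omega>\<bar> \<partial>Q)"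
  by (rule B_stationary) simp

lemma B_mean_zero: "(\<integral>\<omega>. B p t \<omega> \<partial>Q) = 0"
proof -
  have "(\<integral>\<omega>. B p t \<omega> \<partial>Q) = (\<integral>\<omega>. B (cell_rep L p) t \<omega> \<partial>Q)"
  proof (rule Bochner_Integration.integral_cong[OF refl])
    fix \<omega> assume "\<omega> \<in> space Q"
    then have "cell_periodic L (\<lambda>y. b y (max 0 t) \<omega>)"
      using F.A1 by (auto intro!: C01_periodic_per)
    from cell_periodic_rep'[OF this] show "B p t \<omega> = B (cell_rep L p) t \<omega>" by (simp add: B_def)
  qed
  also have "\<dots> = 0"
    unfolding B_def
    by (rule F.A4(2)[rule_format, OF half_open_cell_subset[THEN subsetD, OF cell_rep_mem[OF L_pos]]]) simp
  finally show ?thesis .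
qed

lemma B_combination_mean_zero:
  shows "integrable Q (\<lambda>\<omega>. LINT s:{a..c}|lborel. (\<Sum>p\<in>P. k p * B p s \<omega>))"
    and "(\<integral>\<omega>. (LINT s:{a..c}|lborel. (\<Sum>p\<in>P. k p * B p s \<omega>)) \<partial>Q) = 0"
proof -
  have m: "(\<lambda>q. \<Sum>p\<in>P. k p * B p (fst q) (snd q)) \<in> borel_measurable (borel \<Otimes>\<^sub>M Q)" by measurable
  have i: "integrable Q (\<lambda>\<omega>. \<Sum>p\<in>P. k p * B p s \<omega>)" for s
    using B_integrable by auto
  have bd: "(\<integral>\<omega>. \<bar>\<Sum>p\<in>P. k p * B p s \<omega>\<bar> \<partial>Q) \<le> (\<Sum>p\<in>P. \<bar>k p\<bar> * (\<integral>\<omega>. \<bar>B p 0 \<omega>\<bar> \<partial>Q))" for s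
  proof -
    have "(\<integral>\<omega>. \<bar>\<Sum>p\<in>P. k p * B p s \<omega>\<bar> \<partial>Q) \<le> (\<integral>\<omega>. (\<Sum>p\<in>P. \<bar>k p\<bar> * \<bar>B p s \<omega>\<bar>) \<partial>Q)"
    proof (rule integral_mono)
      show "\<bar>\<Sum>p\<in>P. k p * B p s \<omega>\<bar> \<le> (\<Sum>p\<in>P. \<bar>k p\<bar> * \<bar>B p s \<omega>\<bar>)" for \<omega>
        using sum_abs[of "\<lambda>p. k p * B p s \<omega>" P] by (simp add: abs_mult)
    qed (use i B_integrable in auto)
    also have "\<dots> = (\<Sum>p\<in>P. \<bar>k p\<bar> * (\<integral>\<omega>. \<bar>B p s \<omega>\<bar> \<partial>Q))"
      using B_integrable by (subst Bochner_Integration.integral_sum) auto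
    finally show ?thesis unfolding B_abs_mean[of _ s] .
  qed
  show "integrable Q (\<lambda>\<omega>. LINT s:{a..c}|lborel. (\<Sum>p\<in>P. k p * B p s \<omega>))"
    by (rule F.Fubini_LINT(1)[OF m i bd])
  have "(\<integral>\<omega>. (\<Sum>p\<in>P. k p * B p s \<omega>) \<partial>Q) = 0" for s
    using B_integrable by (subst Bochner_Integration.integral_sum) (auto simp: B_mean_zero)
  then show "(\<integral>\<omega>. (LINT s:{a..c}|lborel. (\<Sum>p\<in>P. k p * B p s \<omega>)) \<partial>Q) = 0"
    by (subst F.Fubini_LINT(2)[OF m i bd]) (auto simp: set_lebesgue_integral_def)
qed

definition S_mean :: "real \<Rightarrow> real" where
  "S_mean lam = (\<integral>\<omega>. S lam \<omega> 0 \<partial>Q)"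

lemma budget_integrable: "integrable Q (\<lambda>\<omega>. budget (S lam \<omega>) a c)"
  and budget_expectation: "a \<le> c \<Longrightarrow> (\<integral>\<omega>. budget (S lam \<omega>) a c \<partial>Q) = (c - a) * S_mean lam"
proof -
  have m: "(\<lambda>q. S lam (snd q) (fst q)) \<in> borel_measurable (borel \<Otimes>\<^sub>M Q)" by measurable
  have i: "integrable Q (\<lambda>\<omega>. S lam \<omega> s)" for s
    unfolding S_def using B_integrable by auto
  have mean: "(\<integral>\<omega>. S lam \<omega> s \<partial>Q) = S_mean lam" for s
    unfolding S_mean_def S_def using B_integrable
    by (simp add: Bochner_Integration.integral_sum B_abs_mean[of _ s])
  have nn: "0 \<le> S lam \<omega> s" for \<omega> s
    unfolding S_def by (intro mult_nonneg_nonneg sum_nonneg order_trans[OF abs_ge_zero h_le]) auto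
  have bd: "(\<integral>\<omega>. \<bar>S lam \<omega> s\<bar> \<partial>Q) \<le> S_mean lam" for s using mean nn by simp
  show "integrable Q (\<lambda>\<omega>. budget (S lam \<omega>) a c)"
    unfolding budget_def by (rule F.Fubini_LINT(1)[OF m i bd])
  show "(\<integral>\<omega>. budget (S lam \<omega>) a c \<partial>Q) = (c - a) * S_mean lam" if "a \<le> c"
    unfolding budget_def using that
    by (subst F.Fubini_LINT(2)[OF m i bd]) (auto simp: set_lebesgue_integral_def mean)
qed

lemma budget_iter:
  assumes "0 \<le> T" "0 \<le> a" "\<omega> \<in> space Q"
  shows "budget (S lam \<omega>) (real k * T + a) (real k * T + c) = budget (S lam ((\<tau> T ^^ k) \<omega>)) a c"
  unfolding budget_shift[symmetric] using assms S_iter by (intro budget_cong) auto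

lemma action_V_measurable:
  assumes f [measurable]: "f \<in> measurable N Q" and g [measurable]: "g \<in> measurable N M" and [measurable]: "y \<in> borel_measurable N"
  shows "(\<lambda>q. LINT s:{0..t}|lborel. V lam (f q) (y q + W s (g q)) (c - s)) \<in> borel_measurable N"
proof -
  have "(\<lambda>q. LINT s:{0..t}|lborel. V lam (f q) (y q + path_at (path (g q)) s) (c - s)) \<in> borel_measurable N"
    unfolding set_lebesgue_integral_def by measurable
  then show ?thesis
  proof (rule measurable_cong[THEN iffD1, rotated])
    fix q assume "q \<in> space N"
    then have "g q \<in> space M" using g by (rule measurable_space[rotated])
    then show "(LINT s:{0..t}|lborel. V lam (f q) (y q + path_at (path (g q)) s) (c - s))
        = (LINT s:{0..t}|lborel. V lam (f q) (y q + W s (g q)) (c - s))"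
      by (intro set_lebesgue_integral_cong) (auto simp: path_at_path)
  qed
qed

lemma fk1_V_measurable:
  assumes [measurable]: "f \<in> measurable N Q" "y \<in> borel_measurable N"
  shows "(\<lambda>q. fk1 (V lam (f q)) t (y q)) \<in> borel_measurable N"
proof -
  note [measurable (raw)] = action_V_measurable
  show ?thesis unfolding fk_def by measurable
qed

lemma swap_gap_V_measurable:
  assumes [measurable]: "f \<in> measurable N Q" "y \<in> borel_measurable N" and "0 \<le> r" "0 \<le> k"
  shows "(\<lambda>q. swap_gap (V lam (f q)) r k (y q)) \<in> borel_measurable N"
proof -
  note [measurable (raw)] = action_V_measurable ln_cosh_measurable W_compose_measurable[OF \<open>0 \<le> r\<close>]
    W_compose_measurable[OF \<open>0 \<le> k\<close>]
  show ?thesis unfolding swap_gap_def swap_diff_def split_action_def by measurable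
qed

lemma fk1_V_eq_feynman_kac:
  assumes w: "\<omega> \<in> space Q" and t: "0 \<le> t"
  shows "feynman_kac M W b lam y t \<omega> = fk1 (V lam \<omega>) t y"
proof -
  have "(LINT s:{0..t}|lborel. V lam \<omega> (y + W s u) (t - s)) = - lam * (LINT s:{0..t}|lborel. b (y + W s u) (t - s) \<omega>)" for u
    unfolding set_integral_mult_right[symmetric]
    using w by (intro set_lebesgue_integral_cong) (auto simp: V_eq)
  then show ?thesis by (simp add: feynman_kac_def fk_def)
qed

end

section \<open>Existence of the exponent\<close>

lemma average_increment_vanishes:
  fixes x :: "nat \<Rightarrow> real"
  assumes "(\<lambda>n. (\<Sum>k<n. x k) / n) \<longlonglongrightarrow> l"
  shows "(\<lambda>n. x n / n) \<longlonglongrightarrow> 0"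
proof -
  have "(\<lambda>n. (\<Sum>k<Suc n. x k) / Suc n) \<longlonglongrightarrow> l" using assms by (rule LIMSEQ_Suc)
  moreover have "(\<lambda>n. real (Suc n) / n) \<longlonglongrightarrow> 1" by (rule LIMSEQ_Suc_n_over_n)
  ultimately have "(\<lambda>n. (\<Sum>k<Suc n. x k) / Suc n * (real (Suc n) / n) - (\<Sum>k<n. x k) / n) \<longlonglongrightarrow> l * 1 - l"
    using assms by (intro tendsto_diff tendsto_mult)
  moreover have "(\<Sum>k<Suc n. x k) / Suc n * (real (Suc n) / n) - (\<Sum>k<n. x k) / n = x n / n" for n
  proof -
    have "(\<Sum>k<Suc n. x k) / Suc n * (real (Suc n) / n) = (\<Sum>k<Suc n. x k) / n"
      by (simp del: of_nat_Suc sum.lessThan_Suc)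
    then show ?thesis by (simp add: diff_divide_distrib[symmetric] del: of_nat_Suc)
  qed
  ultimately show ?thesis by simp
qed

lemma floor_ratio:
  assumes T: "0 < T"
  shows "((\<lambda>t. real (nat \<lfloor>t / T\<rfloor>) / t) \<longlongrightarrow> 1 / T) at_top"
    and "filterlim (\<lambda>t. nat \<lfloor>t / T\<rfloor>) sequentially at_top"
proof -
  have b: "t / T - 1 \<le> real (nat \<lfloor>t / T\<rfloor>)" "0 < t \<Longrightarrow> real (nat \<lfloor>t / T\<rfloor>) \<le> t / T" for t
  proof -
    show "t / T - 1 \<le> real (nat \<lfloor>t / T\<rfloor>)" by linarith
    show "0 < t \<Longrightarrow> real (nat \<lfloor>t / T\<rfloor>) \<le> t / T"
      using T by (subst of_nat_nat) (auto simp: divide_nonneg_nonneg)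
  qed
  show "((\<lambda>t. real (nat \<lfloor>t / T\<rfloor>) / t) \<longlongrightarrow> 1 / T) at_top"
  proof (rule tendsto_sandwich)
    show "\<forall>\<^sub>F t in at_top. 1 / T - 1 / t \<le> real (nat \<lfloor>t / T\<rfloor>) / t"
      using eventually_gt_at_top[of 0]
    proof eventually_elim
      case (elim t)
      have "(t / T - 1) / t \<le> real (nat \<lfloor>t / T\<rfloor>) / t" using b elim by (intro divide_right_mono) auto
      then show ?case using elim by (simp add: diff_divide_distrib)
    qed
    show "\<forall>\<^sub>F t in at_top. real (nat \<lfloor>t / T\<rfloor>) / t \<le> 1 / T"
      using eventually_gt_at_top[of 0]
    proof eventually_elim
      case (elim t)
      have "real (nat \<lfloor>t / T\<rfloor>) / t \<le> (t / T) / t" using b elim by (intro divide_right_mono) auto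
      then show ?case using elim by simp
    qed
    show "((\<lambda>t. 1 / T - 1 / t) \<longlongrightarrow> 1 / T) at_top"
      using tendsto_diff[OF tendsto_const tendsto_divide_0[OF tendsto_const filterlim_at_top_imp_at_infinity[OF filterlim_ident]], of "1 / T" 1] by simp
  qed simp
  show "filterlim (\<lambda>t. nat \<lfloor>t / T\<rfloor>) sequentially at_top"
    unfolding filterlim_at_top
  proof
    fix N :: nat
    show "\<forall>\<^sub>F t in at_top. N \<le> nat \<lfloor>t / T\<rfloor>"
      using eventually_ge_at_top[of "real N * T"]
    proof eventually_elim
      case (elim t)
      then have "real N \<le> t / T" using T by (simp add: field_simps)
      then show ?case by (simp add: le_nat_floor)
    qed
  qed
qed

context separated_field
begin

lemma birkhoff:
  assumes "0 < T" and f: "integrable Q f"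
  shows "AE \<omega> in Q. (\<lambda>n. (\<Sum>k<n. f ((\<tau> T ^^ k) \<omega>)) / n) \<longlonglongrightarrow> (\<integral>\<omega>. f \<omega> \<partial>Q)"
proof (rule F.ergodic_average_tendsto[OF _ _ _ f])
  show "\<tau> T \<in> measurable Q Q" "distr Q Q (\<tau> T) = Q" using F.A2 assms(1) by (auto simp: less_imp_le)
  show "measure Q A = 0 \<or> measure Q A = 1" if "A \<in> sets Q" "\<tau> T -` A \<inter> space Q = A" for A
    using F.A3 assms(1) that by blast
qed

lemma log_fk1_integrable:
  assumes "0 \<le> t" shows "integrable Q (\<lambda>\<omega>. ln (fk1 (V lam \<omega>) t y))"
proof (rule Bochner_Integration.integrable_bound[OF budget_integrable[of lam 0 t]])
  show "(\<lambda>\<omega>. ln (fk1 (V lam \<omega>) t y)) \<in> borel_measurable Q"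
    by (intro borel_measurable_ln fk1_V_measurable) auto
  show "AE \<omega> in Q. norm (ln (fk1 (V lam \<omega>) t y)) \<le> norm (budget (S lam \<omega>) 0 t)"
    using fk1_bounds(5)[OF controlled_V assms] by (intro AE_I2) (auto intro: order_trans[OF _ abs_ge_self])
qed

definition step_error :: "real \<Rightarrow> real \<Rightarrow> 'o \<Rightarrow> real" where
  "step_error lam T \<omega> = ln (harnack_const L TYPE('d)) + 3 * budget (S lam \<omega>) (T - 2) T"

lemma step_error_expectation:
  "integrable Q (step_error lam T)"
  "(\<integral>\<omega>. step_error lam T \<omega> \<partial>Q) = ln (harnack_const L TYPE('d)) + 6 * S_mean lam"
  unfolding step_error_def using budget_integrable
  by (auto simp: F.prob_space budget_expectation)

text \<open>The logarithm of the solution is a sum along the orbit of \<open>\<tau> T\<close>, up to an error per step whose mean does not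
depend on the length \<open>T\<close> of the steps.\<close>

lemma log_fk1_near_sum_0:
  assumes T: "2 \<le> T" and w: "\<omega> \<in> space Q"
  shows "\<bar>ln (fk1 (V lam \<omega>) (real (Suc n) * T) 0) - (\<Sum>k<Suc n. ln (fk1 (V lam ((\<tau> T ^^ k) \<omega>)) T 0))\<bar>
    \<le> (\<Sum>k<n. step_error lam T ((\<tau> T ^^ k) \<omega>))"
proof (induction n)
  case (Suc n)
  let ?t = "real (Suc n) * T"
  have t: "2 \<le> ?t"
    using mult_mono[of 1 "real (Suc n)" 2 T] T by simp
  have "\<bar>ln (fk1 (V lam \<omega>) (T + ?t) 0) - ln (fk1 (V lam \<omega>) ?t 0) - ln (fk1 (\<lambda>y s. V lam \<omega> y (?t + s)) T 0)\<bar>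
      \<le> ln (harnack_const L TYPE('d)) + 3 * budget (S lam \<omega>) (?t - 2) ?t"
    using T by (intro fk1_almost_additive[OF L_pos controlled_V[OF w] V_periodic t]) simp
  also have "?t - 2 = real n * T + (T - 2)" "?t = real n * T + T" by (simp_all add: algebra_simps)
  then have "budget (S lam \<omega>) (?t - 2) ?t = budget (S lam ((\<tau> T ^^ n) \<omega>)) (T - 2) T"
    using budget_iter[of T "T - 2" \<omega> lam n T] T w by (simp add: add_diff_eq)
  finally have "\<bar>ln (fk1 (V lam \<omega>) (T + ?t) 0) - ln (fk1 (V lam \<omega>) ?t 0) - ln (fk1 (\<lambda>y s. V lam \<omega> y (?t + s)) T 0)\<bar>
      \<le> step_error lam T ((\<tau> T ^^ n) \<omega>)" by (simp add: step_error_def)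
  moreover have "fk1 (\<lambda>y s. V lam \<omega> y (?t + s)) T 0 = fk1 (V lam ((\<tau> T ^^ Suc n) \<omega>)) T 0"
    using T w by (intro fk_cong_potential V_iter) auto
  moreover have "T + ?t = real (Suc (Suc n)) * T" by (simp add: algebra_simps)
  ultimately have st: "\<bar>ln (fk1 (V lam \<omega>) (real (Suc (Suc n)) * T) 0) - ln (fk1 (V lam \<omega>) ?t 0)
      - ln (fk1 (V lam ((\<tau> T ^^ Suc n) \<omega>)) T 0)\<bar> \<le> step_error lam T ((\<tau> T ^^ n) \<omega>)" by metis
  have arith: "\<bar>a - (s + v)\<bar> \<le> e + e'" if "\<bar>a - a' - v\<bar> \<le> e'" "\<bar>a' - s\<bar> \<le> e" for a a' v s e e' :: real
    using that by linarith
  show ?case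
    unfolding sum.lessThan_Suc[of _ "Suc n"] sum.lessThan_Suc[of "\<lambda>k. step_error lam T ((\<tau> T ^^ k) \<omega>)" n]
    by (rule arith[OF st Suc.IH])
qed simp

lemma log_fk1_near_sum:
  assumes T: "2 \<le> T" and w: "\<omega> \<in> space Q" and n: "0 < n" and r: "0 \<le> r" "r \<le> T"
  shows "\<bar>ln (fk1 (V lam \<omega>) (r + real n * T) y) - (\<Sum>k<n. ln (fk1 (V lam ((\<tau> T ^^ k) \<omega>)) T 0))\<bar>
    \<le> (\<Sum>k<n. step_error lam T ((\<tau> T ^^ k) \<omega>)) + budget (S lam ((\<tau> T ^^ n) \<omega>)) 0 T"
proof -
  obtain m where m: "n = Suc m" using n not0_implies_Suc by blast
  let ?t = "real n * T"
  have t: "2 \<le> ?t"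
    using mult_mono[of 1 "real n" 2 T] T n by simp
  have "\<bar>ln (fk1 (V lam \<omega>) (r + ?t) y) - ln (fk1 (V lam \<omega>) ?t 0) - ln (fk1 (\<lambda>y s. V lam \<omega> y (?t + s)) r y)\<bar>
      \<le> ln (harnack_const L TYPE('d)) + 3 * budget (S lam \<omega>) (?t - 2) ?t"
    using r by (intro fk1_almost_additive[OF L_pos controlled_V[OF w] V_periodic t]) simp
  also have "?t - 2 = real m * T + (T - 2)" "?t = real m * T + T" by (simp_all add: algebra_simps m)
  then have "budget (S lam \<omega>) (?t - 2) ?t = budget (S lam ((\<tau> T ^^ m) \<omega>)) (T - 2) T"
    using budget_iter[of T "T - 2" \<omega> lam m T] T w by (simp add: add_diff_eq)
  finally have 1: "\<bar>ln (fk1 (V lam \<omega>) (r + ?t) y) - ln (fk1 (V lam \<omega>) ?t 0) - ln (fk1 (\<lambda>y s. V lam \<omega> y (?t + s)) r y)\<bar>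
      \<le> step_error lam T ((\<tau> T ^^ m) \<omega>)" by (simp add: step_error_def)
  have wn: "(\<tau> T ^^ n) \<omega> \<in> space Q" using T w by (intro tau_iter_space) auto
  have "fk1 (\<lambda>y s. V lam \<omega> y (?t + s)) r y = fk1 (V lam ((\<tau> T ^^ n) \<omega>)) r y"
    using T w by (intro fk_cong_potential V_iter) auto
  then have 2: "\<bar>ln (fk1 (\<lambda>y s. V lam \<omega> y (?t + s)) r y)\<bar> \<le> budget (S lam ((\<tau> T ^^ n) \<omega>)) 0 T"
    using fk1_bounds(5)[OF controlled_V[OF wn] r(1), of lam y] budget_mono[OF controlled_V[OF wn] r, of lam] by simp
  have 3: "\<bar>ln (fk1 (V lam \<omega>) ?t 0) - (\<Sum>k<n. ln (fk1 (V lam ((\<tau> T ^^ k) \<omega>)) T 0))\<bar>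
    \<le> (\<Sum>k<m. step_error lam T ((\<tau> T ^^ k) \<omega>))"
    using log_fk1_near_sum_0[OF T w, of lam m] unfolding m .
  have 4: "(\<Sum>k<n. step_error lam T ((\<tau> T ^^ k) \<omega>)) = (\<Sum>k<m. step_error lam T ((\<tau> T ^^ k) \<omega>)) + step_error lam T ((\<tau> T ^^ m) \<omega>)"
    by (simp add: m)
  show ?thesis using 1 2 3 4 by linarith
qed

definition growth :: "real \<Rightarrow> real \<Rightarrow> real" where
  "growth lam T = (\<integral>\<omega>. ln (fk1 (V lam \<omega>) T 0) \<partial>Q) / T"

definition drift_bound :: "real \<Rightarrow> real" where
  "drift_bound lam = ln (harnack_const L TYPE('d)) + 6 * S_mean lam"

text \<open>Birkhoff's theorem for \<open>\<tau> T\<close>, applied to the orbit sum and to the sum of the errors. The mean error per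
step is the same for all \<open>T\<close>, so per unit of time it is of order \<open>1 / T\<close>.\<close>

lemma growth_window:
  assumes T: "2 \<le> T"
  shows "AE \<omega> in Q. \<forall>e>0. \<forall>\<^sub>F t in at_top. \<forall>y. \<bar>ln (fk1 (V lam \<omega>) t y) / t - growth lam T\<bar> < drift_bound lam / T + e"
proof -
  have T0: "0 < T" "0 \<le> T" using T by auto
  show ?thesis
    using birkhoff[OF T0(1) log_fk1_integrable[OF T0(2), of lam 0]] birkhoff[OF T0(1) step_error_expectation(1)[of lam T]]
      birkhoff[OF T0(1) budget_integrable[of lam 0 T]] AE_space
  proof eventually_elim
    case (elim \<omega>)
    define X where "X n = (\<Sum>k<n. ln (fk1 (V lam ((\<tau> T ^^ k) \<omega>)) T 0))" for n
    define Y where "Y n = (\<Sum>k<n. step_error lam T ((\<tau> T ^^ k) \<omega>))" for n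
    define Z where "Z n = budget (S lam ((\<tau> T ^^ n) \<omega>)) 0 T" for n
    have w: "\<omega> \<in> space Q" by fact
    have X: "(\<lambda>n. X n / n) \<longlonglongrightarrow> T * growth lam T" using elim(1) T0 by (simp add: X_def growth_def)
    have Y: "(\<lambda>n. Y n / n) \<longlonglongrightarrow> drift_bound lam"
      using elim(2) by (simp add: Y_def step_error_expectation drift_bound_def)
    have Z: "(\<lambda>n. Z n / n) \<longlonglongrightarrow> 0" unfolding Z_def by (rule average_increment_vanishes[OF elim(3)])
    define n where "n t = nat \<lfloor>t / T\<rfloor>" for t
    have nlim: "filterlim n sequentially at_top" and nt: "((\<lambda>t. real (n t) / t) \<longlongrightarrow> 1 / T) at_top"
      unfolding n_def by (rule floor_ratio[OF T0(1)])+
    define R where "R t = \<bar>real (n t) / t * (X (n t) / n t) - growth lam T\<bar> + real (n t) / t * (Y (n t) / n t + Z (n t) / n t)" for t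
    have "(R \<longlongrightarrow> \<bar>1 / T * (T * growth lam T) - growth lam T\<bar> + 1 / T * (drift_bound lam + 0)) at_top"
      unfolding R_def
      by (intro tendsto_intros nt filterlim_compose[OF X nlim] filterlim_compose[OF Y nlim] filterlim_compose[OF Z nlim])
    then have R: "(R \<longlongrightarrow> drift_bound lam / T) at_top" using T0 by simp
    have bound: "\<bar>ln (fk1 (V lam \<omega>) t y) / t - growth lam T\<bar> \<le> R t" if t: "T \<le> t" for t y
    proof -
      have tT: "1 \<le> t / T" using t T0 by simp
      then have n1: "0 < n t" unfolding n_def by (simp add: le_nat_floor less_le_trans[of 0 1] Suc_le_eq[symmetric])
      have r: "real (n t) \<le> t / T" "t / T < real (n t) + 1"
        unfolding n_def using tT by (auto simp: of_nat_nat) 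
      define r where "r = t - real (n t) * T"
      have r01: "0 \<le> r" "r \<le> T" using r T0 by (auto simp: r_def field_simps)
      have t0: "0 < t" using t T0 by linarith
      have "\<bar>ln (fk1 (V lam \<omega>) (r + real (n t) * T) y) - X (n t)\<bar> \<le> Y (n t) + Z (n t)"
        unfolding X_def Y_def Z_def by (rule log_fk1_near_sum[OF T w n1 r01])
      then have 1: "\<bar>ln (fk1 (V lam \<omega>) t y) / t - X (n t) / t\<bar> \<le> (Y (n t) + Z (n t)) / t"
        using t0 by (simp add: r_def abs_divide divide_right_mono flip: diff_divide_distrib)
      have 2: "real (n t) / t * (X (n t) / n t) = X (n t) / t"
        "real (n t) / t * (Y (n t) / n t + Z (n t) / n t) = (Y (n t) + Z (n t)) / t"
        using n1 by (simp_all add: add_divide_distrib[symmetric])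
      show ?thesis unfolding R_def 2 using 1 by linarith
    qed
    show ?case
    proof (intro allI impI)
      fix e :: real assume "0 < e"
      then have "\<forall>\<^sub>F t in at_top. R t < drift_bound lam / T + e" using R by (intro order_tendstoD) auto
      then show "\<forall>\<^sub>F t in at_top. \<forall>y. \<bar>ln (fk1 (V lam \<omega>) t y) / t - growth lam T\<bar> < drift_bound lam / T + e"
        using eventually_ge_at_top[of T]
      proof eventually_elim
        case (elim t)
        show ?case using le_less_trans[OF bound[OF elim(2)] elim(1)] by blast
      qed
    qed
  qed
qed

text \<open>For almost every \<open>\<omega>\<close> all windows, \<open>T = 2, 3, \<dots>\<close>, hold at once. Hence any two of them intersect and their
centres, which do not depend on \<open>\<omega>\<close>, form a Cauchy sequence.\<close>

lemma exponent_limit: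
  "\<exists>r. AE \<omega> in Q. \<forall>y. ((\<lambda>t. ln (fk1 (V lam \<omega>) t y) / t) \<longlongrightarrow> r) at_top"
proof -
  define \<alpha> where "\<alpha> k = growth lam (real k + 2)" for k :: nat
  define c where "c k = drift_bound lam / (real k + 2)" for k :: nat
  define good where "good \<omega> \<longleftrightarrow> (\<forall>k e. 0 < e \<longrightarrow> (\<forall>\<^sub>F t in at_top. \<forall>y. \<bar>ln (fk1 (V lam \<omega>) t y) / t - \<alpha> k\<bar> < c k + e))" for \<omega>
  have good: "AE \<omega> in Q. good \<omega>"
    unfolding good_def AE_all_countable \<alpha>_def c_def using growth_window by auto
  have "c \<longlonglongrightarrow> 0"
  proof -
    have "filterlim (\<lambda>k. real k + 2) at_top sequentially"
      by (rule filterlim_at_top_mono[OF filterlim_real_sequentially]) auto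
    then show ?thesis unfolding c_def
      by (intro tendsto_divide_0[OF tendsto_const] filterlim_at_top_imp_at_infinity)
  qed
  obtain \<omega>0 where w0: "good \<omega>0"
  proof -
    have "\<exists>\<omega>. good \<omega>"
    proof (rule ccontr)
      assume "\<not> ?thesis"
      then have "AE \<omega> in Q. False" by (intro eventually_mono[OF good]) blast
      then show False by simp
    qed
    then show ?thesis using that by blast
  qed
  have close: "\<bar>\<alpha> j - \<alpha> k\<bar> \<le> c j + c k" for j k
  proof (rule field_le_epsilon)
    fix e :: real assume "0 < e"
    then have "\<forall>\<^sub>F t in at_top. \<forall>y. \<bar>ln (fk1 (V lam \<omega>0) t y) / t - \<alpha> i\<bar> < c i + e / 2" for i
      using w0 unfolding good_def by simp
    from eventually_conj[OF this[of j] this[of k]] obtain t where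
      "\<bar>ln (fk1 (V lam \<omega>0) t 0) / t - \<alpha> j\<bar> < c j + e / 2" "\<bar>ln (fk1 (V lam \<omega>0) t 0) / t - \<alpha> k\<bar> < c k + e / 2"
      using eventually_happens[of _ "at_top :: real filter"] by (metis (no_types, lifting) trivial_limit_at_top_linorder)
    then show "\<bar>\<alpha> j - \<alpha> k\<bar> \<le> c j + c k + e" by linarith
  qed
  have "Cauchy \<alpha>"
  proof (rule metric_CauchyI)
    fix e :: real assume "0 < e"
    then have "\<forall>\<^sub>F k in sequentially. c k < e / 2" using \<open>c \<longlonglongrightarrow> 0\<close> by (intro order_tendstoD) auto
    then obtain N where N: "\<And>k. k \<ge> N \<Longrightarrow> c k < e / 2" by (auto simp: eventually_sequentially)
    have "dist (\<alpha> m) (\<alpha> n) < e" if "m \<ge> N" "n \<ge> N" for m n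
      using close[of m n] N[OF that(1)] N[OF that(2)] by (simp add: dist_real_def)
    then show "\<exists>N. \<forall>m\<ge>N. \<forall>n\<ge>N. dist (\<alpha> m) (\<alpha> n) < e" by blast
  qed
  then obtain r where r: "\<alpha> \<longlonglongrightarrow> r" using Cauchy_convergent convergent_def by blast
  have "AE \<omega> in Q. \<forall>y. ((\<lambda>t. ln (fk1 (V lam \<omega>) t y) / t) \<longlongrightarrow> r) at_top"
    using good
  proof eventually_elim
    case (elim \<omega>)
    show ?case
    proof (intro allI tendstoI)
      fix y and e :: real assume e: "0 < e"
      have "\<forall>\<^sub>F k in sequentially. c k < e / 3 \<and> dist (\<alpha> k) r < e / 3"
        using \<open>c \<longlonglongrightarrow> 0\<close> r e by (intro eventually_conj tendstoD order_tendstoD(2)) auto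
      then obtain k where k: "c k < e / 3" "dist (\<alpha> k) r < e / 3"
        unfolding eventually_sequentially by blast
      have "\<forall>\<^sub>F t in at_top. \<forall>y. \<bar>ln (fk1 (V lam \<omega>) t y) / t - \<alpha> k\<bar> < c k + e / 3"
        using elim e unfolding good_def by simp
      then show "\<forall>\<^sub>F t in at_top. dist (ln (fk1 (V lam \<omega>) t y) / t) r < e"
      proof eventually_elim
        case (elim t)
        then have "\<bar>ln (fk1 (V lam \<omega>) t y) / t - \<alpha> k\<bar> < c k + e / 3" by blast
        then show ?case using k unfolding dist_real_def by linarith
      qed
    qed
  qed
  then show ?thesis by blast
qed

theorem rho_limit:
  "AE \<omega> in Q. \<forall>y. ((\<lambda>t. ln (fk1 (V lam \<omega>) t y) / t) \<longlongrightarrow> \<rho> lam) at_top"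
proof -
  have eq: "((\<lambda>t. 1 / t * ln (feynman_kac M W b lam y t \<omega>)) \<longlongrightarrow> r) at_top
      \<longleftrightarrow> ((\<lambda>t. ln (fk1 (V lam \<omega>) t y) / t) \<longlongrightarrow> r) at_top" if "\<omega> \<in> space Q" for \<omega> y r
  proof (rule tendsto_cong)
    show "\<forall>\<^sub>F t in at_top. 1 / t * ln (feynman_kac M W b lam y t \<omega>) = ln (fk1 (V lam \<omega>) t y) / t"
      using eventually_ge_at_top[of 0] by eventually_elim (simp add: fk1_V_eq_feynman_kac[OF that])
  qed
  have AE_eq: "(AE \<omega> in Q. \<forall>y. ((\<lambda>t. 1 / t * ln (feynman_kac M W b lam y t \<omega>)) \<longlongrightarrow> r) at_top)
      \<longleftrightarrow> (AE \<omega> in Q. \<forall>y. ((\<lambda>t. ln (fk1 (V lam \<omega>) t y) / t) \<longlongrightarrow> r) at_top)" for r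
    using eq by (intro AE_cong) simp
  obtain r where r: "AE \<omega> in Q. \<forall>y. ((\<lambda>t. ln (fk1 (V lam \<omega>) t y) / t) \<longlongrightarrow> r) at_top"
    using exponent_limit by blast
  have "\<rho> lam = r"
    unfolding rho_def AE_eq
  proof (rule the_equality, rule r)
    fix r' assume "AE \<omega> in Q. \<forall>y. ((\<lambda>t. ln (fk1 (V lam \<omega>) t y) / t) \<longlongrightarrow> r') at_top"
    with r have "AE \<omega> in Q. r' = r"
      by eventually_elim (blast intro: tendsto_unique[OF trivial_limit_at_top_linorder])
    then show "r' = r" by simp
  qed
  with r show ?thesis by simp
qed

end

section \<open>Properties of the exponent\<close>

text \<open>Jensen's inequality for the power \<open>p\<close>, through the tangent \<open>1 + p * (exp z - 1) \<le> exp (p * z)\<close>.\<close>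

lemma (in prob_space) integral_exp_power_mean:
  fixes X :: "'a \<Rightarrow> real"
  assumes X: "integrable M (\<lambda>x. exp (X x))" and pX: "integrable M (\<lambda>x. exp (p * X x))" and p: "1 \<le> p"
    and pos: "0 < (\<integral>x. exp (X x) \<partial>M)" "0 < (\<integral>x. exp (p * X x) \<partial>M)"
  shows "p * ln (\<integral>x. exp (X x) \<partial>M) \<le> ln (\<integral>x. exp (p * X x) \<partial>M)"
proof -
  define m where "m = ln (\<integral>x. exp (X x) \<partial>M)"
  have em: "(\<integral>x. exp (X x) \<partial>M) = exp m" using pos by (simp add: m_def)
  have tangent: "1 + p * (exp z - 1) \<le> exp (p * z)" for z :: real
  proof -
    have "exp ((1 - 1 / p) * 0 + (1 / p) * (p * z)) \<le> (1 - 1 / p) * exp 0 + (1 / p) * exp (p * z)"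
      using convex_onD[OF exp_convex, of "1 / p" 0 "p * z"] p by simp
    then have "p * exp z \<le> p * ((1 - 1 / p) * exp 0 + (1 / p) * exp (p * z))" using p by simp
    also have "\<dots> = p - 1 + exp (p * z)" using p by (simp add: field_simps)
    finally show ?thesis by (simp add: algebra_simps)
  qed
  define c where "c = exp (- m)"
  have "exp (X x - m) = exp (X x) * c" for x by (simp add: c_def exp_diff exp_minus field_simps)
  then have "exp (p * m) * (1 + p * (exp (X x) * c - 1)) \<le> exp (p * X x)" for x
    using mult_left_mono[OF tangent[of "X x - m"], of "exp (p * m)"]
    by (simp add: mult_exp_exp right_diff_distrib)
  then have "(\<integral>x. exp (p * m) * (1 + p * (exp (X x) * c - 1)) \<partial>M) \<le> (\<integral>x. exp (p * X x) \<partial>M)"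
    using X pX by (intro integral_mono) auto
  moreover have "(\<integral>x. exp (p * m) * (1 + p * (exp (X x) * c - 1)) \<partial>M) = exp (p * m)"
  proof -
    have "exp m * c = 1" by (simp add: c_def mult_exp_exp)
    then show ?thesis using X by (simp add: prob_space em)
  qed
  ultimately have "exp (p * m) \<le> (\<integral>x. exp (p * X x) \<partial>M)" by simp
  then show ?thesis using pos(2) by (simp add: m_def ln_ge_iff)
qed

context separated_field
begin

lemma orbit_sum:
  fixes f :: "'o \<Rightarrow> real \<Rightarrow> real"
  assumes T: "0 \<le> T" and w: "\<omega> \<in> space Q" and c: "continuous_on UNIV (f \<omega>)"
    and shift: "\<And>k s. 0 \<le> s \<Longrightarrow> f \<omega> (real k * T + s) = f ((\<tau> T ^^ k) \<omega>) s"
  shows "(LINT s:{0..real n * T}|lborel. f \<omega> s) = (\<Sum>k<n. LINT s:{0..T}|lborel. f ((\<tau> T ^^ k) \<omega>) s)"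
proof (induction n)
  case 0
  have "set_lebesgue_integral lborel {0..0} (f \<omega>) = 0"
    using LINT_combine[of 0 0 0 "f \<omega>"] continuous_on_subset[OF c] by simp
  then show ?case by simp
next
  case (Suc n)
  have "(LINT s:{0..real (Suc n) * T}|lborel. f \<omega> s)
      = (LINT s:{0..real n * T}|lborel. f \<omega> s) + (LINT s:{real n * T..real (Suc n) * T}|lborel. f \<omega> s)"
    using T continuous_on_subset[OF c] by (intro LINT_combine) (auto intro!: mult_right_mono)
  also have "(LINT s:{real n * T..real (Suc n) * T}|lborel. f \<omega> s) = (LINT s:{0..T}|lborel. f \<omega> (real n * T + s))"
    using LINT_shift[of "real n * T" 0 T "f \<omega>"] by (simp add: algebra_simps)
  also have "\<dots> = (LINT s:{0..T}|lborel. f ((\<tau> T ^^ n) \<omega>) s)"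
    using shift by (intro set_lebesgue_integral_cong) auto
  finally show ?case using Suc by simp
qed

lemma budget_orbit_sum:
  "0 \<le> T \<Longrightarrow> \<omega> \<in> space Q \<Longrightarrow> budget (S lam \<omega>) 0 (real n * T) = (\<Sum>k<n. budget (S lam ((\<tau> T ^^ k) \<omega>)) 0 T)"
  unfolding budget_def by (rule orbit_sum) (auto simp: S_iter intro: controlled_S_continuous[OF controlled_V] continuous_on_id)

lemma rho_limit_seq:
  assumes T: "0 < T"
  shows "AE \<omega> in Q. \<forall>y. (\<lambda>n. ln (fk1 (V lam \<omega>) (real n * T) y) / n) \<longlonglongrightarrow> T * \<rho> lam"
  using rho_limit[of lam]
proof eventually_elim
  case (elim \<omega>)
  show ?case
  proof
    fix y
    have "filterlim (\<lambda>n. real n * T) at_top sequentially"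
      by (rule filterlim_at_top_mult_tendsto_pos[OF tendsto_const T filterlim_real_sequentially])
    then have "(\<lambda>n. ln (fk1 (V lam \<omega>) (real n * T) y) / (real n * T)) \<longlonglongrightarrow> \<rho> lam"
      by (rule filterlim_compose[OF elim[rule_format, of y]])
    from tendsto_mult[OF tendsto_const[of T] this]
    show "(\<lambda>n. ln (fk1 (V lam \<omega>) (real n * T) y) / n) \<longlonglongrightarrow> T * \<rho> lam"
      using T by simp
  qed
qed

definition mean_gap :: "real \<Rightarrow> real \<Rightarrow> real \<Rightarrow> 'o \<Rightarrow> real" where
  "mean_gap lam r k \<omega> = (\<integral>y. swap_gap (V lam \<omega>) r k y \<partial>cell_unif L)"

lemma mean_gap_bounds:
  assumes w: "\<omega> \<in> space Q" and r: "0 \<le> r" "0 \<le> k"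
  shows "0 \<le> mean_gap lam r k \<omega>" "mean_gap lam r k \<omega> \<le> budget (S lam \<omega>) 0 (r + k)"
proof -
  interpret U: prob_space "cell_unif L :: (real ^ 'd) measure" by (rule prob_space_cell_unif[OF L_pos])
  note b = swap_gap_bounds[OF controlled_V[OF w] r, of lam]
  have i: "integrable (cell_unif L) (swap_gap (V lam \<omega>) r k)"
    using b swap_gap_measurable[OF controlled_V[OF w] r]
    by (intro U.integrable_const_bound[of _ "budget (S lam \<omega>) 0 (r + k)"]) auto
  show "0 \<le> mean_gap lam r k \<omega>"
    unfolding mean_gap_def using b by (intro integral_nonneg_AE) auto
  have "mean_gap lam r k \<omega> \<le> (\<integral>y. budget (S lam \<omega>) 0 (r + k) \<partial>(cell_unif L :: (real ^ 'd) measure))"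
    unfolding mean_gap_def by (rule integral_mono[OF i]) (auto intro: b)
  then show "mean_gap lam r k \<omega> \<le> budget (S lam \<omega>) 0 (r + k)" using U.prob_space by simp
qed

lemma mean_gap_integrable:
  assumes r: "0 \<le> r" "0 \<le> k"
  shows "integrable Q (mean_gap lam r k)"
proof (rule Bochner_Integration.integrable_bound[OF budget_integrable[of lam 0 "r + k"]])
  interpret U: prob_space "cell_unif L :: (real ^ 'd) measure" by (rule prob_space_cell_unif[OF L_pos])
  note [measurable (raw)] = swap_gap_V_measurable[OF _ _ r]
  show "mean_gap lam r k \<in> borel_measurable Q"
    unfolding mean_gap_def[abs_def] by measurable
  show "AE \<omega> in Q. norm (mean_gap lam r k \<omega>) \<le> norm (budget (S lam \<omega>) 0 (r + k))"
    using mean_gap_bounds[OF _ r, of _ lam] by (intro AE_I2) (auto intro: order_trans[OF _ abs_ge_self])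
qed

definition h_mean :: "real ^ 'd \<Rightarrow> real" where
  "h_mean p = (\<integral>y. h p y \<partial>cell_unif L)"

lemma V_cell_average: "(\<integral>y. V lam \<omega> y s \<partial>cell_unif L) = (\<Sum>p\<in>P. - lam * h_mean p * B p s \<omega>)"
proof -
  interpret U: prob_space "cell_unif L :: (real ^ 'd) measure" by (rule prob_space_cell_unif[OF L_pos])
  have "integrable (cell_unif L) (h p)" if "p \<in> P" for p
    using h_le[OF that] borel_measurable_continuous_onI[OF C01_periodic_continuous[OF h[OF that]]]
    by (intro U.integrable_const_bound) auto
  then have "(\<integral>y. (\<Sum>p\<in>P. h p y * B p s \<omega>) \<partial>cell_unif L) = (\<Sum>p\<in>P. h_mean p * B p s \<omega>)"
    by (subst Bochner_Integration.integral_sum) (auto simp: h_mean_def)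
  then have "(\<integral>y. V lam \<omega> y s \<partial>cell_unif L) = - lam * (\<Sum>p\<in>P. h_mean p * B p s \<omega>)"
    unfolding V_def by (simp only: integral_mult_right_zero)
  then show ?thesis by (simp only: sum_distrib_left mult.assoc)
qed

text \<open>The gain applies to each time step with \<open>v\<close> the logarithm of the solution reached so far.\<close>

lemma cell_average_step:
  assumes w: "\<omega> \<in> space Q" and r: "0 \<le> r" "0 \<le> k" and T: "T = r + k"
  shows "(LINT s:{0..T}|lborel. (\<Sum>p\<in>P. - lam * h_mean p * B p s ((\<tau> T ^^ n) \<omega>))) + mean_gap lam r k ((\<tau> T ^^ n) \<omega>)
     + (\<integral>y. ln (fk1 (V lam \<omega>) (real n * T) y) \<partial>cell_unif L)
     \<le> (\<integral>y. ln (fk1 (V lam \<omega>) (real (Suc n) * T) y) \<partial>cell_unif L)"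
proof -
  let ?t = "real n * T"
  have T0: "0 \<le> T" "0 \<le> ?t" using r T by auto
  let ?V = "\<lambda>y s. V lam \<omega> y (?t + s)"
  note cV = controlled_V[OF w, of lam]
  note cV' = controlled_shift[OF cV, of ?t]
  let ?v = "\<lambda>y. ln (fk1 (V lam \<omega>) ?t y)"
  have v: "?v \<in> borel_measurable borel"
    by (intro borel_measurable_ln fk1_measurable[OF cV T0(2)])
  have per1: "cell_periodic L (fk1 (V lam \<omega>) ?t)"
    by (rule fk_periodic[OF V_periodic]) (simp add: cell_periodic_def)
  have perv: "cell_periodic L ?v" using per1 by (simp add: cell_periodic_def)
  have avg: "(\<integral>y. V lam \<omega> y (?t + s) \<partial>cell_unif L) = (\<Sum>p\<in>P. - lam * h_mean p * B p (?t + s) \<omega>)" for s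
    by (rule V_cell_average)
  have cont: "continuous_on UNIV (\<lambda>s. \<integral>y. V lam \<omega> y (?t + s) \<partial>cell_unif L)"
    unfolding avg
    by (intro continuous_intros continuous_on_compose2[OF B_continuous[OF w, of UNIV]]) auto
  have "(LINT s:{0..r + k}|lborel. (\<integral>y. V lam \<omega> y (?t + s) \<partial>cell_unif L)) + (\<integral>y. swap_gap ?V r k y \<partial>cell_unif L)
      + (\<integral>y. ?v y \<partial>cell_unif L) \<le> (\<integral>y. ln (fk ?V (r + k) (\<lambda>x. exp (?v x)) y) \<partial>cell_unif L)"
    by (rule cell_average_gain[OF L_pos cV' V_periodic cont r v fk1_bounds(5)[OF cV T0(2)] perv])
  also have "(\<lambda>x. exp (?v x)) = fk1 (V lam \<omega>) ?t"
    using fk1_bounds(3)[OF cV T0(2)] by simp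
  also have "fk ?V (r + k) (fk1 (V lam \<omega>) ?t) = fk1 (V lam \<omega>) (real (Suc n) * T)"
  proof -
    have "real (Suc n) * T = T + ?t" by (simp add: algebra_simps)
    then show ?thesis unfolding T[symmetric] using fk1_step[OF cV T0(1) T0(2)] by (auto simp only: fun_eq_iff)
  qed
  also have "(\<integral>y. swap_gap ?V r k y \<partial>cell_unif L) = mean_gap lam r k ((\<tau> T ^^ n) \<omega>)"
    unfolding mean_gap_def
    by (intro Bochner_Integration.integral_cong swap_gap_cong_potential r V_iter[OF T0(1) _ w]) auto
  also have "(LINT s:{0..r + k}|lborel. (\<integral>y. V lam \<omega> y (?t + s) \<partial>cell_unif L))
     = (LINT s:{0..T}|lborel. (\<Sum>p\<in>P. - lam * h_mean p * B p s ((\<tau> T ^^ n) \<omega>)))"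
    unfolding avg T[symmetric] using B_iter[OF T0(1) _ w]
    by (intro set_lebesgue_integral_cong) auto
  finally show ?thesis .
qed

text \<open>Summing the gains of the time steps and dividing by their number, the cell averages of the potential
contribute their mean, which is 0. On the other side the averaged logarithms converge by dominated
convergence, with the orbit averages of the budgets as bound.\<close>

lemma rho_ge_mean_gap:
  assumes r: "0 < r" "0 \<le> k" and T: "T = r + k"
  shows "(\<integral>\<omega>. mean_gap lam r k \<omega> \<partial>Q) \<le> T * \<rho> lam"
proof -
  interpret U: prob_space "cell_unif L :: (real ^ 'd) measure" by (rule prob_space_cell_unif[OF L_pos])
  have r': "0 \<le> r" and T0: "0 < T" "0 \<le> T" using r T by auto
  let ?I = "\<lambda>\<omega>. LINT s:{0..T}|lborel. (\<Sum>p\<in>P. - lam * h_mean p * B p s \<omega>)"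
  have "integrable Q (\<lambda>\<omega>. ?I \<omega> + mean_gap lam r k \<omega>)"
    using B_combination_mean_zero(1) mean_gap_integrable[OF r' r(2)] by (rule Bochner_Integration.integrable_add)
  from birkhoff[OF T0(1) this] birkhoff[OF T0(1) budget_integrable[of lam 0 T]] rho_limit_seq[OF T0(1), of lam] AE_space
  have "AE \<omega> in Q. (\<integral>\<omega>. ?I \<omega> + mean_gap lam r k \<omega> \<partial>Q) \<le> T * \<rho> lam"
  proof eventually_elim
    case (elim \<omega>)
    have w: "\<omega> \<in> space Q" by fact
    note cV = controlled_V[OF w, of lam]
    let ?G = "\<lambda>n. \<Sum>j<n. ?I ((\<tau> T ^^ j) \<omega>) + mean_gap lam r k ((\<tau> T ^^ j) \<omega>)"
    let ?L = "\<lambda>n. \<integral>y. ln (fk1 (V lam \<omega>) (real n * T) y) \<partial>cell_unif L"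
    have le: "?G n \<le> ?L n" for n
    proof (induction n)
      case 0
      have "budget (S lam \<omega>) 0 0 = 0" using budget_combine[OF cV, of 0 0 0] by simp
      then have "ln (fk1 (V lam \<omega>) 0 y) = 0" for y using fk1_bounds(5)[OF cV, of 0 y] by simp
      then show ?case by simp
    next
      case (Suc n)
      then show ?case using cell_average_step[OF w r' r(2) T, of lam n] by simp
    qed
    obtain K where K: "\<And>n. norm ((\<Sum>j<n. budget (S lam ((\<tau> T ^^ j) \<omega>)) 0 T) / real n) \<le> K"
      using convergent_imp_Bseq[OF convergentI[OF elim(2)]] by (auto simp: Bseq_def)
    have "(\<lambda>n. \<integral>y. ln (fk1 (V lam \<omega>) (real n * T) y) / n \<partial>cell_unif L) \<longlonglongrightarrow> (\<integral>y. T * \<rho> lam \<partial>(cell_unif L :: (real ^ 'd) measure))"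
    proof (rule integral_dominated_convergence[where w = "\<lambda>_ :: real ^ 'd. K"])
      show "(\<lambda>y. ln (fk1 (V lam \<omega>) (real n * T) y) / n) \<in> borel_measurable (cell_unif L)" for n
        using fk1_measurable[OF cV, of "real n * T"] T0 by simp
      show "AE y in cell_unif L. norm (ln (fk1 (V lam \<omega>) (real n * T) y) / n) \<le> K" for n
      proof (intro AE_I2)
        fix y
        have "\<bar>ln (fk1 (V lam \<omega>) (real n * T) y)\<bar> \<le> (\<Sum>j<n. budget (S lam ((\<tau> T ^^ j) \<omega>)) 0 T)"
          using fk1_bounds(5)[OF cV, of "real n * T" y] T0 by (simp add: budget_orbit_sum[OF T0(2) w])
        then have "norm (ln (fk1 (V lam \<omega>) (real n * T) y) / n) \<le> (\<Sum>j<n. budget (S lam ((\<tau> T ^^ j) \<omega>)) 0 T) / n"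
          by (simp add: abs_divide divide_right_mono)
        then show "norm (ln (fk1 (V lam \<omega>) (real n * T) y) / n) \<le> K"
          using K[of n] unfolding real_norm_def by linarith
      qed
    next
      show "AE y in cell_unif L. (\<lambda>n. ln (fk1 (V lam \<omega>) (real n * T) y) / n) \<longlonglongrightarrow> T * \<rho> lam"
        using elim(3) by simp
    qed auto
    then have lim: "(\<lambda>n. ?L n / n) \<longlonglongrightarrow> T * \<rho> lam"
      using U.prob_space by simp
    have "?G n / n \<le> ?L n / n" for n using le by (intro divide_right_mono) auto
    then show ?case by (intro LIMSEQ_le[OF elim(1) lim]) blast
  qed
  then have "(\<integral>\<omega>. ?I \<omega> + mean_gap lam r k \<omega> \<partial>Q) \<le> T * \<rho> lam" by simp
  moreover have "(\<integral>\<omega>. ?I \<omega> + mean_gap lam r k \<omega> \<partial>Q) = (\<integral>\<omega>. mean_gap lam r k \<omega> \<partial>Q)"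
    by (subst Bochner_Integration.integral_add[OF B_combination_mean_zero(1) mean_gap_integrable[OF r' r(2)]])
       (simp only: B_combination_mean_zero(2) add_0)
  ultimately show ?thesis by simp
qed

lemma rho_nonneg: "0 \<le> \<rho> lam"
proof -
  have "0 \<le> (\<integral>\<omega>. mean_gap lam 1 0 \<omega> \<partial>Q)"
    using mean_gap_bounds(1)[of _ 1 0 lam] by (intro integral_nonneg_AE AE_I2) auto
  also have "\<dots> \<le> 1 * \<rho> lam" by (rule rho_ge_mean_gap) auto
  finally show ?thesis by simp
qed

lemma rho_superlinear:
  assumes m: "1 \<le> p" shows "p * \<rho> lam \<le> \<rho> (p * lam)"
proof -
  have "AE \<omega> in Q. p * \<rho> lam \<le> \<rho> (p * lam)"
    using rho_limit[of lam] rho_limit[of "p * lam"] AE_space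
  proof eventually_elim
    case (elim \<omega>)
    have w: "\<omega> \<in> space Q" by fact
    have le: "p * (ln (fk1 (V lam \<omega>) t 0) / t) \<le> ln (fk1 (V (p * lam) \<omega>) t 0) / t" if t: "0 < t" for t
    proof -
      have t0: "0 \<le> t" using t by simp
      have Vp: "V (p * lam) \<omega> y s = p * V lam \<omega> y s" for y s by (simp add: V_def)
      let ?X = "\<lambda>u. LINT s:{0..t}|lborel. V lam \<omega> (0 + W s u) (t - s)"
      have fk: "fk1 (V lam \<omega>) t 0 = (\<integral>u. exp (?X u) \<partial>M)" "fk1 (V (p * lam) \<omega>) t 0 = (\<integral>u. exp (p * ?X u) \<partial>M)"
        by (simp_all add: fk_def Vp)
      have i: "integrable M (\<lambda>u. exp (?X u))" "integrable M (\<lambda>u. exp (p * ?X u))"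
        using fk_integrable[OF controlled_V[OF w, of lam] t0, of "\<lambda>_. 1" 1 0]
          fk_integrable[OF controlled_V[OF w, of "p * lam"] t0, of "\<lambda>_. 1" 1 0] by (simp_all add: Vp)
      have "p * ln (\<integral>u. exp (?X u) \<partial>M) \<le> ln (\<integral>u. exp (p * ?X u) \<partial>M)"
        by (rule integral_exp_power_mean[OF i m])
           (use fk fk1_bounds(3)[OF controlled_V[OF w] t0, of _ 0] in metis)+
      then show ?thesis using t unfolding fk by (simp add: divide_right_mono)
    qed
    have "((\<lambda>t. p * (ln (fk1 (V lam \<omega>) t 0) / t)) \<longlongrightarrow> p * \<rho> lam) at_top"
      using elim(1) by (intro tendsto_mult tendsto_const) auto
    moreover have "((\<lambda>t. ln (fk1 (V (p * lam) \<omega>) t 0) / t) \<longlongrightarrow> \<rho> (p * lam)) at_top"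
      using elim(2) by auto
    moreover have "\<forall>\<^sub>F t in at_top. p * (ln (fk1 (V lam \<omega>) t 0) / t) \<le> ln (fk1 (V (p * lam) \<omega>) t 0) / t"
      using eventually_gt_at_top[of 0] by eventually_elim (rule le)
    ultimately show ?case by (intro tendsto_le[OF trivial_limit_at_top_linorder])
  qed
  then show ?thesis by simp
qed

text \<open>The path drops out and the logarithm of the solution is the time integral of a stationary ergodic
process of mean 0.\<close>

lemma rho_eq_0_if_shear_free:
  assumes "AE \<omega> in Q. \<forall>t\<ge>0. \<forall>y y'. b y t \<omega> = b y' t \<omega>"
  shows "\<rho> lam = 0"
proof -
  let ?k = "\<lambda>p. - lam * h p 0"
  let ?I = "\<lambda>\<omega>. LINT s:{0..1}|lborel. (\<Sum>p\<in>P. ?k p * B p s \<omega>)"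
  have "AE \<omega> in Q. \<rho> lam = 0"
    using assms birkhoff[OF zero_less_one B_combination_mean_zero(1)[of 0 1 ?k]] rho_limit_seq[OF zero_less_one, of lam] AE_space
  proof eventually_elim
    case (elim \<omega>)
    have w: "\<omega> \<in> space Q" by fact
    have V0: "V lam \<omega> y s = (\<Sum>p\<in>P. ?k p * B p s \<omega>)" if "0 \<le> s" for y s
    proof -
      have "V lam \<omega> y s = V lam \<omega> 0 s" using elim(1) that w by (auto simp: V_eq)
      then show ?thesis by (simp add: V_def sum_distrib_left mult.assoc sum_negf)
    qed
    have "ln (fk1 (V lam \<omega>) (real n) 0) = (\<Sum>j<n. ?I ((\<tau> 1 ^^ j) \<omega>))" for n
    proof -
      let ?f = "\<lambda>s. \<Sum>p\<in>P. ?k p * B p s \<omega>"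
      have "(LINT s:{0..real n}|lborel. V lam \<omega> (0 + W s u) (real n - s)) = (LINT s:{0..real n}|lborel. ?f (real n - s))" for u
        by (intro set_lebesgue_integral_cong) (auto simp: V0)
      then have "fk1 (V lam \<omega>) (real n) 0 = exp (LINT s:{0..real n}|lborel. ?f (real n - s))"
        by (simp add: fk_def prob_space)
      then have "ln (fk1 (V lam \<omega>) (real n) 0) = (LINT s:{0..real n}|lborel. ?f (real n - s))" by simp
      also have "\<dots> = (LINT s:{0..real n * 1}|lborel. ?f s)" using LINT_reverse[where f = ?f] by simp
      also have "\<dots> = (\<Sum>j<n. ?I ((\<tau> 1 ^^ j) \<omega>))"
      proof (rule orbit_sum[where f = "\<lambda>\<omega> s. \<Sum>p\<in>P. ?k p * B p s \<omega>"])
        show "(\<Sum>p\<in>P. ?k p * B p (real k * 1 + s) \<omega>) = (\<Sum>p\<in>P. ?k p * B p s ((\<tau> 1 ^^ k) \<omega>))"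
          if "0 \<le> s" for k s
          using B_iter[of 1 s \<omega> _ k] that w by simp
      qed (use w in \<open>auto intro!: continuous_intros B_continuous\<close>)
      finally show ?thesis .
    qed
    then have "(\<lambda>n. (\<Sum>j<n. ?I ((\<tau> 1 ^^ j) \<omega>)) / real n) \<longlonglongrightarrow> 1 * \<rho> lam"
      using elim(3)[rule_format, of 0] by simp
    from LIMSEQ_unique[OF this elim(2)] show ?case
      unfolding B_combination_mean_zero(2) by simp
  qed
  then show ?thesis by simp
qed

lemma V_modulus:
  assumes w: "\<omega> \<in> space Q" and e: "0 < e"
  shows "\<exists>d>0. \<forall>y z t. dist y z < d \<longrightarrow> 0 \<le> t \<longrightarrow> t < d \<longrightarrow> \<bar>V 1 \<omega> y t - V 1 \<omega> z 0\<bar> \<le> e"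
proof -
  have C: "(\<lambda>y. b y s \<omega>) \<in> C01_periodic L" if "0 \<le> s" for s using F.A1 w that by auto
  have "((\<lambda>s. C01_norm (\<lambda>y. b y s \<omega> - b y 0 \<omega>)) \<longlongrightarrow> 0) (at 0 within {0..})"
    using F.A1 w by auto
  then have "\<forall>\<^sub>F s in at 0 within {0..}. dist (C01_norm (\<lambda>y. b y s \<omega> - b y 0 \<omega>)) 0 < e / 2"
    using e by (intro tendstoD) auto
  then obtain d1 where d1: "0 < d1" "\<And>s. 0 \<le> s \<Longrightarrow> s \<noteq> 0 \<Longrightarrow> dist s 0 < d1 \<Longrightarrow> dist (C01_norm (\<lambda>y. b y s \<omega> - b y 0 \<omega>)) 0 < e / 2"
    unfolding eventually_at atLeast_iff by blast
  obtain K where K: "K-lipschitz_on UNIV (\<lambda>y. b y 0 \<omega>)" using C[of 0] by (auto simp: C01_periodic_def)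
  have K0: "0 \<le> K" using lipschitz_on_nonneg[OF K] .
  define d where "d = min d1 (e / (2 * (K + 1)))"
  have d: "0 < d" using d1 e K0 by (simp add: d_def)
  have "\<bar>V 1 \<omega> y t - V 1 \<omega> z 0\<bar> \<le> e" if "dist y z < d" "0 \<le> t" "t < d" for y z t
  proof -
    have "\<bar>b y t \<omega> - b y 0 \<omega>\<bar> \<le> e / 2"
    proof (cases "t = 0")
      case False
      have "\<bar>b y t \<omega> - b y 0 \<omega>\<bar> \<le> C01_norm (\<lambda>y. b y t \<omega> - b y 0 \<omega>)"
        using abs_le_C01_norm[OF L_pos C01_periodic_lin[OF C[OF that(2)] C[of 0], of "- 1"], of y] by simp
      then show ?thesis using d1(2)[of t] False that by (simp add: d_def dist_real_def)
    qed (use e in simp)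
    moreover have "\<bar>b y 0 \<omega> - b z 0 \<omega>\<bar> \<le> e / 2"
    proof -
      have "\<bar>b y 0 \<omega> - b z 0 \<omega>\<bar> \<le> K * dist y z" using lipschitz_onD[OF K, of y z] by (simp add: dist_real_def)
      also have "\<dots> \<le> (K + 1) * d" using that K0 by (intro mult_mono) auto
      also have "\<dots> \<le> (K + 1) * (e / (2 * (K + 1)))" using K0 by (intro mult_left_mono) (auto simp: d_def)
      also have "\<dots> = e / 2" using K0 by (simp add: field_simps)
      finally show ?thesis .
    qed
    ultimately have "\<bar>b z 0 \<omega> - b y t \<omega>\<bar> \<le> e" by linarith
    then show ?thesis using that w by (simp add: V_eq)
  qed
  with d show ?thesis by blast
qed

text \<open>A vanishing exponent leaves no room for a gain, so almost surely the field at time 0 is constant in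
space. Stationarity carries this to every single time, and continuity to all times at once.\<close>

lemma shear_free_if_rho_eq_0:
  assumes "\<rho> 1 \<le> 0"
  shows "AE \<omega> in Q. \<forall>t\<ge>0. \<forall>y y'. b y t \<omega> = b y' t \<omega>"
proof -
  have "AE \<omega> in Q. mean_gap 1 (1 / Suc n) (1 / Suc n * (1 / Suc n)) \<omega> = 0" for n
  proof -
    let ?r = "1 / real (Suc n)"
    have r: "0 < ?r" "0 \<le> ?r" "0 \<le> ?r * ?r" by auto
    have nn: "AE \<omega> in Q. 0 \<le> mean_gap 1 ?r (?r * ?r) \<omega>"
      using mean_gap_bounds(1)[OF _ r(2,3)] by (intro AE_I2) auto
    have "(\<integral>\<omega>. mean_gap 1 ?r (?r * ?r) \<omega> \<partial>Q) \<le> (?r + ?r * ?r) * \<rho> 1"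
      by (rule rho_ge_mean_gap[OF r(1,3) refl])
    also have "\<dots> \<le> 0" using assms r by (intro mult_nonneg_nonpos) auto
    finally have "(\<integral>\<omega>. mean_gap 1 ?r (?r * ?r) \<omega> \<partial>Q) = 0"
      using integral_nonneg_AE[OF nn] by simp
    then show ?thesis
      using integral_nonneg_eq_0_iff_AE[OF mean_gap_integrable[OF r(2,3)] nn] by simp
  qed
  then have "AE \<omega> in Q. \<forall>n. mean_gap 1 (1 / Suc n) (1 / Suc n * (1 / Suc n)) \<omega> = 0"
    by (simp add: AE_all_countable)
  then have AE0: "AE \<omega> in Q. \<forall>y y'. b y 0 \<omega> = b y' 0 \<omega>"
    using AE_space
  proof eventually_elim
    case (elim \<omega>)
    show ?case
    proof (intro allI, rule ccontr)
      fix y y' assume "b y 0 \<omega> \<noteq> b y' 0 \<omega>"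
      then have "V 1 \<omega> y 0 \<noteq> V 1 \<omega> y' 0" using elim(2) by (simp add: V_eq)
      from swap_gap_pos[OF L_pos controlled_V[OF elim(2)] V_periodic V_modulus[OF elim(2)] this]
      show False using elim(1) unfolding mean_gap_def by (metis less_irrefl)
    qed
  qed
  have AEt: "AE \<omega> in Q. \<forall>y y'. B y t \<omega> = B y' t \<omega>" for t
  proof -
    have t: "0 \<le> max 0 t" by simp
    have m: "\<tau> (max 0 t) \<in> measurable Q Q" and d: "distr Q Q (\<tau> (max 0 t)) = Q"
      using F.A2 t by blast+
    have "AE \<omega> in distr Q Q (\<tau> (max 0 t)). \<forall>y y'. b y 0 \<omega> = b y' 0 \<omega>"
      unfolding d by (rule AE0)
    then have "AE \<omega> in Q. \<forall>y y'. b y 0 (\<tau> (max 0 t) \<omega>) = b y' 0 (\<tau> (max 0 t) \<omega>)"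
      by (rule AE_distrD[OF m])
    then show ?thesis
      using AE_space
    proof eventually_elim
      case (elim \<omega>)
      have "b y 0 (\<tau> (max 0 t) \<omega>) = B y t \<omega>" for y
        using F.A2[rule_format, OF t, THEN conjunct2, THEN conjunct2, rule_format, OF elim(2), of 0 y] by (simp add: B_def)
      then show ?case using elim(1) by simp
    qed
  qed
  have "AE \<omega> in Q. \<forall>t\<in>\<rat>. \<forall>y y'. B y t \<omega> = B y' t \<omega>"
    using AEt by (subst AE_ball_countable[OF countable_rat]) auto
  then show ?thesis
    using AE_space
  proof eventually_elim
    case (elim \<omega>)
    show ?case
    proof (intro allI impI)
      fix t :: real and y y' assume t: "0 \<le> t"
      have "B y t \<omega> - B y' t \<omega> = 0"
      proof (rule continuous_constant_on_closure[of "\<rat>" "\<lambda>t. B y t \<omega> - B y' t \<omega>" 0 t])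
        show "continuous_on (closure \<rat>) (\<lambda>t. B y t \<omega> - B y' t \<omega>)"
          by (intro continuous_intros B_continuous elim)
        show "B y x \<omega> - B y' x \<omega> = 0" if "x \<in> \<rat>" for x
        proof -
          have "B y x \<omega> = B y' x \<omega>" using elim(1) that by blast
          then show ?thesis by simp
        qed
        show "t \<in> closure \<rat>" by (simp add: Rats_closure_real)
      qed
      then show "b y t \<omega> = b y' t \<omega>" using t by (simp add: B_def)
    qed
  qed
qed

end

section \<open>The front speed\<close>

text \<open>The supremum of \<open>f u / u\<close> is a genuine one because \<open>f\<close> is Lipschitz and vanishes at 0.\<close>

lemma kpp_slope_pos:
  assumes "kpp_nonlinearity f df"
  shows "0 < df 0"
proof -
  have d: "\<And>u. u \<in> {0..1} \<Longrightarrow> (f has_real_derivative df u) (at u within {0..1})"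
    and c: "continuous_on {0..1} df" and f0: "f 0 = 0" and pos: "\<And>u. u \<in> {0<..<1} \<Longrightarrow> f u > 0"
    and sup: "df 0 = (SUP u\<in>{0<..<1}. f u / u)"
    using assms unfolding kpp_nonlinearity_def by auto
  have "bounded (df ` {0..1})" by (intro compact_imp_bounded compact_continuous_image c) auto
  then obtain K where "\<forall>u\<in>{0..1}. norm (df u) \<le> K" by (auto simp: bounded_iff)
  then have K: "\<And>u. u \<in> {0..1} \<Longrightarrow> norm (df u) \<le> K" by blast
  have "f u / u \<le> K" if "u \<in> {0<..<1}" for u
  proof -
    have "norm (f u - f 0) \<le> K * norm (u - 0)"
      by (rule field_differentiable_bound[of "{0..1}" f df]) (use d K that in auto)
    then have "f u \<le> K * u" using that f0 by simp
    then show ?thesis using that by (simp add: field_simps)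
  qed
  then have "bdd_above ((\<lambda>u. f u / u) ` {0<..<1})" by (rule bdd_aboveI2)
  from cSUP_upper[OF _ this, of "1 / 2"] have "f (1 / 2) / (1 / 2) \<le> df 0" by (simp add: sup)
  moreover have "0 < f (1 / 2)" by (rule pos) simp
  ultimately show ?thesis by simp
qed

context separated_field
begin

lemma mu_scaled_pos: "0 < a \<Longrightarrow> 0 < mu_scaled a Q M W b \<delta> lam"
  unfolding mu_scaled_def using rho_nonneg[of "\<delta> * lam"] by (intro add_pos_nonneg) auto

lemma front_speed_le:
  assumes "0 < a" "0 < lam"
  shows "front_speed a Q M W b \<delta> \<le> mu_scaled a Q M W b \<delta> lam / lam"
  unfolding front_speed_def
proof (rule cINF_lower)
  show "bdd_below ((\<lambda>lam. mu_scaled a Q M W b \<delta> lam / lam) ` {0<..})"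
    using mu_scaled_pos[OF assms(1)] by (intro bdd_belowI2[of _ 0]) (auto intro: less_imp_le)
qed (use assms in simp)

lemma front_speed_ge:
  assumes "\<And>lam. 0 < lam \<Longrightarrow> c \<le> mu_scaled a Q M W b \<delta> lam / lam"
  shows "c \<le> front_speed a Q M W b \<delta>"
  unfolding front_speed_def using assms by (intro cINF_greatest) auto

lemma speed_ratio_nonneg:
  assumes a: "0 < a" shows "0 \<le> speed_ratio_liminf a Q M W b"
  unfolding speed_ratio_liminf_def
proof (rule Liminf_bounded)
  show "\<forall>\<^sub>F \<delta> in at_top. 0 \<le> ereal (front_speed a Q M W b \<delta> / \<delta>)"
    using eventually_gt_at_top[of 0]
  proof eventually_elim
    case (elim \<delta>)
    have "0 \<le> front_speed a Q M W b \<delta>"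
      by (rule front_speed_ge) (use mu_scaled_pos[OF a] in \<open>auto intro!: divide_nonneg_nonneg less_imp_le\<close>)
    then show ?case using elim by simp
  qed
qed

lemma speed_ratio_finite:
  assumes a: "0 < a" shows "speed_ratio_liminf a Q M W b < \<infinity>"
proof -
  have "\<forall>\<^sub>F \<delta> in at_top. ereal (front_speed a Q M W b \<delta> / \<delta>) \<le> ereal (a + 1 + \<rho> 1)"
    using eventually_ge_at_top[of 1]
  proof eventually_elim
    case (elim \<delta>)
    have "front_speed a Q M W b \<delta> / \<delta> \<le> (mu_scaled a Q M W b \<delta> (1 / \<delta>) / (1 / \<delta>)) / \<delta>"
      using elim a by (intro divide_right_mono front_speed_le) auto
    also have "\<dots> = mu_scaled a Q M W b \<delta> (1 / \<delta>)" using elim by simp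
    also have "\<dots> = a + (1 / \<delta>)\<^sup>2 / 2 + \<rho> 1" using elim by (simp add: mu_scaled_def)
    also have "\<dots> \<le> a + 1 + \<rho> 1"
    proof -
      have "(1 / \<delta>)\<^sup>2 \<le> 1\<^sup>2" using elim by (intro power_mono) auto
      then show ?thesis by simp
    qed
    finally show ?case by simp
  qed
  then have "Limsup at_top (\<lambda>\<delta>. ereal (front_speed a Q M W b \<delta> / \<delta>)) \<le> ereal (a + 1 + \<rho> 1)"
    by (rule Limsup_bounded)
  moreover have "speed_ratio_liminf a Q M W b \<le> Limsup at_top (\<lambda>\<delta>. ereal (front_speed a Q M W b \<delta> / \<delta>))"
    unfolding speed_ratio_liminf_def by (rule Liminf_le_Limsup) simp
  ultimately show ?thesis by (meson ereal_less_PInfty le_less_trans less_ereal.simps(4) order_trans)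
qed

lemma speed_ratio_eq_0:
  assumes a: "0 < a" and rho: "\<And>lam. \<rho> lam = 0"
  shows "speed_ratio_liminf a Q M W b = 0"
proof (rule antisym[OF _ speed_ratio_nonneg[OF a]])
  have lim: "((\<lambda>\<delta>. ereal ((a + 1 / 2) / \<delta>)) \<longlongrightarrow> ereal 0) at_top"
    by (intro tendsto_ereal tendsto_divide_0[OF tendsto_const] filterlim_at_top_imp_at_infinity filterlim_ident)
  have "\<forall>\<^sub>F \<delta> in at_top. ereal (front_speed a Q M W b \<delta> / \<delta>) \<le> ereal ((a + 1 / 2) / \<delta>)"
    using eventually_gt_at_top[of 0]
  proof eventually_elim
    case (elim \<delta>)
    have "front_speed a Q M W b \<delta> \<le> a + 1 / 2"
      using front_speed_le[OF a zero_less_one, of \<delta>] by (simp add: mu_scaled_def rho)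
    then show ?case using elim by (simp add: divide_right_mono)
  qed
  then have "speed_ratio_liminf a Q M W b \<le> Liminf at_top (\<lambda>\<delta>. ereal ((a + 1 / 2) / \<delta>))"
    unfolding speed_ratio_liminf_def by (rule Liminf_mono)
  also have "\<dots> = 0"
    using lim_imp_Liminf[OF _ lim] by (simp add: zero_ereal_def)
  finally show "speed_ratio_liminf a Q M W b \<le> 0" .
qed

text \<open>With \<open>m = \<delta> * lam\<close> the quotient to be minimized is at least \<open>(a + \<rho> m) / m\<close>. This is at least \<open>a\<close> for
\<open>m \<le> 1\<close> and at least \<open>\<rho> 1\<close> for \<open>m \<ge> 1\<close>, where \<open>\<rho> m \<ge> m * \<rho> 1\<close>.\<close>

lemma speed_ratio_ge:
  assumes a: "0 < a"
  shows "ereal (min a (\<rho> 1)) \<le> speed_ratio_liminf a Q M W b"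
  unfolding speed_ratio_liminf_def
proof (rule Liminf_bounded)
  show "\<forall>\<^sub>F \<delta> in at_top. ereal (min a (\<rho> 1)) \<le> ereal (front_speed a Q M W b \<delta> / \<delta>)"
    using eventually_gt_at_top[of 0]
  proof eventually_elim
    case (elim \<delta>)
    have "min a (\<rho> 1) * \<delta> \<le> front_speed a Q M W b \<delta>"
    proof (rule front_speed_ge)
      fix lam :: real assume lam: "0 < lam"
      define m where "m = \<delta> * lam"
      have m: "0 < m" using lam elim by (simp add: m_def)
      have "min a (\<rho> 1) * m \<le> a + \<rho> m"
      proof (cases "m \<le> 1")
        case True
        have "min a (\<rho> 1) * m \<le> a * 1"
          using True m a by (intro mult_mono) auto
        then show ?thesis using rho_nonneg[of m] by simp
      next
        case False
        have "min a (\<rho> 1) * m \<le> m * \<rho> 1" using m by (simp add: mult.commute)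
        also have "\<dots> \<le> \<rho> (m * 1)" by (rule rho_superlinear) (use False in simp)
        finally show ?thesis using a by simp
      qed
      also have "\<dots> \<le> mu_scaled a Q M W b \<delta> lam" by (simp add: mu_scaled_def m_def)
      finally have "min a (\<rho> 1) * \<delta> * lam \<le> mu_scaled a Q M W b \<delta> lam" by (simp add: m_def mult.assoc)
      then show "min a (\<rho> 1) * \<delta> \<le> mu_scaled a Q M W b \<delta> lam / lam"
        using lam by (simp add: pos_le_divide_eq)
    qed
    then have "min a (\<rho> 1) \<le> front_speed a Q M W b \<delta> / \<delta>"
      using elim by (simp add: pos_le_divide_eq)
    then show ?case by (simp only: ereal_less_eq)
  qed
qed

theorem speed_ratio_eq_0_iff:
  assumes a: "0 < a"
  shows "speed_ratio_liminf a Q M W b = 0 \<longleftrightarrow> (AE \<omega> in Q. \<forall>t\<ge>0. \<forall>y y'. b y t \<omega> = b y' t \<omega>)"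
proof
  assume 0: "speed_ratio_liminf a Q M W b = 0"
  show "AE \<omega> in Q. \<forall>t\<ge>0. \<forall>y y'. b y t \<omega> = b y' t \<omega>"
  proof (rule shear_free_if_rho_eq_0)
    have "min a (\<rho> 1) \<le> 0" using speed_ratio_ge[OF a] unfolding 0 by (simp only: zero_ereal_def ereal_less_eq)
    then show "\<rho> 1 \<le> 0" using a by (simp add: min_le_iff_disj)
  qed
next
  assume "AE \<omega> in Q. \<forall>t\<ge>0. \<forall>y y'. b y t \<omega> = b y' t \<omega>"
  then show "speed_ratio_liminf a Q M W b = 0"
    by (intro speed_ratio_eq_0[OF a] rho_eq_0_if_shear_free)
qed

end

theorem proposition6p2:
  fixes f df :: "real \<Rightarrow> real"
    and L :: real
    and Q :: "'o measure"
    and M :: "'w measure"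
    and W :: "real \<Rightarrow> 'w \<Rightarrow> real ^ 'd"
    and b :: "real ^ 'd \<Rightarrow> real \<Rightarrow> 'o \<Rightarrow> real"
    and \<tau> :: "real \<Rightarrow> 'o \<Rightarrow> 'o"
    and N :: nat
    and b1 :: "nat \<Rightarrow> real ^ 'd \<Rightarrow> real"
    and b2 :: "nat \<Rightarrow> real \<Rightarrow> 'o \<Rightarrow> real"
  assumes kpp: "kpp_nonlinearity f df"
    and wiener: "wiener_process M W"
    and field: "random_shear_field Q L b \<tau>"
    and form: "\<And>y t \<omega>. t \<ge> 0 \<Longrightarrow> \<omega> \<in> space Q \<Longrightarrow> b y t \<omega> = (\<Sum>j=1..N. b1 j y * b2 j t \<omega>)"
    and b1: "\<And>j. j \<in> {1..N} \<Longrightarrow> b1 j \<in> C01_periodic L"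
    and b2_gaussian: "\<And>j. j \<in> {1..N} \<Longrightarrow> gaussian_process Q {0..} (b2 j)"
    and b2_stationary: "\<And>j. j \<in> {1..N} \<Longrightarrow> stationary_process Q (b2 j)"
    and b2_centered: "\<And>j t. j \<in> {1..N} \<Longrightarrow> t \<ge> 0 \<Longrightarrow> (\<integral>\<omega>. b2 j t \<omega> \<partial>Q) = 0"
  shows "0 \<le> speed_ratio_liminf (df 0) Q M W b \<and>
         speed_ratio_liminf (df 0) Q M W b < \<infinity> \<and>
         (speed_ratio_liminf (df 0) Q M W b = 0 \<longleftrightarrow>
            (AE \<omega> in Q. \<forall>t\<ge>0. \<forall>y y'. b y t \<omega> = b y' t \<omega>))"
proof -
  interpret F: random_shear_field Q L b \<tau> by (rule field)
  interpret Wi: wiener M W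
    using wiener by (auto simp: wiener_def wiener_axioms_def wiener_process_def)
  \<comment> \<open>The weights do not depend on the coefficients \<open>c j\<close>, so they serve all times and all \<open>\<omega>\<close> together.\<close>
  obtain P h where P: "finite P" "\<And>p. p \<in> P \<Longrightarrow> h p \<in> C01_periodic L"
    and sep: "\<And>c x. (\<Sum>j\<in>{1..N}. c j * b1 j x) = (\<Sum>p\<in>P. h p x * (\<Sum>j\<in>{1..N}. c j * b1 j p))"
    using finite_interpolation[of "{1..N}" "\<lambda>g. g \<in> C01_periodic L" b1, OF _ b1 C01_periodic_zero C01_periodic_lin]
    by blast
  interpret separated_field Q L b \<tau> M W P h
  proof unfold_locales
    show "b y t \<omega> = (\<Sum>p\<in>P. h p y * b p t \<omega>)" if "0 \<le> t" "\<omega> \<in> space Q" for y t \<omega>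
      using sep[of "\<lambda>j. b2 j t \<omega>" y] that by (simp add: form mult.commute)
  qed (use P in auto)
  have a: "0 < df 0" by (rule kpp_slope_pos[OF kpp])
  show ?thesis
    using speed_ratio_nonneg[OF a] speed_ratio_finite[OF a] speed_ratio_eq_0_iff[OF a] by blast
qed

end
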